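(* Let $n\ge1$ and $\eta(\xi)=\frac{|\xi|^2}{(1+|\xi|^2)^2}$ for $\xi\in\mathbb{R}^n$. Let $\sigma,s\in\mathbb{R}$ with $\sigma+s>0$, let $1\le r\le\infty$, $1\le p\le2$, and let $\ell\in\mathbb{R}$ satisfy $\ell>n\big(\frac1p-\frac12\big)$ (in the case $p=2$, $\ell\ge0$ is allowed). Then there is a constant $C>0$, independent of $f$ and $t$, such that for all $f\in\dot{B}^{\sigma+\ell}_{p,r}(\mathbb{R}^n)\cap\dot{B}^{-s}_{2,\infty}(\mathbb{R}^n)$ and all $t\ge0$, $$\Big\|2^{q\sigma}\big\|\widehat{\dot{\Delta}_qf}\,e^{-\eta(\xi)t}\big\|_{L^2}\Big\|_{\ell^r_q}\le C\Big((1+t)^{-\frac{\sigma+s}{2}}\|f\|_{\dot{B}^{-s}_{2,\infty}}+(1+t)^{-\frac{\ell}{2}+\frac n2(\frac1p-\frac12)}\|f\|_{\dot{B}^{\sigma+\ell}_{p,r}}\Big),$$ where the first term on the right is the low-frequency estimate (bounding the contribution of $q<0$) and the second one is the high-frequency estimate (bounding the contribution of $q\ge0$).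
   Context: $\widehat{\cdot}$ and $\mathcal{F}$ denote the Fourier transform on $\mathbb{R}^n$. Fix a smooth $\varphi:\mathbb{R}^n\to[0,1]$ (radial) supported in $\{\frac34\le|\xi|\le\frac83\}$ with $\sum_{q\in\mathbb{Z}}\varphi(2^{-q}\xi)=1$ for $\xi\ne0$, and set $\dot\Delta_qf=\mathcal{F}^{-1}(\varphi(2^{-q}\cdot)\mathcal{F}f)$, $q\in\mathbb{Z}$. For $s\in\mathbb{R}$, $1\le p,r\le\infty$, the homogeneous Besov space $\dot B^s_{p,r}$ is the set of tempered distributions modulo polynomials with finite norm $\|f\|_{\dot B^s_{p,r}}=\big\|(2^{qs}\|\dot\Delta_qf\|_{L^p})_{q\in\mathbb{Z}}\big\|_{\ell^r}$. The norm $\|\cdot\|_{\ell^r_q}$ is the $\ell^r$ norm over $q\in\mathbb{Z}$, and the inner $L^2$ norm is in $\xi$. *)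

theory Defs
  imports "HOL-Probability.Probability"
begin

section \<open>Lebesgue norms with values in the extended nonnegative reals\<close>

text \<open>Only used for positive exponents.\<close>

definition enn_powr :: "ennreal \<Rightarrow> real \<Rightarrow> ennreal" where
  "enn_powr x a = (if x = \<infinity> then \<infinity> else ennreal (enn2real x powr a))"

text \<open>The norm for exponents in \<open>[1, \<infinity>]\<close>; over \<^term>\<open>count_space I\<close> it is the sequence norm
  over the index set \<open>I\<close>.\<close>

definition lp_norm :: "'a measure \<Rightarrow> ennreal \<Rightarrow> ('a \<Rightarrow> ennreal) \<Rightarrow> ennreal" where
  "lp_norm M p f =
     (if p = \<infinity> then esssup M f
      else enn_powr (\<integral>\<^sup>+x. enn_powr (f x) (enn2real p) \<partial>M) (1 / enn2real p))"


section \<open>Smooth functions, Schwartz functions, tempered distributions\<close>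

definition pderivative :: "'n::finite \<Rightarrow> (real^'n \<Rightarrow> 'b::real_normed_vector) \<Rightarrow> real^'n \<Rightarrow> 'b" where
  "pderivative i f x = vector_derivative (\<lambda>h. f (x + h *\<^sub>R axis i 1)) (at 0)"

fun pderivatives :: "'n::finite list \<Rightarrow> (real^'n \<Rightarrow> 'b::real_normed_vector) \<Rightarrow> real^'n \<Rightarrow> 'b" where
  "pderivatives [] f = f"
| "pderivatives (i # is) f = pderivative i (pderivatives is f)"

definition smooth :: "(real^'n::finite \<Rightarrow> 'b::real_normed_vector) \<Rightarrow> bool" where
  "smooth f \<longleftrightarrow> (\<forall>is x. pderivatives is f differentiable (at x))"

definition schwartz :: "(real^'n::finite \<Rightarrow> complex) \<Rightarrow> bool" where
  "schwartz \<psi> \<longleftrightarrow> smooth \<psi> \<and>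
     (\<forall>N is. bounded (range (\<lambda>x. (1 + norm x) ^ N *\<^sub>R pderivatives is \<psi> x)))"

definition schwartz_seminorm :: "nat \<Rightarrow> 'n::finite list \<Rightarrow> (real^'n \<Rightarrow> complex) \<Rightarrow> real" where
  "schwartz_seminorm N is \<psi> = (SUP x. (1 + norm x) ^ N * norm (pderivatives is \<psi> x))"

text \<open>A distribution is a functional on all functions, of which only the values on Schwartz
  functions are ever used; its values elsewhere are irrelevant.\<close>

type_synonym 'n functional = "(real^'n \<Rightarrow> complex) \<Rightarrow> complex"

definition tempered :: "'n::finite functional \<Rightarrow> bool" where
  "tempered u \<longleftrightarrow>
     (\<forall>\<psi> \<theta> a b. schwartz \<psi> \<longrightarrow> schwartz \<theta> \<longrightarrow>
        u (\<lambda>x. a * \<psi> x + b * \<theta> x) = a * u \<psi> + b * u \<theta>) \<and>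
     (\<exists>C N. \<forall>\<psi>. schwartz \<psi> \<longrightarrow>
        norm (u \<psi>) \<le> C * (\<Sum>is\<in>{is. length is \<le> N}. schwartz_seminorm N is \<psi>))"

definition represents :: "(real^'n::finite \<Rightarrow> complex) \<Rightarrow> 'n functional \<Rightarrow> bool" where
  "represents g u \<longleftrightarrow> g \<in> borel_measurable lborel \<and>
     (\<forall>\<psi>. schwartz \<psi> \<longrightarrow> integrable lborel (\<lambda>x. g x * \<psi> x) \<and>
        u \<psi> = (\<integral>x. g x * \<psi> x \<partial>lborel))"

text \<open>The representing function is unique almost everywhere, so the infimum is its norm; it is
  \<open>\<infinity>\<close> if the distribution is not a function.\<close>

definition dist_norm :: "ennreal \<Rightarrow> 'n::finite functional \<Rightarrow> ennreal" where
  "dist_norm p u =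
     (INF g\<in>{g. represents g u}. lp_norm lborel p (\<lambda>x. ennreal (norm (g x))))"

definition mult_dist :: "(real^'n::finite \<Rightarrow> complex) \<Rightarrow> 'n functional \<Rightarrow> 'n functional" where
  "mult_dist m u = (\<lambda>\<psi>. u (\<lambda>x. m x * \<psi> x))"


section \<open>Fourier transform\<close>

definition fourier :: "(real^'n::finite \<Rightarrow> complex) \<Rightarrow> real^'n \<Rightarrow> complex" where
  "fourier \<psi> \<xi> = (\<integral>x. cis (- (x \<bullet> \<xi>)) * \<psi> x \<partial>lborel)"

definition inv_fourier :: "(real^'n::finite \<Rightarrow> complex) \<Rightarrow> real^'n \<Rightarrow> complex" where
  "inv_fourier \<psi> x =
     of_real (1 / (2 * pi) ^ CARD('n)) * (\<integral>\<xi>. cis (x \<bullet> \<xi>) * \<psi> \<xi> \<partial>lborel)"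

definition fourier_dist :: "'n::finite functional \<Rightarrow> 'n functional" where
  "fourier_dist u = (\<lambda>\<psi>. u (fourier \<psi>))"

definition inv_fourier_dist :: "'n::finite functional \<Rightarrow> 'n functional" where
  "inv_fourier_dist u = (\<lambda>\<psi>. u (inv_fourier \<psi>))"


section \<open>Homogeneous Besov spaces\<close>

text \<open>As the annulus is closed, the second line says that it contains the support.\<close>

definition dyadic_partition :: "(real^'n::finite \<Rightarrow> real) \<Rightarrow> bool" where
  "dyadic_partition \<phi> \<longleftrightarrow> smooth \<phi> \<and> range \<phi> \<subseteq> {0..1} \<and>
     (\<forall>\<xi>. \<phi> \<xi> \<noteq> 0 \<longrightarrow> 3/4 \<le> norm \<xi> \<and> norm \<xi> \<le> 8/3) \<and>
     (\<forall>\<xi> \<zeta>. norm \<xi> = norm \<zeta> \<longrightarrow> \<phi> \<xi> = \<phi> \<zeta>) \<and>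
     (\<forall>\<xi>. \<xi> \<noteq> 0 \<longrightarrow> ((\<lambda>q::int. \<phi> ((2 powi (- q)) *\<^sub>R \<xi>)) has_sum 1) UNIV)"

definition dyadic_block :: "(real^'n::finite \<Rightarrow> real) \<Rightarrow> int \<Rightarrow> 'n functional \<Rightarrow> 'n functional" where
  "dyadic_block \<phi> q u =
     inv_fourier_dist (mult_dist (\<lambda>\<xi>. of_real (\<phi> ((2 powi (- q)) *\<^sub>R \<xi>))) (fourier_dist u))"

definition besov_norm ::
  "(real^'n::finite \<Rightarrow> real) \<Rightarrow> real \<Rightarrow> ennreal \<Rightarrow> ennreal \<Rightarrow> 'n functional \<Rightarrow> ennreal" where
  "besov_norm \<phi> s p r u =
     lp_norm (count_space UNIV) r
       (\<lambda>q::int. ennreal (2 powr (of_int q * s)) * dist_norm p (dyadic_block \<phi> q u))"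

definition modulo_polynomials :: "('n::finite functional \<times> 'n functional) set" where
  "modulo_polynomials = {(u, v). tempered u \<and> tempered v \<and>
     (\<exists>P. polynomial_function P \<and> represents P (\<lambda>\<psi>. u \<psi> - v \<psi>))}"

text \<open>The elements are classes of tempered distributions modulo polynomials. Since \<open>\<phi>\<close> vanishes
  near the origin, the dyadic blocks, and hence the norm, do not depend on the representative.\<close>

definition besov_space ::
  "(real^'n::finite \<Rightarrow> real) \<Rightarrow> real \<Rightarrow> ennreal \<Rightarrow> ennreal \<Rightarrow> 'n functional set set" where
  "besov_space \<phi> s p r =
     {F \<in> {u. tempered u} // modulo_polynomials. \<exists>f\<in>F. besov_norm \<phi> s p r f < \<infinity>}"


section \<open>The dissipation rate\<close>

definition eta :: "real^'n::finite \<Rightarrow> real" where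
  "eta \<xi> = (norm \<xi>)\<^sup>2 / (1 + (norm \<xi>)\<^sup>2)\<^sup>2"

text \<open>\<open>L\<^sup>2\<close> norm in the frequency variable of the damped Fourier transform of a dyadic block.\<close>

definition damped_block_norm ::
  "(real^'n::finite \<Rightarrow> real) \<Rightarrow> real \<Rightarrow> int \<Rightarrow> 'n functional \<Rightarrow> ennreal" where
  "damped_block_norm \<phi> t q f =
     dist_norm 2 (mult_dist (\<lambda>\<xi>. of_real (exp (- eta \<xi> * t)))
       (fourier_dist (dyadic_block \<phi> q f)))"

end

theory Submission
  imports Defs
begin

text \<open>
  A dyadic block is localised to \<open>|\<xi>| \<approx> 2\<^sup>q\<close>, and there \<open>\<eta>(\<xi>) \<ge> c 4\<^bsup>-|q|\<^esup>\<close>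
  (\<open>eta_annulus\<close>). Plancherel's inequality therefore bounds the damped block by
  \<open>exp (- c t 4\<^bsup>-|q|\<^esup>)\<close> times the \<open>L\<^sup>2\<close> norm of the block, and Bernstein's inequality
  replaces the \<open>L\<^sup>2\<close> norm by \<open>2\<^bsup>qn(1/p-1/2)\<^esup>\<close> times the \<open>L\<^sup>p\<close> norm
  (\<open>damped_block_norm_estimate\<close>). It remains to estimate sequences.

  For \<open>q < 0\<close> take \<open>p = 2\<close>. The data are at most \<open>2\<^bsup>qs\<^esup>\<close> times their norm, so the weights
  \<open>2\<^bsup>q(\<sigma>+s)\<^esup> exp (- c t 4\<^sup>q)\<close> have to be summed. They depend on \<open>2\<^sup>q (1+t)\<^bsup>1/2\<^esup>\<close>
  up to the factor \<open>(1+t)\<^bsup>-(\<sigma>+s)/2\<^esup>\<close> and decay geometrically on both sides of the frequency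
  \<open>(1+t)\<^bsup>-1/2\<^esup>\<close>, hence are uniformly summable (\<open>low_frequency_weight\<close>,
  \<open>lp_norm_geometric\<close>). For \<open>q \<ge> 0\<close>, with \<open>\<alpha> = l - n(1/p - 1/2) \<ge> 0\<close>, the weights
  \<open>2\<^bsup>-q\<alpha>\<^esup> exp (- c t 4\<^bsup>-q\<^esup>)\<close> are at most a constant times \<open>(1+t)\<^bsup>-\<alpha>/2\<^esup>\<close>
  (\<open>high_frequency_weight\<close>); this suffices because the sum is already part of the norm of the data.

  The Fourier analysis behind this is developed from Gaussian integrals. The Schwartz class is stable under the
  Fourier transform and under multiplication with \<open>e\<^sup>-\<^sup>\<eta>\<^sup>t\<close> (\<open>schwartz_fourier\<close>, \<open>slow_damping\<close>), so that the
  distributional definitions can be evaluated on test functions. Inversion (\<open>fourier_inversion\<close>) and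
  Plancherel's inequality (\<open>plancherel_le\<close>) follow from Gaussian regularisation, and truncation extends the
  transform to \<open>L\<^sup>2\<close> (\<open>fourier_L2\<close>). Bernstein's inequality (\<open>bernstein\<close>) is obtained by convolving
  a representing function with the kernel of a slightly larger cutoff. The convolution represents the same
  block, so its norms may be used in place of those of the given function.
\<close>

section \<open>Product integrals and Gaussians\<close>

lemma cis_measurable [measurable (raw)]:
  "f \<in> borel_measurable M \<Longrightarrow> (\<lambda>x. cis (f x)) \<in> borel_measurable M"
  by (rule borel_measurable_continuous_on[of cis]) (auto intro!: continuous_intros)

lemma
  fixes f :: "'n::finite \<Rightarrow> real \<Rightarrow> complex"
  assumes f: "\<And>i. integrable lborel (f i)"
  shows integrable_prod_vec: "integrable lborel (\<lambda>x::real^'n. \<Prod>i\<in>UNIV. f i (x $ i))"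
    and integral_prod_vec:
      "(\<integral>(x::real^'n). (\<Prod>i\<in>UNIV. f i (x $ i)) \<partial>lborel) = (\<Prod>i\<in>UNIV. \<integral>x. f i x \<partial>lborel)"
proof -
  define ix :: "real^'n \<Rightarrow> 'n" where "ix b = (SOME i. b = axis i 1)" for b
  have ix [simp]: "ix (axis i 1) = i" for i
    unfolding ix_def by (rule some_equality) (auto simp: axis_eq_axis)
  have inj: "inj (\<lambda>i::'n. axis i (1::real))"
    by (auto simp: inj_on_def axis_eq_axis)
  have Basis: "(Basis :: (real^'n) set) = range (\<lambda>i. axis i 1)"
    by (auto simp: Basis_vec_def)
  interpret product_sigma_finite "\<lambda>b::real^'n. lborel :: real measure" ..
  have [measurable]: "f i \<in> borel_measurable borel" for i
    using borel_measurable_integrable[OF f[of i]] by simp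
  define g where "g = (\<lambda>x::real^'n. \<Prod>i\<in>UNIV. f i (x $ i))"
  have [measurable]: "g \<in> borel_measurable borel"
    unfolding g_def by measurable
  have eq: "g (\<Sum>b\<in>Basis. h b *\<^sub>R b) = (\<Prod>b\<in>Basis. f (ix b) (h b))" for h :: "real^'n \<Rightarrow> real"
  proof -
    have "(\<Sum>b\<in>Basis. h b *\<^sub>R b) $ i = h (axis i 1)" for i
    proof -
      have "(\<Sum>b\<in>Basis. h b *\<^sub>R b) $ i = (\<Sum>b\<in>Basis. h b *\<^sub>R b) \<bullet> axis i 1"
        by (simp add: inner_axis)
      also have "\<dots> = h (axis i 1)"
        by (rule inner_sum_left_Basis) (simp add: Basis)
      finally show ?thesis .
    qed
    then show ?thesis
      unfolding g_def Basis by (simp add: prod.reindex[OF inj] o_def)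
  qed
  have "integrable lborel g"
    unfolding lborel_eq[where 'a="real^'n"]
    by (subst integrable_distr_eq) (auto simp: eq intro!: product_integrable_prod f)
  moreover have "integral\<^sup>L lborel g = (\<Prod>i\<in>UNIV. \<integral>x. f i x \<partial>lborel)"
  proof -
    have "integral\<^sup>L lborel g = (\<integral>h. (\<Prod>b\<in>Basis. f (ix b) (h b)) \<partial>(\<Pi>\<^sub>M b\<in>Basis. lborel))"
      by (subst lborel_eq[where 'a="real^'n"], subst integral_distr) (auto simp: eq)
    also have "\<dots> = (\<Prod>b\<in>Basis. \<integral>x. f (ix b) x \<partial>lborel)"
      by (intro product_integral_prod f) auto
    finally show ?thesis
      unfolding Basis by (simp add: prod.reindex[OF inj] o_def)
  qed
  ultimately show "integrable lborel (\<lambda>x::real^'n. \<Prod>i\<in>UNIV. f i (x $ i))"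
    and "(\<integral>(x::real^'n). (\<Prod>i\<in>UNIV. f i (x $ i)) \<partial>lborel) = (\<Prod>i\<in>UNIV. \<integral>x. f i x \<partial>lborel)"
    by (simp_all add: g_def)
qed

lemma nn_integral_affine:
  fixes t :: "'a::euclidean_space"
  assumes [measurable]: "f \<in> borel_measurable borel" and c: "c \<noteq> 0"
  shows "(\<integral>\<^sup>+x. f x \<partial>lborel) = ennreal (\<bar>c\<bar> ^ DIM('a)) * (\<integral>\<^sup>+x. f (t + c *\<^sub>R x) \<partial>lborel)"
  by (subst lborel_affine[OF c, of t])
     (simp add: nn_integral_density nn_integral_distr nn_integral_cmult)

lemma lborel_integrable_affine:
  fixes f :: "'a::euclidean_space \<Rightarrow> 'b::{banach, second_countable_topology}"
  assumes f: "integrable lborel f" and c: "c \<noteq> 0"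
  shows "integrable lborel (\<lambda>x. f (t + c *\<^sub>R x))"
  using f[THEN borel_measurable_integrable] f c unfolding integrable_iff_bounded
  by (subst (asm) nn_integral_affine[where c=c and t=t]) (auto simp: ennreal_mult_less_top)

lemma lborel_integral_affine:
  fixes f :: "'a::euclidean_space \<Rightarrow> 'b::{banach, second_countable_topology}"
  assumes f: "integrable lborel f" and c: "c \<noteq> 0"
  shows "(\<integral>x. f x \<partial>lborel) = \<bar>c\<bar> ^ DIM('a) *\<^sub>R (\<integral>x. f (t + c *\<^sub>R x) \<partial>lborel)"
  using c f[THEN borel_measurable_integrable] lborel_integrable_affine[OF f, of c t]
  by (subst lborel_affine[OF c, of t])
     (simp add: integral_density integral_distr)

definition gauss :: "real^'n::finite \<Rightarrow> real" where
  "gauss x = exp (- (norm x)\<^sup>2 / 2)"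

lemma gauss_measurable [measurable]: "gauss \<in> borel_measurable borel"
  unfolding gauss_def by measurable

lemma gauss_pos: "gauss x > 0" and gauss_le_1 [simp]: "gauss x \<le> 1"
  and gauss_nonneg [simp]: "gauss x \<ge> 0"
  by (auto simp: gauss_def)

lemma gauss_one_dim:
  "integrable lborel (\<lambda>x. cis (x * s) * complex_of_real (exp (- x\<^sup>2 / 2)))" (is ?A)
  "(\<integral>x. cis (x * s) * complex_of_real (exp (- x\<^sup>2 / 2)) \<partial>lborel) =
     complex_of_real (sqrt (2 * pi) * exp (- s\<^sup>2 / 2))" (is ?B)
proof -
  have dens: "complex_of_real (exp (- x\<^sup>2 / 2)) = sqrt (2 * pi) * complex_of_real (std_normal_density x)" for x
    by (simp add: std_normal_density_def)
  have "integrable lborel (\<lambda>x. complex_of_real (std_normal_density x))"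
    using integrable_std_normal_moment[of 0] by simp
  then have i: "integrable lborel (\<lambda>x. cis (x * s) * complex_of_real (std_normal_density x))"
    by (rule Bochner_Integration.integrable_bound)
       (auto simp: norm_mult)
  then have "integrable lborel (\<lambda>x. sqrt (2 * pi) * (cis (x * s) * complex_of_real (std_normal_density x)))"
    by simp
  then show ?A
    unfolding dens by (simp add: mult_ac)
  have "char std_normal_distribution s = (\<integral>x. cis (x * s) * complex_of_real (std_normal_density x) \<partial>lborel)"
    unfolding char_def
    by (subst integral_density)
       (auto simp: scaleR_conv_of_real normal_density_nonneg cis_conv_exp mult_ac intro!: Bochner_Integration.integral_cong)
  then have *: "(\<integral>x. cis (x * s) * complex_of_real (std_normal_density x) \<partial>lborel) = exp (- s\<^sup>2 / 2)"
    by (simp add: char_std_normal_distribution)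
  have "(\<integral>x. cis (x * s) * complex_of_real (exp (- x\<^sup>2 / 2)) \<partial>lborel)
      = (\<integral>x. complex_of_real (sqrt (2 * pi)) * (cis (x * s) * complex_of_real (std_normal_density x)) \<partial>lborel)"
    unfolding dens by (simp add: mult_ac)
  also have "\<dots> = complex_of_real (sqrt (2 * pi)) * exp (- s\<^sup>2 / 2)"
    by (subst integral_mult_right_zero) (simp only: *)
  finally show ?B by simp
qed

lemma gauss_prod: "gauss x = (\<Prod>i\<in>UNIV. exp (- (x $ i)\<^sup>2 / 2))"
  unfolding gauss_def
  by (simp add: exp_sum[symmetric] norm_vec_def L2_set_def sum_nonneg sum_negf sum_divide_distrib)

text \<open>The exponential \<open>e\<^sup>i\<^sup>x\<^sup>\<xi>\<close> is a product over the coordinates, like the Gaussian, so that the Gaussian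
  integral on \<open>\<real>\<^sup>n\<close> factors into one-dimensional ones; these are the characteristic function of the
  standard normal distribution.\<close>

lemma cis_sum: "cis (\<Sum>i\<in>A. f i) = (\<Prod>i\<in>A. cis (f i))"
  by (induction A rule: infinite_finite_induct) (auto simp: cis_mult[symmetric])

lemma
  shows integrable_gauss_cis: "integrable lborel (\<lambda>x::real^'n::finite. cis (x \<bullet> s) * complex_of_real (gauss x))"
    and integral_gauss_cis: "(\<integral>(x::real^'n). cis (x \<bullet> s) * complex_of_real (gauss x) \<partial>lborel)
      = complex_of_real (sqrt (2 * pi) ^ CARD('n) * gauss s)"
proof -
  have eq: "cis (x \<bullet> s) * complex_of_real (gauss x) =
     (\<Prod>i\<in>UNIV. cis (x $ i * s $ i) * complex_of_real (exp (- (x $ i)\<^sup>2 / 2)))" for x :: "real^'n"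
    by (simp add: inner_vec_def cis_sum gauss_prod prod.distrib)
  show "integrable lborel (\<lambda>x. cis (x \<bullet> s) * complex_of_real (gauss x))"
    unfolding eq by (intro integrable_prod_vec gauss_one_dim)
  show "(\<integral>(x::real^'n). cis (x \<bullet> s) * complex_of_real (gauss x) \<partial>lborel)
      = complex_of_real (sqrt (2 * pi) ^ CARD('n) * gauss s)"
    unfolding eq integral_prod_vec[OF gauss_one_dim(1)] gauss_one_dim(2)
    by (simp add: prod.distrib gauss_prod)
qed

lemma integrable_gauss: "integrable lborel (\<lambda>x::real^'n::finite. gauss x)"
  using integrable_norm[OF integrable_gauss_cis[of 0]] by (simp add: less_imp_le[OF gauss_pos])

lemma integral_gauss: "(\<integral>(x::real^'n::finite). gauss x \<partial>lborel) = sqrt (2 * pi) ^ CARD('n)"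
proof -
  have "complex_of_real (\<integral>(x::real^'n). gauss x \<partial>lborel) = of_real (sqrt (2 * pi) ^ CARD('n))"
    using integral_gauss_cis[where s = "0::real^'n"] by (simp add: gauss_def)
  then show ?thesis
    using of_real_eq_iff by blast
qed

lemma gauss_scaled_fourier:
  fixes s :: "real^'n::finite"
  assumes e: "e > 0"
  shows "(\<integral>(x::real^'n). cis (x \<bullet> s) * complex_of_real (gauss (e *\<^sub>R x)) \<partial>lborel)
      = complex_of_real (sqrt (2 * pi) ^ CARD('n) / e ^ CARD('n) * gauss ((1 / e) *\<^sub>R s))"
    and "integrable lborel (\<lambda>x::real^'n. cis (x \<bullet> s) * complex_of_real (gauss (e *\<^sub>R x)))"
proof -
  let ?f = "\<lambda>x::real^'n. cis (x \<bullet> ((1/e) *\<^sub>R s)) * complex_of_real (gauss x)"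
  have f: "?f (0 + e *\<^sub>R x) = cis (x \<bullet> s) * complex_of_real (gauss (e *\<^sub>R x))" for x
    using e by simp
  show "integrable lborel (\<lambda>x::real^'n. cis (x \<bullet> s) * complex_of_real (gauss (e *\<^sub>R x)))"
    using lborel_integrable_affine[OF integrable_gauss_cis[of "(1/e) *\<^sub>R s"], of e 0] e unfolding f by simp
  show "(\<integral>(x::real^'n). cis (x \<bullet> s) * complex_of_real (gauss (e *\<^sub>R x)) \<partial>lborel)
      = complex_of_real (sqrt (2 * pi) ^ CARD('n) / e ^ CARD('n) * gauss ((1 / e) *\<^sub>R s))"
    using lborel_integral_affine[OF integrable_gauss_cis[of "(1/e) *\<^sub>R s"], of e 0] e
    unfolding f integral_gauss_cis
    by (simp add: field_simps scaleR_conv_of_real)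
qed

lemma integrable_inverse_one_plus_square: "integrable lborel (\<lambda>x::real. 1 / (1 + x\<^sup>2))"
  using integrable_inverse_1_plus_square
  by (simp add: set_integrable_def inverse_eq_divide)

text \<open>Since \<open>(1 + |x|)\<^sup>2\<close> dominates each \<open>1 + x\<^sub>i\<^sup>2\<close>, the claim reduces to the one-dimensional
  integral of \<open>1 / (1 + x\<^sup>2)\<close>.\<close>

lemma integrable_decay:
  "integrable lborel (\<lambda>x::real^'n::finite. 1 / (1 + norm x) ^ (2 * CARD('n)))"
proof -
  have "integrable lborel (\<lambda>x::real. complex_of_real (1 / (1 + x\<^sup>2)))"
    by (intro integrable_of_real integrable_inverse_one_plus_square)
  from integrable_prod_vec[OF this, where 'n='n]
  have "integrable lborel (\<lambda>x::real^'n. \<Prod>i\<in>UNIV. complex_of_real (1 / (1 + (x $ i)\<^sup>2)))" .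
  then show ?thesis
  proof (rule Bochner_Integration.integrable_bound)
    show "AE x::real^'n in lborel. norm (1 / (1 + norm x) ^ (2 * CARD('n)))
       \<le> norm (\<Prod>i\<in>UNIV. complex_of_real (1 / (1 + (x $ i)\<^sup>2)))"
    proof (intro AE_I2)
      fix x :: "real^'n"
      have "1 + (x $ i)\<^sup>2 \<le> (1 + norm x)\<^sup>2" for i
        using power_mono[OF component_le_norm_cart[of x i], of 2]
        by (simp add: power2_sum) (smt (verit) norm_ge_zero)
      then have "(\<Prod>i\<in>(UNIV::'n set). 1 / (1 + norm x)\<^sup>2) \<le> (\<Prod>i\<in>UNIV. 1 / (1 + (x $ i)\<^sup>2))"
        by (intro prod_mono conjI divide_left_mono)
           (auto intro!: mult_pos_pos add_pos_nonneg zero_less_power)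
      then have "1 / (1 + norm x) ^ (2 * CARD('n)) \<le> (\<Prod>i\<in>UNIV. 1 / (1 + (x $ i)\<^sup>2))"
        by (simp add: power_mult power_divide)
      also have "\<dots> = norm (\<Prod>i\<in>UNIV. complex_of_real (1 / (1 + (x $ i)\<^sup>2)))"
        unfolding prod_norm[symmetric] norm_of_real by (intro prod.cong refl) simp
      finally show "norm (1 / (1 + norm x) ^ (2 * CARD('n)))
         \<le> norm (\<Prod>i\<in>UNIV. complex_of_real (1 / (1 + (x $ i)\<^sup>2)))"
        by simp
    qed
  qed simp
qed

section \<open>The Schwartz class and its multipliers\<close>

lemma has_derivative_imp_pderivative:
  assumes "(f has_derivative D) (at x)"
  shows "((\<lambda>h. f (x + h *\<^sub>R axis i 1)) has_vector_derivative D (axis i 1)) (at 0)"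
    and "pderivative i f x = D (axis i 1)"
proof -
  interpret D: bounded_linear D
    using assms by (rule has_derivative_bounded_linear)
  have "((\<lambda>h. x + h *\<^sub>R axis i 1) has_derivative (\<lambda>h. h *\<^sub>R axis i 1)) (at 0)"
    by (auto intro!: derivative_eq_intros)
  from has_derivative_compose[OF this, of f D] assms
  show "((\<lambda>h. f (x + h *\<^sub>R axis i 1)) has_vector_derivative D (axis i 1)) (at 0)"
    by (simp add: has_vector_derivative_def D.scaleR)
  then show "pderivative i f x = D (axis i 1)"
    unfolding pderivative_def by (rule vector_derivative_at)
qed

lemma pderivative_eq:
  "f differentiable (at x) \<Longrightarrow> pderivative i f x = frechet_derivative f (at x) (axis i 1)"
  by (rule has_derivative_imp_pderivative(2)) (simp add: frechet_derivative_works)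

lemma pderivative_add:
  assumes "f differentiable (at x)" "g differentiable (at x)"
  shows "pderivative i (\<lambda>x. f x + g x) x = pderivative i f x + pderivative i g x"
  using has_derivative_imp_pderivative(2)[OF has_derivative_add
      [OF assms(1)[unfolded frechet_derivative_works] assms(2)[unfolded frechet_derivative_works]]]
  by (simp add: pderivative_eq assms)

lemma pderivative_mult:
  fixes f g :: "real^'n::finite \<Rightarrow> complex"
  assumes "f differentiable (at x)" "g differentiable (at x)"
  shows "pderivative i (\<lambda>x. f x * g x) x = pderivative i f x * g x + f x * pderivative i g x"
  using has_derivative_imp_pderivative(2)[OF has_derivative_mult
      [OF assms(1)[unfolded frechet_derivative_works] assms(2)[unfolded frechet_derivative_works]]]
  by (simp add: pderivative_eq assms add.commute)

lemma pderivatives_append: "pderivatives (is @ js) f = pderivatives is (pderivatives js f)"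
  by (induction "is") auto

lemma pderivatives_mem:
  assumes "f \<in> X" and "\<And>f i. f \<in> X \<Longrightarrow> pderivative i f \<in> X"
  shows "pderivatives is f \<in> X"
  by (induction "is") (auto intro: assms)

definition rapid :: "(real^'n::finite \<Rightarrow> complex) \<Rightarrow> bool" where
  "rapid f \<longleftrightarrow> (\<forall>N::nat. \<exists>C. \<forall>x. (1 + norm x) ^ N * norm (f x) \<le> C)"

lemma schwartz_iff:
  "schwartz f \<longleftrightarrow> (\<forall>is. (\<forall>x. pderivatives is f differentiable (at x)) \<and> rapid (pderivatives is f))"
proof -
  have "bounded (range (\<lambda>x. (1 + norm x) ^ N *\<^sub>R g x)) \<longleftrightarrow>
      (\<exists>C. \<forall>x. (1 + norm x) ^ N * norm (g x) \<le> C)" for N and g :: "real^'n \<Rightarrow> complex"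
    unfolding bounded_iff by simp
  then show ?thesis
    unfolding schwartz_def smooth_def rapid_def by blast
qed

text \<open>All closure properties of the Schwartz class below are instances of this principle: it is
  the largest class of rapidly decreasing differentiable functions closed under partial
  derivatives, so membership only needs first derivatives.\<close>

lemma schwartz_coinduct:
  assumes "f \<in> X"
    and "\<And>f x. f \<in> X \<Longrightarrow> f differentiable (at x)"
    and "\<And>f. f \<in> X \<Longrightarrow> rapid f"
    and "\<And>f i. f \<in> X \<Longrightarrow> pderivative i f \<in> X"
  shows "schwartz f"
  unfolding schwartz_iff using pderivatives_mem[of f X] assms by blast

lemma schwartz_pderivative:
  assumes "schwartz f" shows "schwartz (pderivative i f)"
proof -
  have "pderivatives is (pderivative i f) = pderivatives (is @ [i]) f" for "is"
    by (simp add: pderivatives_append)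
  then show ?thesis
    using assms unfolding schwartz_iff by metis
qed

lemma schwartz_differentiable: "schwartz f \<Longrightarrow> f differentiable (at x)"
  unfolding schwartz_iff by (metis pderivatives.simps(1))

lemma schwartz_rapid: "schwartz f \<Longrightarrow> rapid f"
  unfolding schwartz_iff by (metis pderivatives.simps(1))

lemma rapid_add: "rapid f \<Longrightarrow> rapid g \<Longrightarrow> rapid (\<lambda>x. f x + g x)"
  unfolding rapid_def
proof
  fix N :: nat
  assume "\<forall>N::nat. \<exists>C. \<forall>x. (1 + norm x) ^ N * norm (f x) \<le> C"
    and "\<forall>N::nat. \<exists>C. \<forall>x. (1 + norm x) ^ N * norm (g x) \<le> C"
  then obtain C D where CD: "\<forall>x. (1 + norm x) ^ N * norm (f x) \<le> C" "\<forall>x. (1 + norm x) ^ N * norm (g x) \<le> D"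
    by blast
  have "(1 + norm x) ^ N * norm (f x + g x) \<le> C + D" for x
  proof -
    have "(1 + norm x) ^ N * norm (f x + g x) \<le> (1 + norm x) ^ N * (norm (f x) + norm (g x))"
      by (intro mult_left_mono norm_triangle_ineq) auto
    with CD show ?thesis
      by (simp add: algebra_simps) (smt (verit) CD)
  qed
  then show "\<exists>C. \<forall>x. (1 + norm x) ^ N * norm (f x + g x) \<le> C" by blast
qed

definition moderate :: "(real^'n::finite \<Rightarrow> complex) \<Rightarrow> bool" where
  "moderate f \<longleftrightarrow> (\<exists>C (N::nat). \<forall>x. norm (f x) \<le> C * (1 + norm x) ^ N)"

lemma moderateI: "(\<And>x. norm (f x) \<le> C * (1 + norm x) ^ N) \<Longrightarrow> moderate f"
  unfolding moderate_def by blast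

lemma moderateE:
  assumes "moderate f"
  obtains C N where "C \<ge> 0" "\<And>x. norm (f x) \<le> C * (1 + norm x) ^ N"
proof -
  obtain C N where CN: "\<And>x. norm (f x) \<le> C * (1 + norm x) ^ N"
    using assms unfolding moderate_def by blast
  have "C \<ge> 0"
    using order_trans[OF norm_ge_zero CN[of 0]] by simp
  with CN that show ?thesis by blast
qed

lemma moderate_add:
  assumes "moderate f" "moderate g" shows "moderate (\<lambda>x. f x + g x)"
proof -
  obtain C N where f: "C \<ge> 0" "\<And>x. norm (f x) \<le> C * (1 + norm x) ^ N"
    using assms(1) by (rule moderateE) blast
  obtain D M where g: "D \<ge> 0" "\<And>x. norm (g x) \<le> D * (1 + norm x) ^ M"
    using assms(2) by (rule moderateE) blast
  have "norm (f x + g x) \<le> (C + D) * (1 + norm x) ^ (N + M)" for x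
  proof -
    have "norm (f x) \<le> C * (1 + norm x) ^ (N + M)"
      by (rule order_trans[OF f(2)]) (intro mult_left_mono power_increasing, auto simp: f)
    moreover have "norm (g x) \<le> D * (1 + norm x) ^ (N + M)"
      by (rule order_trans[OF g(2)]) (intro mult_left_mono power_increasing, auto simp: g)
    ultimately show ?thesis
      using norm_triangle_ineq[of "f x" "g x"] by (simp add: algebra_simps)
  qed
  then show ?thesis by (rule moderateI)
qed

lemma moderate_mult:
  assumes "moderate f" "moderate g" shows "moderate (\<lambda>x. f x * g x)"
proof -
  obtain C N where f: "C \<ge> 0" "\<And>x. norm (f x) \<le> C * (1 + norm x) ^ N"
    using assms(1) by (rule moderateE) blast
  obtain D M where g: "D \<ge> 0" "\<And>x. norm (g x) \<le> D * (1 + norm x) ^ M"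
    using assms(2) by (rule moderateE) blast
  have "norm (f x * g x) \<le> (C * D) * (1 + norm x) ^ (N + M)" for x
    using mult_mono[OF f(2)[of x] g(2)[of x]] f(1) by (simp add: norm_mult power_add mult_ac)
  then show ?thesis by (rule moderateI)
qed

lemma moderate_const: "moderate (\<lambda>x. c)"
  by (rule moderateI[of _ "norm c" 0]) simp

lemma rapid_mult:
  assumes "rapid f" "moderate g" shows "rapid (\<lambda>x. f x * g x)"
  unfolding rapid_def
proof
  fix M :: nat
  obtain D N where g: "D \<ge> 0" "\<And>x. norm (g x) \<le> D * (1 + norm x) ^ N"
    using assms(2) by (rule moderateE) blast
  obtain C where C: "\<And>x. (1 + norm x) ^ (M + N) * norm (f x) \<le> C"
    using assms(1) unfolding rapid_def by blast
  have "(1 + norm x) ^ M * norm (f x * g x) \<le> C * D" for x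
  proof -
    have "(1 + norm x) ^ M * norm (f x * g x) \<le> (1 + norm x) ^ M * norm (f x) * (D * (1 + norm x) ^ N)"
      unfolding norm_mult mult.assoc by (intro mult_left_mono g) auto
    also have "\<dots> = ((1 + norm x) ^ (M + N) * norm (f x)) * D"
      by (simp add: power_add mult_ac)
    also have "\<dots> \<le> C * D"
      by (intro mult_right_mono C g)
    finally show ?thesis .
  qed
  then show "\<exists>C. \<forall>x. (1 + norm x) ^ M * norm (f x * g x) \<le> C" by blast
qed

text \<open>The smooth functions all of whose derivatives grow at most polynomially are the
  multipliers of the Schwartz class.\<close>

definition slow :: "(real^'n::finite \<Rightarrow> complex) \<Rightarrow> bool" where
  "slow f \<longleftrightarrow> (\<forall>is. (\<forall>x. pderivatives is f differentiable (at x)) \<and> moderate (pderivatives is f))"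

lemma slow_pderivative:
  assumes "slow f" shows "slow (pderivative i f)"
proof -
  have "pderivatives is (pderivative i f) = pderivatives (is @ [i]) f" for "is"
    by (simp add: pderivatives_append)
  then show ?thesis
    using assms unfolding slow_def by metis
qed

lemma slow_differentiable: "slow f \<Longrightarrow> f differentiable (at x)"
  unfolding slow_def by (metis pderivatives.simps(1))

lemma slow_moderate: "slow f \<Longrightarrow> moderate f"
  unfolding slow_def by (metis pderivatives.simps(1))

inductive_set generated :: "(real^'n::finite \<Rightarrow> complex) set \<Rightarrow> (real^'n \<Rightarrow> complex) set"
  for B where
  gen_base: "b \<in> B \<Longrightarrow> b \<in> generated B"
| gen_const: "(\<lambda>x. c) \<in> generated B"
| gen_add: "f \<in> generated B \<Longrightarrow> g \<in> generated B \<Longrightarrow> (\<lambda>x. f x + g x) \<in> generated B"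
| gen_mult: "f \<in> generated B \<Longrightarrow> g \<in> generated B \<Longrightarrow> (\<lambda>x. f x * g x) \<in> generated B"

text \<open>By the Leibniz rule an algebra is closed under differentiation as soon as the derivatives of
  its generators belong to it.\<close>

lemma slow_generated:
  assumes B: "\<And>b x. b \<in> B \<Longrightarrow> b differentiable (at x)" "\<And>b. b \<in> B \<Longrightarrow> moderate b"
    "\<And>b i. b \<in> B \<Longrightarrow> pderivative i b \<in> generated B"
    and f: "f \<in> generated B"
  shows "slow f"
proof -
  have d: "\<forall>x. g differentiable (at x)" if "g \<in> generated B" for g
    using that by induction (auto intro: B)
  have m: "moderate g" if "g \<in> generated B" for g
    using that by induction (auto intro: B moderate_add moderate_mult moderate_const)
  have p: "pderivative i g \<in> generated B" if "g \<in> generated B" for g i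
    using that
  proof induction
    case (gen_base b)
    then show ?case by (rule B)
  next
    case (gen_const c)
    have "pderivative i (\<lambda>x. c) = (\<lambda>x. 0)"
      by (rule ext, rule has_derivative_imp_pderivative(2)) simp
    then show ?case by (simp add: generated.gen_const)
  next
    case (gen_add f g)
    have "pderivative i (\<lambda>x. f x + g x) = (\<lambda>x. pderivative i f x + pderivative i g x)"
      using gen_add d by (intro ext pderivative_add) auto
    with gen_add show ?case by (simp add: generated.gen_add)
  next
    case (gen_mult f g)
    have "pderivative i (\<lambda>x. f x * g x) = (\<lambda>x. pderivative i f x * g x + f x * pderivative i g x)"
      using gen_mult d by (intro ext pderivative_mult) auto
    with gen_mult show ?case by (simp add: generated.gen_add generated.gen_mult)
  qed
  have "pderivatives is f \<in> generated B" for "is"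
    by (rule pderivatives_mem[OF f p])
  then show ?thesis
    unfolding slow_def using d m by blast
qed

text \<open>The class contains sums because the Leibniz rule turns a product into a sum of products, and it has
  to be closed under partial derivatives.\<close>

inductive_set products :: "(real^'n::finite \<Rightarrow> complex) set" where
  base: "schwartz f \<Longrightarrow> slow g \<Longrightarrow> (\<lambda>x. f x * g x) \<in> products"
| add: "f \<in> products \<Longrightarrow> g \<in> products \<Longrightarrow> (\<lambda>x. f x + g x) \<in> products"

lemma schwartz_products: "f \<in> products \<Longrightarrow> schwartz f"
proof (erule schwartz_coinduct)
  have d: "\<forall>x. f differentiable (at x)" if "f \<in> products" for f :: "real^'n \<Rightarrow> complex"
    using that by induction (auto intro!: differentiable_mult intro: schwartz_differentiable slow_differentiable)
  then show "f differentiable (at x)" if "f \<in> products" for f :: "real^'n \<Rightarrow> complex" and x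
    using that by blast
  show "rapid f" if "f \<in> products" for f :: "real^'n \<Rightarrow> complex"
    using that by induction (auto intro: rapid_add rapid_mult schwartz_rapid slow_moderate)
  show "pderivative i f \<in> products" if "f \<in> products" for f :: "real^'n \<Rightarrow> complex" and i
    using that
  proof induction
    case (base f g)
    have "pderivative i (\<lambda>x. f x * g x) = (\<lambda>x. pderivative i f x * g x + f x * pderivative i g x)"
      using base by (intro ext pderivative_mult schwartz_differentiable slow_differentiable)
    with base show ?case
      by (simp add: products.add products.base schwartz_pderivative slow_pderivative)
  next
    case (add f g)
    have "pderivative i (\<lambda>x. f x + g x) = (\<lambda>x. pderivative i f x + pderivative i g x)"
      using add d by (intro ext pderivative_add) auto
    with add show ?case by (simp add: products.add)
  qed
qed

lemma schwartz_mult_slow: "schwartz f \<Longrightarrow> slow g \<Longrightarrow> schwartz (\<lambda>x. f x * g x)"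
  by (rule schwartz_products[OF products.base])

lemma slow_const: "slow (\<lambda>x. c)"
  by (rule slow_generated[of "{}"]) (auto intro: gen_const)

lemma schwartz_cmult: "schwartz f \<Longrightarrow> schwartz (\<lambda>x. c * f x)"
  using schwartz_mult_slow[OF _ slow_const, of f c] by (simp add: mult.commute)

lemma schwartz_add:
  assumes "schwartz f" "schwartz g" shows "schwartz (\<lambda>x. f x + g x)"
  using schwartz_products[OF products.add[OF products.base[OF assms(1) slow_const[of 1]]
        products.base[OF assms(2) slow_const[of 1]]]] by simp

lemma schwartz_scale:
  assumes "schwartz f" and a: "a \<noteq> (0::real)" shows "schwartz (\<lambda>x. f (a *\<^sub>R x))"
proof (rule schwartz_coinduct[of _ "{\<lambda>x. c * g (a *\<^sub>R x) |c g. schwartz g}"])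
  show "(\<lambda>x. f (a *\<^sub>R x)) \<in> {\<lambda>x. c * g (a *\<^sub>R x) |c g. schwartz g}"
    using assms by (auto intro!: exI[of _ 1] exI[of _ f])
next
  fix h :: "real^'n \<Rightarrow> complex"
  assume "h \<in> {\<lambda>x. c * g (a *\<^sub>R x) |c g. schwartz g}"
  then obtain c g where g: "schwartz g" and h: "h = (\<lambda>x. c * g (a *\<^sub>R x))"
    by blast
  have D: "(h has_derivative (\<lambda>y. c * frechet_derivative g (at (a *\<^sub>R x)) (a *\<^sub>R y))) (at x)" for x
    unfolding h
    using has_derivative_compose[OF has_derivative_scaleR_right[OF has_derivative_ident]
        schwartz_differentiable[OF g, unfolded frechet_derivative_works], of a x UNIV]
    by (rule has_derivative_mult_right)
  then show "h differentiable (at x)" for x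
    by (auto simp: differentiable_def)
  show "rapid h"
    unfolding rapid_def
  proof
    fix N :: nat
    obtain C where C: "\<And>x. (1 + norm x) ^ N * norm (g x) \<le> C"
      using schwartz_rapid[OF g] unfolding rapid_def by blast
    define b where "b = 1 + 1 / \<bar>a\<bar>"
    have "(1 + norm x) ^ N * norm (h x) \<le> b ^ N * C * norm c" for x
    proof -
      have "1 + norm x \<le> b * (1 + norm (a *\<^sub>R x))"
        using a by (simp add: b_def field_simps)
      then have "(1 + norm x) ^ N \<le> b ^ N * (1 + norm (a *\<^sub>R x)) ^ N"
        unfolding power_mult_distrib[symmetric] by (intro power_mono) auto
      then have "(1 + norm x) ^ N * norm (h x) \<le> (b ^ N * (1 + norm (a *\<^sub>R x)) ^ N) * norm (h x)"
        by (intro mult_right_mono) auto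
      also have "\<dots> = b ^ N * ((1 + norm (a *\<^sub>R x)) ^ N * norm (g (a *\<^sub>R x))) * norm c"
        by (simp add: h norm_mult mult_ac)
      also have "\<dots> \<le> b ^ N * C * norm c"
        by (intro mult_right_mono mult_left_mono C) (auto simp: b_def)
      finally show ?thesis .
    qed
    then show "\<exists>C. \<forall>x. (1 + norm x) ^ N * norm (h x) \<le> C" by blast
  qed
  fix i
  have "pderivative i h = (\<lambda>x. (c * of_real a) * pderivative i g (a *\<^sub>R x))"
  proof
    fix x
    interpret L: bounded_linear "frechet_derivative g (at (a *\<^sub>R x))"
      using schwartz_differentiable[OF g] by (metis frechet_derivative_works has_derivative_bounded_linear)
    have "pderivative i h x = c * frechet_derivative g (at (a *\<^sub>R x)) (a *\<^sub>R axis i 1)"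
      by (rule has_derivative_imp_pderivative(2)[OF D])
    also have "\<dots> = (c * of_real a) * pderivative i g (a *\<^sub>R x)"
      unfolding L.scaleR pderivative_eq[OF schwartz_differentiable[OF g]]
      by (simp add: scaleR_conv_of_real[where 'a=complex])
    finally show "pderivative i h x = (c * of_real a) * pderivative i g (a *\<^sub>R x)" .
  qed
  then show "pderivative i h \<in> {\<lambda>x. c * g (a *\<^sub>R x) |c g. schwartz g}"
    using schwartz_pderivative[OF g] by blast
qed

lemma pderivatives_of_real:
  fixes f :: "real^'n::finite \<Rightarrow> real"
  assumes "smooth f"
  shows "pderivatives is (\<lambda>x. complex_of_real (f x)) = (\<lambda>x. of_real (pderivatives is f x))"
    and "(\<lambda>x. complex_of_real (pderivatives is f x)) differentiable (at y)"
proof -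
  have d: "((\<lambda>x. complex_of_real (pderivatives is f x)) has_derivative
      (\<lambda>h. of_real (frechet_derivative (pderivatives is f) (at x) h))) (at x)" for "is" x
    using assms unfolding smooth_def by (intro has_derivative_of_real) (metis frechet_derivative_works)
  then show "(\<lambda>x. complex_of_real (pderivatives is f x)) differentiable (at y)"
    by (auto simp: differentiable_def)
  show "pderivatives is (\<lambda>x. complex_of_real (f x)) = (\<lambda>x. of_real (pderivatives is f x))"
  proof (induction "is")
    case (Cons i "is")
    have "pderivative i (\<lambda>x. complex_of_real (pderivatives is f x)) x
        = of_real (pderivative i (pderivatives is f) x)" for x
      using assms has_derivative_imp_pderivative(2)[OF d] pderivative_eq[of "pderivatives is f" x i]
      unfolding smooth_def by simp
    with Cons show ?case by auto
  qed simp
qed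

text \<open>A function that vanishes outside a ball vanishes near every exterior point, hence so do its
  derivatives.\<close>

lemma pderivative_eq_0_outside:
  assumes "\<And>x. norm x > R \<Longrightarrow> f x = 0" "norm x > R"
  shows "pderivative i f x = 0"
proof (rule has_derivative_imp_pderivative(2))
  have "open {x. norm x > R}"
    by (intro open_Collect_less continuous_intros)
  then show "(f has_derivative (\<lambda>h. 0)) (at x)"
    using has_derivative_transform_within_open[OF has_derivative_const[of 0], of "{x. norm x > R}" x f] assms
    by simp
qed

lemma pderivatives_eq_0_outside:
  assumes "\<And>x. norm x > R \<Longrightarrow> f x = 0"
  shows "norm x > R \<Longrightarrow> pderivatives is f x = 0"
  by (induction "is" arbitrary: x) (auto intro!: assms pderivative_eq_0_outside[of R])

lemma rapid_compact_support:
  fixes f :: "real^'n::finite \<Rightarrow> complex"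
  assumes "continuous_on UNIV f" and "\<And>x. norm x > R \<Longrightarrow> f x = 0"
  shows "rapid f"
  unfolding rapid_def
proof
  fix N :: nat
  have "bounded ((\<lambda>x. (1 + norm x) ^ N * norm (f x)) ` cball 0 R)"
    by (intro compact_imp_bounded compact_continuous_image continuous_intros)
       (auto intro: continuous_on_subset[OF assms(1)])
  then obtain C where C: "\<And>x. norm x \<le> R \<Longrightarrow> (1 + norm x) ^ N * norm (f x) \<le> C"
    by (auto simp: bounded_iff abs_mult) (metis mem_cball_0)
  have "(1 + norm x) ^ N * norm (f x) \<le> max C 0" for x
    using C[of x] assms(2)[of x] by (cases "norm x \<le> R") auto
  then show "\<exists>C. \<forall>x. (1 + norm x) ^ N * norm (f x) \<le> C" by blast
qed

lemma schwartz_compact_support: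
  fixes f :: "real^'n::finite \<Rightarrow> real"
  assumes f: "smooth f" and supp: "\<And>x. norm x > R \<Longrightarrow> f x = 0"
  shows "schwartz (\<lambda>x. complex_of_real (f x))"
  unfolding schwartz_iff pderivatives_of_real(1)[OF f]
proof (intro allI conjI rapid_compact_support)
  fix "is" x
  show d: "(\<lambda>x. complex_of_real (pderivatives is f x)) differentiable (at x)" for x
    by (rule pderivatives_of_real(2)[OF f])
  show "continuous_on UNIV (\<lambda>x. complex_of_real (pderivatives is f x))"
    using differentiable_imp_continuous_within[OF d] by (intro continuous_at_imp_continuous_on) blast
  show "complex_of_real (pderivatives is f x) = 0" if "norm x > R" for x
    using pderivatives_eq_0_outside[OF supp that] by simp
qed

lemma schwartz_imp_slow: assumes "schwartz f" shows "slow f"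
proof -
  have "moderate g" if g: "rapid g" for g :: "real^'n \<Rightarrow> complex"
    using g[unfolded rapid_def, rule_format, of 0] moderateI[of g _ 0] by auto
  with assms show ?thesis unfolding slow_def schwartz_iff by blast
qed

text \<open>The inverse square of the Japanese bracket. In terms of it the dissipation rate
  is a polynomial, and its derivatives are polynomials in it and the coordinates.\<close>

definition inv_bracket :: "real^'n::finite \<Rightarrow> real" where
  "inv_bracket x = 1 / (1 + (norm x)\<^sup>2)"

lemma eta_inv_bracket: "eta x = inv_bracket x - (inv_bracket x)\<^sup>2"
proof -
  have *: "1 / a - (1 / a)\<^sup>2 = (a - 1) / a\<^sup>2" if "a \<noteq> 0" for a :: real
    using that by (simp add: field_simps power2_eq_square)
  have "1 + (norm x)\<^sup>2 \<noteq> 0" by (smt (verit) zero_le_power2)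
  from *[OF this] show ?thesis unfolding eta_def inv_bracket_def by simp
qed

lemma inv_bracket_has_derivative:
  "(inv_bracket has_derivative (\<lambda>h. - 2 * (x \<bullet> h) * (inv_bracket x)\<^sup>2)) (at x)"
proof -
  have p: "1 + x \<bullet> x \<noteq> 0" by (smt (verit) inner_ge_zero)
  have "((\<lambda>x. 1 / (1 + x \<bullet> x)) has_derivative (\<lambda>h. - 2 * (x \<bullet> h) * (1 / (1 + x \<bullet> x))\<^sup>2)) (at x)"
    by (rule derivative_eq_intros refl p)+
       (use p in \<open>auto simp: fun_eq_iff inner_commute power2_eq_square divide_simps\<close>)
  then show ?thesis
    by (simp add: inv_bracket_def[abs_def] power2_norm_eq_inner)
qed

text \<open>The coordinates, the inverse bracket and \<open>e\<^sup>-\<^sup>\<eta>\<^sup>t\<close> generate an algebra that is closed under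
  derivatives, because \<open>\<partial>\<^sub>i (1 + |x|\<^sup>2)\<^sup>-\<^sup>1 = - 2 x\<^sub>i (1 + |x|\<^sup>2)\<^sup>-\<^sup>2\<close>. This makes damping act on test functions.\<close>

lemma slow_coordinate: "slow (\<lambda>x::real^'n::finite. complex_of_real (x $ j))" (is ?A)
  and slow_damping: "t \<ge> 0 \<Longrightarrow> slow (\<lambda>x::real^'n. complex_of_real (exp (- eta x * t)))" (is "_ \<Longrightarrow> ?B")
proof -
  define e where "e t x = exp (- t * (inv_bracket x - (inv_bracket x)\<^sup>2))" for t and x :: "real^'n"
  let ?X = "\<lambda>j (x::real^'n). complex_of_real (x $ j)"
  let ?W = "\<lambda>x::real^'n. complex_of_real (inv_bracket x)"
  let ?E = "\<lambda>t (x::real^'n). complex_of_real (e t x)"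
  define B where "B = range ?X \<union> {?W} \<union> ?E ` {0..}"
  have X: "(?X j has_derivative (\<lambda>h. of_real (h $ j))) (at x)" for j x
    by (intro has_derivative_of_real bounded_linear_imp_has_derivative bounded_linear_vec_nth)
  have W: "(?W has_derivative (\<lambda>h. of_real (- 2 * (x \<bullet> h) * (inv_bracket x)\<^sup>2))) (at x)" for x
    by (intro has_derivative_of_real inv_bracket_has_derivative)
  have E: "(?E t has_derivative (\<lambda>h. of_real (2 * t * (x \<bullet> h) * (inv_bracket x)\<^sup>2 * (1 - 2 * inv_bracket x) * e t x))) (at x)" for t x
    unfolding e_def
    by (rule has_derivative_of_real)
       (rule derivative_eq_intros inv_bracket_has_derivative refl |
        simp add: fun_eq_iff algebra_simps power2_eq_square)+
  have generated: "?X j \<in> generated B" "?W \<in> generated B" "t \<ge> 0 \<Longrightarrow> ?E t \<in> generated B" for j t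
    by (auto simp: B_def intro!: gen_base)
  have inv_bracket: "inv_bracket x > 0" "inv_bracket x \<le> 1" for x :: "real^'n"
    by (auto simp: inv_bracket_def add_pos_nonneg)
  have slow: "slow f" if "f \<in> generated B" for f
  proof (rule slow_generated[OF _ _ _ that])
    show "b differentiable (at x)" if "b \<in> B" for b x
      using that X W E unfolding B_def differentiable_def by blast
    show "moderate b" if "b \<in> B" for b
      using that unfolding B_def
    proof (elim UnE rangeE imageE singletonE)
      fix j assume b: "b = ?X j"
      show "moderate b"
        unfolding b
        by (rule moderateI[of _ 1 1]) (simp add: component_le_norm_cart add_increasing)
    next
      assume b: "b = ?W"
      show "moderate b"
        unfolding b by (rule moderateI[of _ 1 0]) (use inv_bracket in \<open>auto simp: less_imp_le\<close>)
    next
      fix t :: real assume b: "b = ?E t" and t: "t \<in> {0..}"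
      have "inv_bracket x - (inv_bracket x)\<^sup>2 \<ge> 0" for x :: "real^'n"
        using inv_bracket[of x] by (simp add: power2_eq_square mult_left_le)
      then show "moderate b"
        unfolding b using t by (intro moderateI[of _ 1 0]) (auto simp: e_def)
    qed
    show "pderivative i b \<in> generated B" if "b \<in> B" for b i
      using that unfolding B_def
    proof (elim UnE rangeE imageE singletonE, fold B_def)
      fix j assume b: "b = ?X j"
      have "pderivative i (?X j) = (\<lambda>x. of_real (axis i 1 $ j))"
        by (rule ext, rule has_derivative_imp_pderivative(2)[OF X])
      then show "pderivative i b \<in> generated B"
        unfolding b by (auto intro: gen_const)
    next
      assume b: "b = ?W"
      have "pderivative i ?W = (\<lambda>x. -2 * (?X i x * (?W x * ?W x)))"
        by (rule ext, subst has_derivative_imp_pderivative(2)[OF W])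
           (simp add: inner_axis power2_eq_square)
      then show "pderivative i b \<in> generated B"
        unfolding b by (simp only:) (intro generated.gen_mult gen_const generated)
    next
      fix t :: real assume b: "b = ?E t" and t: "t \<in> {0..}"
      have "pderivative i (?E t) = (\<lambda>x. of_real (2 * t) * (?X i x * (?W x * ?W x)) * (1 + (-2) * ?W x) * ?E t x)"
        by (rule ext, subst has_derivative_imp_pderivative(2)[OF E])
           (simp add: inner_axis power2_eq_square mult_ac)
      then show "pderivative i b \<in> generated B"
        unfolding b using t by (simp only: atLeast_iff) (intro generated.gen_mult gen_const generated generated.gen_add)
    qed
  qed
  show ?A by (rule slow[OF generated(1)])
  have "complex_of_real (exp (- eta x * t)) = ?E t x" for x :: "real^'n"
    unfolding e_def eta_inv_bracket by (simp add: algebra_simps)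
  then show ?B if "t \<ge> 0"
    using slow[OF generated(3)[OF that]] by simp
qed

section \<open>The Fourier transform of Schwartz functions\<close>

lemma schwartz_continuous: "schwartz f \<Longrightarrow> continuous_on UNIV f"
  using differentiable_imp_continuous_within[OF schwartz_differentiable]
  by (intro continuous_at_imp_continuous_on) blast

lemma schwartz_measurable: "schwartz f \<Longrightarrow> f \<in> borel_measurable borel"
  by (intro borel_measurable_continuous_onI schwartz_continuous)

lemma schwartz_decay:
  fixes f :: "real^'n::finite \<Rightarrow> complex"
  assumes "schwartz f"
  obtains C where "C \<ge> 0" "\<And>x. norm (f x) \<le> C / (1 + norm x) ^ N"
proof -
  obtain C where C: "\<And>x. (1 + norm x) ^ N * norm (f x) \<le> C"
    using schwartz_rapid[OF assms] unfolding rapid_def by blast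
  have "norm (f x) \<le> C / (1 + norm x) ^ N" for x
    using C[of x] by (subst pos_le_divide_eq) (auto intro!: zero_less_power add_pos_nonneg simp: mult.commute)
  moreover have "C \<ge> 0"
    using C[of 0] order_trans[OF norm_ge_zero, of "f 0" C] by simp
  ultimately show ?thesis using that by blast
qed

lemma schwartz_integrable:
  fixes f :: "real^'n::finite \<Rightarrow> complex"
  assumes "schwartz f" shows "integrable lborel f"
proof -
  obtain C where C: "C \<ge> 0" "\<And>x. norm (f x) \<le> C / (1 + norm x) ^ (2 * CARD('n))"
    using schwartz_decay[OF assms] by blast
  show ?thesis
  proof (rule Bochner_Integration.integrable_bound)
    show "integrable lborel (\<lambda>x::real^'n. C * (1 / (1 + norm x) ^ (2 * CARD('n))))"
      by (intro integrable_mult_right integrable_decay)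
    show "AE x in lborel. norm (f x) \<le> norm (C * (1 / (1 + norm x) ^ (2 * CARD('n))))"
      using C by simp
  qed (use schwartz_measurable[OF assms] in simp)
qed

lemma schwartz_bounded:
  assumes "schwartz f" obtains C where "C \<ge> 0" "\<And>x. norm (f x) \<le> C"
  using schwartz_decay[OF assms, of 0] by auto

lemma cis_mult_integrable:
  assumes "integrable M f" and "g \<in> borel_measurable M"
  shows "integrable M (\<lambda>x. cis (g x) * f x)"
  by (rule Bochner_Integration.integrable_bound[OF assms(1)])
     (use assms in \<open>auto simp: norm_mult\<close>)

lemma fourier_integrable:
  "integrable lborel f \<Longrightarrow> integrable lborel (\<lambda>x::real^'n::finite. cis (- (x \<bullet> \<xi>)) * f x)"
  by (rule cis_mult_integrable) auto

lemma fourier_bound: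
  "norm (fourier f \<xi>) \<le> (\<integral>x. norm (f x) \<partial>lborel)"
proof -
  have "norm (fourier f \<xi>) \<le> (\<integral>x. norm (cis (- (x \<bullet> \<xi>)) * f x) \<partial>lborel)"
    unfolding fourier_def by (rule integral_norm_bound)
  then show ?thesis by (simp add: norm_mult)
qed

lemma schwartz_coordinate_mult: "schwartz f \<Longrightarrow> schwartz (\<lambda>x. complex_of_real (x $ i) * f x)"
  using schwartz_mult_slow[OF _ slow_coordinate] by (simp add: mult.commute)

text \<open>The remainder of the first-order expansion of \<open>e\<^sup>-\<^sup>i\<^sup>x\<^sup>\<xi>\<close> is at most quadratic, which leaves the
  second moment of \<open>|f|\<close> as a bound.\<close>

lemma fourier_has_derivative:
  fixes f :: "real^'n::finite \<Rightarrow> complex"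
  assumes f: "schwartz f"
  shows "(fourier f has_derivative
    (\<lambda>h. \<Sum>i\<in>UNIV. of_real (h $ i) * fourier (\<lambda>x. - \<i> * (of_real (x $ i) * f x)) \<xi>)) (at \<xi>)"
proof -
  define L where "L h = (\<Sum>i\<in>UNIV. of_real (h $ i) * fourier (\<lambda>x. - \<i> * (of_real (x $ i) * f x)) \<xi>)" for h :: "real^'n"
  define K where "K = (\<integral>x. (norm x)\<^sup>2 * norm (f x) \<partial>lborel)"
  have xf: "schwartz (\<lambda>x. - \<i> * (of_real (x $ i) * f x))" for i
    using f by (intro schwartz_cmult schwartz_coordinate_mult)
  have fi: "integrable lborel f" by (rule schwartz_integrable[OF f])
  have Ki: "integrable lborel (\<lambda>x. (norm x)\<^sup>2 * norm (f x))"
  proof -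
    have "schwartz (\<lambda>x. \<Sum>i\<in>I. complex_of_real (x $ i) * (complex_of_real (x $ i) * f x))" for I :: "'n set"
    proof (induction I rule: infinite_finite_induct)
      case (insert i I)
      then show ?case
        using schwartz_add[OF schwartz_coordinate_mult[OF schwartz_coordinate_mult[OF f]] insert(3)] by simp
    qed (use schwartz_cmult[OF f, of 0] in auto)
    from integrable_norm[OF schwartz_integrable[OF this[of UNIV]]]
    show ?thesis
    proof (rule arg_cong[where f="integrable lborel", THEN iffD1, rotated], intro ext)
      fix x :: "real^'n"
      have "(\<Sum>i\<in>UNIV. complex_of_real (x $ i) * (complex_of_real (x $ i) * f x)) = of_real ((norm x)\<^sup>2) * f x"
        unfolding power2_norm_eq_inner inner_vec_def by (simp add: sum_distrib_right mult.assoc)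
      then show "norm (\<Sum>i\<in>UNIV. complex_of_real (x $ i) * (complex_of_real (x $ i) * f x)) = (norm x)\<^sup>2 * norm (f x)"
        by (simp only: norm_mult norm_of_real) simp
    qed
  qed
  have L_eq: "L h = (\<integral>x. cis (- (x \<bullet> \<xi>)) * (- \<i> * of_real (x \<bullet> h) * f x) \<partial>lborel)"
    and L_int: "integrable lborel (\<lambda>x. cis (- (x \<bullet> \<xi>)) * (- \<i> * of_real (x \<bullet> h) * f x))" for h
  proof -
    have i: "integrable lborel (\<lambda>x. of_real (h $ i) * (cis (- (x \<bullet> \<xi>)) * (- \<i> * (of_real (x $ i) * f x))))" for i
      by (intro integrable_mult_right fourier_integrable schwartz_integrable xf)
    have eq: "cis (- (x \<bullet> \<xi>)) * (- \<i> * of_real (x \<bullet> h) * f x) =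
        (\<Sum>i\<in>UNIV. of_real (h $ i) * (cis (- (x \<bullet> \<xi>)) * (- \<i> * (of_real (x $ i) * f x))))" for x
      unfolding inner_vec_def[of x h] by (simp add: sum_distrib_left sum_distrib_right sum_negf mult_ac)
    show "integrable lborel (\<lambda>x. cis (- (x \<bullet> \<xi>)) * (- \<i> * of_real (x \<bullet> h) * f x))"
      unfolding eq by (intro Bochner_Integration.integrable_sum i)
    show "L h = (\<integral>x. cis (- (x \<bullet> \<xi>)) * (- \<i> * of_real (x \<bullet> h) * f x) \<partial>lborel)"
      unfolding eq by (subst Bochner_Integration.integral_sum[OF i]) (simp add: L_def fourier_def)
  qed
  have rem: "norm (fourier f \<zeta> - fourier f \<xi> - L (\<zeta> - \<xi>)) \<le> (norm (\<zeta> - \<xi>))\<^sup>2 * K" for \<zeta>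
  proof -
    let ?h = "\<zeta> - \<xi>"
    let ?d = "\<lambda>x. cis (- (x \<bullet> \<zeta>)) * f x - cis (- (x \<bullet> \<xi>)) * f x - cis (- (x \<bullet> \<xi>)) * (- \<i> * of_real (x \<bullet> ?h) * f x)"
    have "fourier f \<zeta> - fourier f \<xi> - L ?h = (\<integral>x. ?d x \<partial>lborel)"
      unfolding L_eq fourier_def
      using Bochner_Integration.integral_diff[OF Bochner_Integration.integrable_diff[OF
            fourier_integrable[OF fi, of \<zeta>] fourier_integrable[OF fi, of \<xi>]] L_int[of ?h]]
        Bochner_Integration.integral_diff[OF fourier_integrable[OF fi, of \<zeta>] fourier_integrable[OF fi, of \<xi>]]
      by simp
    also have "norm \<dots> \<le> (\<integral>x. (norm ?h)\<^sup>2 * ((norm x)\<^sup>2 * norm (f x)) \<partial>lborel)"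
    proof (rule Bochner_Integration.integral_norm_bound_integral)
      show "integrable lborel ?d"
        by (intro Bochner_Integration.integrable_diff fourier_integrable fi L_int)
      show "integrable lborel (\<lambda>x. (norm ?h)\<^sup>2 * ((norm x)\<^sup>2 * norm (f x)))"
        by (intro integrable_mult_right Ki)
      fix x
      let ?y = "- (x \<bullet> ?h)"
      have "cis (- (x \<bullet> \<zeta>)) = cis (- (x \<bullet> \<xi>)) * cis ?y"
        by (simp add: cis_mult inner_diff_right)
      then have "?d x = cis (- (x \<bullet> \<xi>)) * (cis ?y - (1 + \<i> * of_real ?y)) * f x"
        by (simp add: algebra_simps)
      then have "norm (?d x) = norm (cis ?y - (1 + \<i> * of_real ?y)) * norm (f x)"
        by (simp only: norm_mult norm_cis mult_1)
      also have "norm (cis ?y - (1 + \<i> * of_real ?y)) \<le> \<bar>?y\<bar>\<^sup>2 / 2"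
        using iexp_approx1[of ?y 1] by (simp add: cis_conv_exp power2_eq_square)
      also have "\<bar>?y\<bar>\<^sup>2 / 2 \<le> (norm x * norm ?h)\<^sup>2"
        using power_mono[OF Cauchy_Schwarz_ineq2[of x ?h], of 2] zero_le_power2[of "norm x * norm ?h"]
        unfolding power2_abs power2_minus abs_minus_cancel by linarith
      finally show "norm (?d x) \<le> (norm ?h)\<^sup>2 * ((norm x)\<^sup>2 * norm (f x))"
        by (simp add: power_mult_distrib mult_right_mono mult_ac)
    qed
    finally show ?thesis by (simp add: K_def)
  qed
  have "(fourier f has_derivative L) (at \<xi>)"
  proof (rule has_derivativeI_sandwich[of 1])
    show "bounded_linear L"
      unfolding L_def[abs_def]
      by (intro bounded_linear_sum bounded_linear_compose[OF bounded_linear_mult_left]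
          bounded_linear_compose[OF bounded_linear_of_real] bounded_linear_vec_nth)
    show "norm (fourier f \<zeta> - fourier f \<xi> - L (\<zeta> - \<xi>)) / norm (\<zeta> - \<xi>) \<le> norm (\<zeta> - \<xi>) * K" if "\<zeta> \<noteq> \<xi>" for \<zeta>
      using rem[of \<zeta>] that by (simp add: divide_le_eq power2_eq_square mult_ac)
    show "((\<lambda>\<zeta>. norm (\<zeta> - \<xi>) * K) \<longlongrightarrow> 0) (at \<xi>)"
      by (auto intro!: tendsto_eq_intros)
  qed simp
  then show ?thesis by (simp add: L_def[abs_def])
qed

lemma pderivative_fourier:
  assumes "schwartz f"
  shows "pderivative i (fourier f) = fourier (\<lambda>x. - \<i> * (of_real (x $ i) * f x))"
proof
  fix \<xi>
  have "pderivative i (fourier f) \<xi> =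
      (\<Sum>j\<in>UNIV. of_real (axis i 1 $ j) * fourier (\<lambda>x. - \<i> * (of_real (x $ j) * f x)) \<xi>)"
    by (rule has_derivative_imp_pderivative(2)[OF fourier_has_derivative[OF assms]])
  also have "\<dots> = (\<Sum>j\<in>UNIV. if j = i then fourier (\<lambda>x. - \<i> * (of_real (x $ j) * f x)) \<xi> else 0)"
    by (intro sum.cong) (auto simp: axis_def)
  finally show "pderivative i (fourier f) \<xi> = fourier (\<lambda>x. - \<i> * (of_real (x $ i) * f x)) \<xi>"
    by simp
qed

lemma fourier_translate:
  assumes "integrable lborel f"
  shows "fourier (\<lambda>x. f (x + a)) \<xi> = cis (a \<bullet> \<xi>) * fourier f \<xi>"
proof -
  have i: "integrable lborel (\<lambda>x. cis (- (x \<bullet> \<xi>)) * f x)"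
    by (rule fourier_integrable[OF assms])
  have "fourier f \<xi> = (\<integral>x. cis (- ((a + 1 *\<^sub>R x) \<bullet> \<xi>)) * f (a + 1 *\<^sub>R x) \<partial>lborel)"
    unfolding fourier_def by (subst lborel_integral_affine[OF i, of 1 a]) simp_all
  then have "cis (a \<bullet> \<xi>) * fourier f \<xi> = (\<integral>x. cis (a \<bullet> \<xi>) * (cis (- ((a + 1 *\<^sub>R x) \<bullet> \<xi>)) * f (a + 1 *\<^sub>R x)) \<partial>lborel)"
    by simp
  also have "\<dots> = fourier (\<lambda>x. f (x + a)) \<xi>"
    unfolding fourier_def
    by (intro Bochner_Integration.integral_cong refl)
       (simp add: mult.assoc[symmetric] cis_mult inner_add_left add.commute)
  finally show ?thesis by simp
qed

lemma has_vector_derivative_quotient: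
  fixes f :: "real \<Rightarrow> 'a::real_normed_vector"
  assumes "(f has_vector_derivative D) (at 0)"
  shows "((\<lambda>s. (f s - f 0) /\<^sub>R s) \<longlongrightarrow> D) (at 0)"
proof -
  have "((\<lambda>h. norm (f h - f 0 - h *\<^sub>R D) / norm h) \<longlongrightarrow> 0) (at 0)"
    using assms unfolding has_vector_derivative_def has_derivative_at by simp
  moreover have "eventually (\<lambda>h. norm (f h - f 0 - h *\<^sub>R D) / norm h = norm ((f h - f 0) /\<^sub>R h - D)) (at 0)"
  proof (rule eventually_at_topological[THEN iffD2], intro exI[of _ UNIV] conjI ballI impI)
    fix h :: real assume h: "h \<noteq> 0"
    then have "(f h - f 0) /\<^sub>R h - D = (f h - f 0 - h *\<^sub>R D) /\<^sub>R h"
      by (simp add: scaleR_diff_right)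
    then show "norm (f h - f 0 - h *\<^sub>R D) / norm h = norm ((f h - f 0) /\<^sub>R h - D)"
      by (simp add: divide_inverse mult.commute)
  qed auto
  ultimately have "((\<lambda>h. norm ((f h - f 0) /\<^sub>R h - D)) \<longlongrightarrow> 0) (at 0)"
    by (simp add: tendsto_cong)
  then show ?thesis
    by (metis LIM_zero_iff tendsto_norm_zero_iff)
qed

text \<open>Instead of integrating by parts one differentiates the covariance of the Fourier transform
  under translations; the decay of the derivative dominates the difference quotients.\<close>

lemma fourier_pderivative:
  fixes f :: "real^'n::finite \<Rightarrow> complex"
  assumes f: "schwartz f"
  shows "fourier (pderivative i f) \<xi> = \<i> * of_real (\<xi> $ i) * fourier f \<xi>"
proof -
  define h where "h k = 1 / real (Suc k)" for k
  have h: "0 < h k" "h k \<le> 1" for k by (auto simp: h_def)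
  have h0: "h \<longlonglongrightarrow> 0" unfolding h_def by (rule LIMSEQ_Suc[OF lim_const_over_n])
  have h0': "filterlim h (at 0) sequentially"
    using h0 h(1) by (intro filterlim_atI) (auto simp: less_imp_neq[symmetric] intro!: always_eventually)
  let ?e = "axis i (1::real) :: real^'n"
  define q where "q k x = (f (x + h k *\<^sub>R ?e) - f x) / of_real (h k)" for k x
  have vd: "((\<lambda>s. f (x + s *\<^sub>R ?e)) has_vector_derivative pderivative i f (x + s *\<^sub>R ?e)) (at s)" for x s
  proof -
    have "((\<lambda>u. f ((x + s *\<^sub>R ?e) + u *\<^sub>R ?e)) has_vector_derivative pderivative i f (x + s *\<^sub>R ?e)) (at 0)"
      using has_derivative_imp_pderivative[OF schwartz_differentiable[OF f, unfolded frechet_derivative_works]]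
      by metis
    then have "((\<lambda>u. f ((x + s *\<^sub>R ?e) + (u - s) *\<^sub>R ?e)) has_vector_derivative pderivative i f (x + s *\<^sub>R ?e)) (at s)"
      using vector_diff_chain_at[of "\<lambda>u. u - s" 1 s "\<lambda>u. f ((x + s *\<^sub>R ?e) + u *\<^sub>R ?e)",
          OF has_vector_derivative_diff[OF has_vector_derivative_id has_vector_derivative_const, simplified]]
      by (simp add: o_def)
    then show ?thesis by (simp add: algebra_simps)
  qed
  obtain C where C: "C \<ge> 0" "\<And>x. norm (pderivative i f x) \<le> C / (1 + norm x) ^ (2 * CARD('n))"
    using schwartz_decay[OF schwartz_pderivative[OF f]] by blast
  \<comment> \<open>A shift by at most one at most doubles \<open>1 + |x|\<close>.\<close>
  define D where "D = C * 2 ^ (2 * CARD('n))"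
  have near: "norm (pderivative i f (x + s *\<^sub>R ?e)) \<le> D / (1 + norm x) ^ (2 * CARD('n))"
    if "0 \<le> s" "s \<le> 1" for x s
  proof -
    have "norm x \<le> norm (x + s *\<^sub>R ?e) + norm (s *\<^sub>R ?e)"
      by (metis add_diff_cancel norm_triangle_ineq4)
    also have "norm (s *\<^sub>R ?e) \<le> 1" using that by (simp add: norm_axis_1)
    finally have "1 + norm x \<le> 2 * (1 + norm (x + s *\<^sub>R ?e))"
      by (smt (verit) norm_ge_zero)
    then have "(1 + norm x) ^ (2 * CARD('n)) \<le> 2 ^ (2 * CARD('n)) * (1 + norm (x + s *\<^sub>R ?e)) ^ (2 * CARD('n))"
      unfolding power_mult_distrib[symmetric] by (intro power_mono) auto
    then have "C * (1 + norm x) ^ (2 * CARD('n)) \<le> D * (1 + norm (x + s *\<^sub>R ?e)) ^ (2 * CARD('n))"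
      unfolding D_def mult.assoc using C(1) by (rule mult_left_mono)
    moreover have "(1 + norm x) ^ (2 * CARD('n)) > 0" "(1 + norm (x + s *\<^sub>R ?e)) ^ (2 * CARD('n)) > 0"
      by (auto intro!: zero_less_power add_pos_nonneg)
    ultimately have "C / (1 + norm (x + s *\<^sub>R ?e)) ^ (2 * CARD('n)) \<le> D / (1 + norm x) ^ (2 * CARD('n))"
      by (simp add: divide_simps)
    with C(2) show ?thesis by (rule order_trans)
  qed
  have q_bound: "norm (q k x) \<le> D * (1 / (1 + norm x) ^ (2 * CARD('n)))" for k x
  proof -
    have "norm (f (x + h k *\<^sub>R ?e) - f (x + 0 *\<^sub>R ?e)) \<le> D / (1 + norm x) ^ (2 * CARD('n)) * norm (h k - 0)"
    proof (rule differentiable_bound[of "{0..1}" "\<lambda>s. f (x + s *\<^sub>R ?e)"])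
      show "((\<lambda>s. f (x + s *\<^sub>R ?e)) has_derivative (\<lambda>u. u *\<^sub>R pderivative i f (x + s *\<^sub>R ?e))) (at s within {0..1})" for s
        using vd[of x s] unfolding has_vector_derivative_def by (rule has_derivative_at_withinI)
      show "onorm (\<lambda>u. u *\<^sub>R pderivative i f (x + s *\<^sub>R ?e)) \<le> D / (1 + norm x) ^ (2 * CARD('n))" if "s \<in> {0..1}" for s
      proof (rule onorm_le)
        fix u :: real
        show "norm (u *\<^sub>R pderivative i f (x + s *\<^sub>R ?e)) \<le> D / (1 + norm x) ^ (2 * CARD('n)) * norm u"
          using mult_right_mono[OF near[of s x], of "norm u"] that by (simp add: mult.commute)
      qed
    qed (use h in \<open>auto simp: less_imp_le\<close>)
    then have "norm (f (x + h k *\<^sub>R ?e) - f x) / h k \<le> D / (1 + norm x) ^ (2 * CARD('n))"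
      using h(1)[of k] by (simp add: pos_divide_le_eq)
    then show ?thesis using h(1)[of k] by (simp add: q_def norm_divide)
  qed
  have q_lim: "(\<lambda>k. q k x) \<longlonglongrightarrow> pderivative i f x" for x
  proof -
    have "((\<lambda>s. (f (x + s *\<^sub>R ?e) - f x) /\<^sub>R s) \<longlongrightarrow> pderivative i f x) (at 0)"
      using has_vector_derivative_quotient[OF vd[of x 0]] by simp
    from filterlim_compose[OF this h0'] show ?thesis
      by (simp add: q_def scaleR_conv_of_real divide_inverse mult.commute)
  qed
  have fi: "integrable lborel f" by (rule schwartz_integrable[OF f])
  have fi': "integrable lborel (\<lambda>x. f (x + a))" for a
    using lborel_integrable_affine[OF fi, of 1 a] by (simp add: add.commute)
  have Fq: "fourier (q k) \<xi> = (cis (h k * \<xi> $ i) - 1) / of_real (h k) * fourier f \<xi>" for k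
  proof -
    have "fourier (q k) \<xi> = (fourier (\<lambda>x. f (x + h k *\<^sub>R ?e)) \<xi> - fourier f \<xi>) / of_real (h k)"
      unfolding fourier_def q_def times_divide_eq_right right_diff_distrib
      by (simp add: fourier_integrable fi fi')
    also have "\<dots> = (cis (h k * \<xi> $ i) - 1) / of_real (h k) * fourier f \<xi>"
      unfolding fourier_translate[OF fi] by (simp add: inner_axis' algebra_simps diff_divide_distrib)
    finally show ?thesis .
  qed
  have "(\<lambda>k. fourier (q k) \<xi>) \<longlonglongrightarrow> fourier (pderivative i f) \<xi>"
    unfolding fourier_def
  proof (rule integral_dominated_convergence)
    show "integrable lborel (\<lambda>x::real^'n. D * (1 / (1 + norm x) ^ (2 * CARD('n))))"
      by (intro integrable_mult_right integrable_decay)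
    note [measurable] = schwartz_measurable[OF f] schwartz_measurable[OF schwartz_pderivative[OF f]]
    show "(\<lambda>x. cis (- (x \<bullet> \<xi>)) * pderivative i f x) \<in> borel_measurable lborel"
      by measurable
    show "(\<lambda>x. cis (- (x \<bullet> \<xi>)) * q k x) \<in> borel_measurable lborel" for k
      unfolding q_def by measurable
    show "AE x in lborel. (\<lambda>k. cis (- (x \<bullet> \<xi>)) * q k x) \<longlonglongrightarrow> cis (- (x \<bullet> \<xi>)) * pderivative i f x"
      by (intro AE_I2 tendsto_mult_left q_lim)
    show "AE x in lborel. norm (cis (- (x \<bullet> \<xi>)) * q k x) \<le> D * (1 / (1 + norm x) ^ (2 * CARD('n)))" for k
      using q_bound[of k] by (auto simp: norm_mult)
  qed
  moreover have "(\<lambda>k. fourier (q k) \<xi>) \<longlonglongrightarrow> \<i> * of_real (\<xi> $ i) * fourier f \<xi>"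
  proof -
    have "((\<lambda>s. cis (s * \<xi> $ i)) has_vector_derivative \<i> * of_real (\<xi> $ i)) (at 0)"
      using exp_scaleR_has_vector_derivative_right[of "\<i> * of_real (\<xi> $ i)" 0 UNIV]
      by (simp add: cis_conv_exp scaleR_conv_of_real mult_ac)
    then have "((\<lambda>s. (cis (s * \<xi> $ i) - 1) /\<^sub>R s) \<longlongrightarrow> \<i> * of_real (\<xi> $ i)) (at 0)"
      by (auto dest!: has_vector_derivative_quotient)
    from filterlim_compose[OF this h0']
    have "(\<lambda>k. (cis (h k * \<xi> $ i) - 1) / of_real (h k)) \<longlonglongrightarrow> \<i> * of_real (\<xi> $ i)"
      by (simp add: scaleR_conv_of_real divide_inverse mult.commute)
    then show ?thesis
      unfolding Fq by (rule tendsto_mult_right)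
  qed
  ultimately show ?thesis by (rule LIMSEQ_unique)
qed

text \<open>Each power of \<open>|\<xi>|\<close> costs one derivative of \<open>f\<close>.\<close>

lemma rapid_fourier:
  fixes f :: "real^'n::finite \<Rightarrow> complex"
  assumes "schwartz f" shows "rapid (fourier f)"
  unfolding rapid_def
proof
  fix N :: nat
  show "\<exists>C. \<forall>\<xi>. (1 + norm \<xi>) ^ N * norm (fourier f \<xi>) \<le> C"
    using assms
  proof (induction N arbitrary: f)
    case 0
    then show ?case using fourier_bound[of f] by auto
  next
    case (Suc N)
    obtain A where A: "\<And>\<xi>. (1 + norm \<xi>) ^ N * norm (fourier f \<xi>) \<le> A"
      using Suc by blast
    have "\<forall>i. \<exists>B. \<forall>\<xi>. (1 + norm \<xi>) ^ N * norm (fourier (pderivative i f) \<xi>) \<le> B"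
      using Suc.IH[OF schwartz_pderivative[OF Suc.prems]] by blast
    then obtain B where B: "\<And>i \<xi>. (1 + norm \<xi>) ^ N * norm (fourier (pderivative i f) \<xi>) \<le> B i"
      by metis
    have "(1 + norm \<xi>) ^ Suc N * norm (fourier f \<xi>) \<le> A + (\<Sum>i\<in>UNIV. B i)" for \<xi> :: "real^'n"
    proof -
      have "(1 + norm \<xi>) ^ Suc N * norm (fourier f \<xi>)
          \<le> (1 + norm \<xi>) ^ N * ((1 + (\<Sum>i\<in>UNIV. \<bar>\<xi> $ i\<bar>)) * norm (fourier f \<xi>))"
        using norm_le_l1_cart[of \<xi>]
        unfolding power_Suc2 mult.assoc by (intro mult_left_mono mult_right_mono) auto
      also have "\<dots> = (1 + norm \<xi>) ^ N * norm (fourier f \<xi>)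
          + (\<Sum>i\<in>UNIV. (1 + norm \<xi>) ^ N * norm (fourier (pderivative i f) \<xi>))"
        unfolding fourier_pderivative[OF Suc.prems]
        by (simp add: norm_mult distrib_right distrib_left sum_distrib_left sum_distrib_right mult_ac)
      also have "\<dots> \<le> A + (\<Sum>i\<in>UNIV. B i)"
        by (intro add_mono sum_mono A B)
      finally show ?thesis .
    qed
    then show ?case by blast
  qed
qed

text \<open>Transforms of Schwartz functions are differentiable and rapidly decreasing, and so are their
  partial derivatives, which are again such transforms.\<close>

lemma schwartz_fourier:
  assumes "schwartz f" shows "schwartz (fourier f)"
proof (rule schwartz_coinduct[of _ "fourier ` Collect schwartz"])
  fix g :: "real^'a \<Rightarrow> complex" assume "g \<in> fourier ` Collect schwartz"
  then obtain f where f: "schwartz f" and g: "g = fourier f" by blast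
  show "g differentiable (at \<xi>)" for \<xi>
    unfolding g differentiable_def using fourier_has_derivative[OF f] by blast
  show "rapid g"
    unfolding g by (rule rapid_fourier[OF f])
  show "pderivative i g \<in> fourier ` Collect schwartz" for i
    unfolding g pderivative_fourier[OF f]
    using f by (intro imageI CollectI schwartz_cmult schwartz_coordinate_mult)
qed (use assms in blast)

lemma inv_fourier_eq:
  fixes f :: "real^'n::finite \<Rightarrow> complex"
  shows "inv_fourier f x = of_real (1 / (2 * pi) ^ CARD('n)) * fourier f (- x)"
  unfolding inv_fourier_def fourier_def by (simp add: inner_commute)

lemma schwartz_inv_fourier:
  assumes "schwartz f" shows "schwartz (inv_fourier f)"
proof -
  have "schwartz (\<lambda>x. of_real (1 / (2 * pi) ^ CARD('a)) * fourier f ((-1) *\<^sub>R x))"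
    by (intro schwartz_cmult schwartz_scale schwartz_fourier assms) simp
  then show ?thesis
    by (simp add: inv_fourier_eq[abs_def])
qed

section \<open>Fourier inversion\<close>

text \<open>The kernel will be a complex exponential.\<close>

lemma Fubini_bounded_kernel:
  fixes f g :: "real^'n::finite \<Rightarrow> complex" and k :: "real^'n \<Rightarrow> real^'n \<Rightarrow> complex"
  assumes f: "integrable lborel f" and g: "integrable lborel g"
    and k [measurable]: "case_prod k \<in> borel_measurable (borel \<Otimes>\<^sub>M borel)"
    and k1: "\<And>x y. norm (k x y) \<le> 1"
  shows "(\<integral>x. f x * (\<integral>y. k x y * g y \<partial>lborel) \<partial>lborel) = (\<integral>y. g y * (\<integral>x. k x y * f x \<partial>lborel) \<partial>lborel)"
proof -
  note [measurable] = borel_measurable_integrable[OF f] borel_measurable_integrable[OF g]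
  have k_lb [measurable]: "case_prod k \<in> borel_measurable (lborel \<Otimes>\<^sub>M lborel)"
    using k by (simp cong: measurable_cong_sets)
  have fn: "integrable lborel (\<lambda>x. norm (f x))" and gn: "integrable lborel (\<lambda>x. norm (g x))"
    using f g by auto
  have kb: "norm (k x y * z) \<le> norm z" for x y z
    using mult_right_mono[OF k1 norm_ge_zero, of x y z] by (simp add: norm_mult)
  have int: "integrable (lborel \<Otimes>\<^sub>M lborel) (\<lambda>(x, y). f x * (k x y * g y))"
  proof (rule lborel_pair.Fubini_integrable)
    show m: "(\<lambda>(x, y). f x * (k x y * g y)) \<in> borel_measurable (lborel \<Otimes>\<^sub>M lborel)"
      by measurable
    have kg: "integrable lborel (\<lambda>y. k x y * g y)" for x
    proof (rule Bochner_Integration.integrable_bound[OF g])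
      show "(\<lambda>y. k x y * g y) \<in> borel_measurable lborel" by measurable
      show "AE y in lborel. norm (k x y * g y) \<le> norm (g y)"
        using kb by blast
    qed
    then show "AE x in lborel. integrable lborel (\<lambda>y. case (x, y) of (x, y) \<Rightarrow> f x * (k x y * g y))"
      by simp
    show "integrable lborel (\<lambda>x. \<integral>y. norm (case (x, y) of (x, y) \<Rightarrow> f x * (k x y * g y)) \<partial>lborel)"
    proof (rule Bochner_Integration.integrable_bound[OF integrable_mult_left[OF fn, of "\<integral>y. norm (g y) \<partial>lborel"]])
      show "(\<lambda>x. \<integral>y. norm (case (x, y) of (x, y) \<Rightarrow> f x * (k x y * g y)) \<partial>lborel) \<in> borel_measurable lborel"
        by measurable
      show "AE x in lborel. norm (\<integral>y. norm (case (x, y) of (x, y) \<Rightarrow> f x * (k x y * g y)) \<partial>lborel)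
          \<le> norm (norm (f x) * (\<integral>y. norm (g y) \<partial>lborel))"
      proof (rule AE_I2)
        fix x
        have "(\<integral>y. norm (k x y * g y) \<partial>lborel) \<le> (\<integral>y. norm (g y) \<partial>lborel)"
          by (intro integral_mono gn integrable_norm kg kb)
        moreover have "0 \<le> (\<integral>y. norm (k x y * g y) \<partial>lborel)" by simp
        ultimately show "norm (\<integral>y. norm (case (x, y) of (x, y) \<Rightarrow> f x * (k x y * g y)) \<partial>lborel)
          \<le> norm (norm (f x) * (\<integral>y. norm (g y) \<partial>lborel))"
          by (simp add: norm_mult[of "f x"] abs_mult mult_left_mono)
      qed
    qed
  qed
  have "(\<integral>x. f x * (\<integral>y. k x y * g y \<partial>lborel) \<partial>lborel) = (\<integral>x. (\<integral>y. f x * (k x y * g y) \<partial>lborel) \<partial>lborel)"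
    by simp
  also have "\<dots> = (\<integral>y. (\<integral>x. f x * (k x y * g y) \<partial>lborel) \<partial>lborel)"
    by (rule lborel_pair.Fubini_integral[symmetric]) (rule int)
  also have "\<dots> = (\<integral>y. (\<integral>x. g y * (k x y * f x) \<partial>lborel) \<partial>lborel)"
    by (intro Bochner_Integration.integral_cong refl) (simp add: mult_ac)
  finally show ?thesis by simp
qed

lemma fourier_multiplication_formula:
  assumes "integrable lborel f" "integrable lborel g"
  shows "(\<integral>x. f x * fourier g x \<partial>lborel) = (\<integral>x. fourier f x * g x \<partial>lborel)"
  using Fubini_bounded_kernel[OF assms, of "\<lambda>x y. cis (- (x \<bullet> y))"]
  unfolding fourier_def by (simp add: inner_commute mult.commute)

lemma fourier_measurable [measurable]:
  assumes [measurable]: "f \<in> borel_measurable borel"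
  shows "fourier f \<in> borel_measurable borel"
proof -
  have "(\<lambda>\<xi>. \<integral>x. cis (- (x \<bullet> \<xi>)) * f x \<partial>lborel) \<in> borel_measurable borel"
    by measurable
  then show ?thesis by (simp add: fourier_def[abs_def])
qed

definition eps :: "nat \<Rightarrow> real" where "eps k = 1 / real (Suc k)"

lemma eps_pos: "eps k > 0" and eps_lim: "eps \<longlonglongrightarrow> 0"
  using LIMSEQ_inverse_real_of_nat by (auto simp: eps_def[abs_def] inverse_eq_divide)

lemma gauss_eps_lim: "(\<lambda>k. gauss (eps k *\<^sub>R x)) \<longlonglongrightarrow> 1"
proof -
  have "(\<lambda>k. gauss (eps k *\<^sub>R x)) \<longlonglongrightarrow> exp (- (norm (0 *\<^sub>R x))\<^sup>2 / 2)"
    unfolding gauss_def by (intro tendsto_intros eps_lim) auto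
  then show ?thesis by simp
qed

lemma integrable_bounded_mult:
  fixes f g :: "'a \<Rightarrow> complex"
  assumes "integrable M f" "g \<in> borel_measurable M" "\<And>x. norm (g x) \<le> C"
  shows "integrable M (\<lambda>x. g x * f x)"
proof (rule Bochner_Integration.integrable_bound)
  show "integrable M (\<lambda>x. C * norm (f x))"
    using assms by auto
  show "AE x in M. norm (g x * f x) \<le> norm (C * norm (f x))"
  proof (rule AE_I2)
    fix x
    have "norm (g x) * norm (f x) \<le> \<bar>C\<bar> * norm (f x)"
      using assms(3)[of x] by (intro mult_right_mono) auto
    then show "norm (g x * f x) \<le> norm (C * norm (f x))"
      by (simp add: norm_mult abs_mult)
  qed
  show "(\<lambda>x. g x * f x) \<in> borel_measurable M"
    using assms by auto
qed

text \<open>Damping by a Gaussian makes the double integral absolutely convergent; after exchanging the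
  integrals the kernel is a multiple of an approximate identity.\<close>

lemma fourier_gauss_mean:
  fixes f :: "real^'n::finite \<Rightarrow> complex"
  assumes f: "integrable lborel f" and e: "e > 0"
  shows "(\<integral>\<xi>. cis (x \<bullet> \<xi>) * of_real (gauss (e *\<^sub>R \<xi>)) * fourier f \<xi> \<partial>lborel) =
    (\<integral>y. f y * of_real (sqrt (2 * pi) ^ CARD('n) / e ^ CARD('n) * gauss ((1 / e) *\<^sub>R (x - y))) \<partial>lborel)"
proof -
  let ?g = "\<lambda>\<xi>::real^'n. cis (\<xi> \<bullet> x) * complex_of_real (gauss (e *\<^sub>R \<xi>))"
  have g: "integrable lborel ?g"
    by (rule gauss_scaled_fourier(2)[OF e])
  have "(\<integral>\<xi>. cis (x \<bullet> \<xi>) * of_real (gauss (e *\<^sub>R \<xi>)) * fourier f \<xi> \<partial>lborel)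
      = (\<integral>\<xi>. ?g \<xi> * (\<integral>y. cis (- (y \<bullet> \<xi>)) * f y \<partial>lborel) \<partial>lborel)"
    by (simp add: fourier_def inner_commute)
  also have "\<dots> = (\<integral>y. f y * (\<integral>\<xi>. cis (- (y \<bullet> \<xi>)) * ?g \<xi> \<partial>lborel) \<partial>lborel)"
    by (rule Fubini_bounded_kernel[OF g f]) auto
  also have "\<dots> = (\<integral>y. f y * (\<integral>\<xi>. cis (\<xi> \<bullet> (x - y)) * complex_of_real (gauss (e *\<^sub>R \<xi>)) \<partial>lborel) \<partial>lborel)"
    by (simp add: mult.assoc[symmetric] cis_mult inner_diff_right inner_commute)
  also have "\<dots> = (\<integral>y. f y * of_real (sqrt (2 * pi) ^ CARD('n) / e ^ CARD('n) * gauss ((1 / e) *\<^sub>R (x - y))) \<partial>lborel)"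
    by (simp only: gauss_scaled_fourier(1)[OF e])
  finally show ?thesis .
qed

text \<open>As the Gaussian factor is removed, the regularised integral tends to the inversion integral by
  dominated convergence; by the preceding identity it also tends to \<open>f x\<close> times the square of the mass of the Gaussian.\<close>

theorem fourier_inversion:
  fixes f :: "real^'n::finite \<Rightarrow> complex"
  assumes f: "schwartz f"
  shows "inv_fourier (fourier f) = f"
proof
  fix x
  define c where "c = sqrt (2 * pi) ^ CARD('n)"
  have cc: "c * c = (2 * pi) ^ CARD('n)"
    unfolding c_def power_mult_distrib[symmetric] by simp
  obtain C where C: "\<And>x. norm (f x) \<le> C"
    using schwartz_bounded[OF f] by blast
  have [measurable]: "f \<in> borel_measurable borel"
    by (rule schwartz_measurable[OF f])
  have fi: "integrable lborel f" and Fi: "integrable lborel (fourier f)"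
    using f by (auto intro: schwartz_integrable schwartz_fourier)
  let ?J = "\<lambda>k. \<integral>\<xi>. cis (x \<bullet> \<xi>) * of_real (gauss (eps k *\<^sub>R \<xi>)) * fourier f \<xi> \<partial>lborel"
  have "?J \<longlonglongrightarrow> (\<integral>\<xi>. cis (x \<bullet> \<xi>) * fourier f \<xi> \<partial>lborel)"
  proof (rule integral_dominated_convergence)
    show "integrable lborel (\<lambda>\<xi>. norm (fourier f \<xi>))" using Fi by simp
    show "AE \<xi> in lborel. (\<lambda>k. cis (x \<bullet> \<xi>) * of_real (gauss (eps k *\<^sub>R \<xi>)) * fourier f \<xi>)
        \<longlonglongrightarrow> cis (x \<bullet> \<xi>) * fourier f \<xi>"
    proof (rule AE_I2)
      fix \<xi> :: "real^'n"
      have "(\<lambda>k. cis (x \<bullet> \<xi>) * of_real (gauss (eps k *\<^sub>R \<xi>)) * fourier f \<xi>)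
        \<longlonglongrightarrow> cis (x \<bullet> \<xi>) * of_real 1 * fourier f \<xi>"
        by (intro tendsto_intros gauss_eps_lim)
      then show "(\<lambda>k. cis (x \<bullet> \<xi>) * of_real (gauss (eps k *\<^sub>R \<xi>)) * fourier f \<xi>)
        \<longlonglongrightarrow> cis (x \<bullet> \<xi>) * fourier f \<xi>" by simp
    qed
    show "AE \<xi> in lborel. norm (cis (x \<bullet> \<xi>) * of_real (gauss (eps k *\<^sub>R \<xi>)) * fourier f \<xi>) \<le> norm (fourier f \<xi>)" for k
      using gauss_le_1 gauss_pos
      by (intro AE_I2) (auto simp: norm_mult less_imp_le intro!: mult_left_le_one_le)
  qed auto
  moreover have "?J \<longlonglongrightarrow> of_real c * (f x * of_real c)"
  proof -
    have J: "?J k = of_real c * (\<integral>z. f (x + eps k *\<^sub>R z) * of_real (gauss z) \<partial>lborel)" for k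
    proof -
      let ?u = "\<lambda>y. f y * of_real (c / eps k ^ CARD('n) * gauss ((1 / eps k) *\<^sub>R (x - y)))"
      have ui: "integrable lborel ?u"
      proof -
        have "norm (of_real (c / eps k ^ CARD('n) * gauss ((1 / eps k) *\<^sub>R (x - y))) :: complex) \<le> c / eps k ^ CARD('n)" for y
        proof -
          have "c / eps k ^ CARD('n) \<ge> 0"
            using eps_pos[of k] by (simp add: c_def)
          from mult_left_le[OF gauss_le_1 this] mult_nonneg_nonneg[OF this gauss_nonneg] show ?thesis
            unfolding norm_of_real by (metis abs_of_nonneg)
        qed
        then have "integrable lborel (\<lambda>y. of_real (c / eps k ^ CARD('n) * gauss ((1 / eps k) *\<^sub>R (x - y))) * f y)"
          by (intro integrable_bounded_mult[OF fi]) auto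
        then show ?thesis by (simp add: mult.commute)
      qed
      have "?J k = (\<integral>y. ?u y \<partial>lborel)"
        unfolding c_def by (rule fourier_gauss_mean[OF fi eps_pos])
      also have "\<dots> = eps k ^ CARD('n) *\<^sub>R (\<integral>z. ?u (x + eps k *\<^sub>R z) \<partial>lborel)"
        using lborel_integral_affine[OF ui, of "eps k" x] eps_pos[of k] by (simp add: less_imp_neq[symmetric])
      also have "(\<integral>z. ?u (x + eps k *\<^sub>R z) \<partial>lborel)
          = (\<integral>z. of_real (c / eps k ^ CARD('n)) * (f (x + eps k *\<^sub>R z) * of_real (gauss z)) \<partial>lborel)"
        using eps_pos[of k] by (intro Bochner_Integration.integral_cong refl) (simp add: gauss_def)
      also have "eps k ^ CARD('n) *\<^sub>R \<dots> = of_real c * (\<integral>z. f (x + eps k *\<^sub>R z) * of_real (gauss z) \<partial>lborel)"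
        using eps_pos[of k] by (simp add: scaleR_conv_of_real)
      finally show ?thesis .
    qed
    have "(\<lambda>k. \<integral>z. f (x + eps k *\<^sub>R z) * of_real (gauss z) \<partial>lborel) \<longlonglongrightarrow> (\<integral>z. f x * of_real (gauss (z::real^'n)) \<partial>lborel)"
    proof (rule integral_dominated_convergence)
      show "integrable lborel (\<lambda>z::real^'n. C * gauss z)"
        by (intro integrable_mult_right integrable_gauss)
      show "AE z in lborel. (\<lambda>k. f (x + eps k *\<^sub>R z) * of_real (gauss z)) \<longlonglongrightarrow> f x * of_real (gauss z)"
      proof (rule AE_I2)
        fix z
        have "(\<lambda>k. x + eps k *\<^sub>R z) \<longlonglongrightarrow> x + 0 *\<^sub>R z"
          by (intro tendsto_intros eps_lim)
        then have "(\<lambda>k. f (x + eps k *\<^sub>R z)) \<longlonglongrightarrow> f x"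
          using differentiable_imp_continuous_within[OF schwartz_differentiable[OF f, of x]]
          by (intro isCont_tendsto_compose[of x f]) auto
        then show "(\<lambda>k. f (x + eps k *\<^sub>R z) * of_real (gauss z)) \<longlonglongrightarrow> f x * of_real (gauss z)"
          by (rule tendsto_mult_right)
      qed
      show "AE z in lborel. norm (f (x + eps k *\<^sub>R z) * of_real (gauss z)) \<le> C * gauss z" for k
        using C gauss_pos by (intro AE_I2) (auto simp: norm_mult less_imp_le intro!: mult_right_mono)
    qed auto
    also have "(\<integral>z. f x * of_real (gauss (z::real^'n)) \<partial>lborel) = f x * of_real c"
      by (simp add: integral_gauss c_def)
    finally show ?thesis
      unfolding J by (rule tendsto_mult_left)
  qed
  ultimately have "(\<integral>\<xi>. cis (x \<bullet> \<xi>) * fourier f \<xi> \<partial>lborel) = of_real c * (f x * of_real c)"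
    by (rule LIMSEQ_unique)
  also have "\<dots> = of_real ((2 * pi) ^ CARD('n)) * f x"
    unfolding cc[symmetric] by simp
  finally show "inv_fourier (fourier f) x = f x"
    unfolding inv_fourier_def by simp
qed

section \<open>Plancherel's inequality and the Fourier transform on square integrable functions\<close>

text \<open>The square of the \<open>L\<^sup>2\<close> norm.\<close>

definition energy :: "(real^'n::finite \<Rightarrow> complex) \<Rightarrow> ennreal" where
  "energy f = (\<integral>\<^sup>+x. (ennreal (norm (f x)))\<^sup>2 \<partial>lborel)"

text \<open>Fatou's lemma in the form needed to pass bounds to almost everywhere limits.\<close>

lemma nn_integral_limit_le:
  fixes u :: "nat \<Rightarrow> 'a \<Rightarrow> ennreal"
  assumes [measurable]: "\<And>k. u k \<in> borel_measurable M"
    and lim: "AE x in M. (\<lambda>k. u k x) \<longlonglongrightarrow> v x"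
    and le: "\<And>k. (\<integral>\<^sup>+x. u k x \<partial>M) \<le> B"
  shows "(\<integral>\<^sup>+x. v x \<partial>M) \<le> B"
proof -
  have "(\<integral>\<^sup>+x. v x \<partial>M) = (\<integral>\<^sup>+x. liminf (\<lambda>k. u k x) \<partial>M)"
    using lim by (intro nn_integral_cong_AE, eventually_elim) (metis lim_imp_Liminf trivial_limit_sequentially)
  also have "\<dots> \<le> liminf (\<lambda>k. \<integral>\<^sup>+x. u k x \<partial>M)"
    by (rule nn_integral_liminf) measurable
  also have "\<dots> \<le> limsup (\<lambda>k. \<integral>\<^sup>+x. u k x \<partial>M)"
    by (rule Liminf_le_Limsup) simp
  also have "\<dots> \<le> B"
    using le by (intro Limsup_bounded) auto
  finally show ?thesis .
qed

lemma norm_integral_le_nn_integral: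
  fixes f :: "'a \<Rightarrow> complex"
  shows "ennreal (norm (\<integral>x. f x \<partial>M)) \<le> (\<integral>\<^sup>+x. ennreal (norm (f x)) \<partial>M)"
  by (cases "integrable M f") (auto simp: integral_norm_bound_ennreal not_integrable_integral_eq)

lemma gauss_kernel_mass:
  fixes x :: "real^'n::finite"
  assumes e: "e > 0"
  shows "(\<integral>\<^sup>+y. ennreal (sqrt (2 * pi) ^ CARD('n) / e ^ CARD('n) * gauss ((1 / e) *\<^sub>R (x - y))) \<partial>lborel)
      = ennreal ((2 * pi) ^ CARD('n))" (is "?A x = _")
    and "(\<integral>\<^sup>+y. ennreal (sqrt (2 * pi) ^ CARD('n) / e ^ CARD('n) * gauss ((1 / e) *\<^sub>R (y - x))) \<partial>lborel)
      = ennreal ((2 * pi) ^ CARD('n))"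
proof -
  define c where "c = sqrt (2 * pi) ^ CARD('n)"
  have c: "c > 0" "c * c = (2 * pi) ^ CARD('n)"
    unfolding c_def power_mult_distrib[symmetric] by auto
  have "?A x = ennreal (\<bar>e\<bar> ^ CARD('n)) *
      (\<integral>\<^sup>+z. ennreal (c / e ^ CARD('n) * gauss ((1 / e) *\<^sub>R (x - (x + e *\<^sub>R z)))) \<partial>lborel)"
    unfolding c_def using e by (subst nn_integral_affine[where c=e and t=x]) auto
  also have "\<dots> = (\<integral>\<^sup>+z. ennreal (c * gauss (z::real^'n)) \<partial>lborel)"
    using e c by (subst nn_integral_cmult[symmetric])
      (auto simp: ennreal_mult'[symmetric] gauss_def intro!: nn_integral_cong)
  also have "\<dots> = ennreal (c * c)"
    using c integrable_gauss[where 'n='n]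
    by (subst nn_integral_eq_integral) (auto simp: integral_gauss c_def)
  finally show *: "?A x = ennreal ((2 * pi) ^ CARD('n))"
    by (simp add: c)
  have "gauss ((1 / e) *\<^sub>R (y - x)) = gauss ((1 / e) *\<^sub>R (x - y))" for y
    by (simp add: gauss_def norm_minus_commute)
  with * show "(\<integral>\<^sup>+y. ennreal (sqrt (2 * pi) ^ CARD('n) / e ^ CARD('n) * gauss ((1 / e) *\<^sub>R (y - x))) \<partial>lborel)
      = ennreal ((2 * pi) ^ CARD('n))" by simp
qed

text \<open>With a Gaussian damping factor the energy of the transform is the quadratic form of \<open>f\<close> with
  respect to a positive kernel of mass \<open>(2\<pi>)\<^sup>n\<close>, and a quadratic form is bounded
  by the mass of its kernel because \<open>|f x| |f y| \<le> (|f x|\<^sup>2 + |f y|\<^sup>2) / 2\<close>.\<close>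

lemma plancherel_gauss:
  fixes f :: "real^'n::finite \<Rightarrow> complex"
  assumes f: "integrable lborel f" and e: "e > 0"
  shows "(\<integral>\<^sup>+\<xi>. ennreal ((norm (fourier f \<xi>))\<^sup>2 * gauss (e *\<^sub>R \<xi>)) \<partial>lborel)
    \<le> ennreal ((2 * pi) ^ CARD('n)) * energy f"
proof -
  define P where "P z = sqrt (2 * pi) ^ CARD('n) / e ^ CARD('n) * gauss ((1 / e) *\<^sub>R z)" for z :: "real^'n"
  define m where "m = (2 * pi) ^ CARD('n)"
  have m: "m \<ge> 0" by (simp add: m_def)
  have P [simp]: "P z \<ge> 0" for z
    using e by (simp add: P_def)
  have [measurable]: "f \<in> borel_measurable borel"
    using borel_measurable_integrable[OF f] by simp
  have [measurable]: "P \<in> borel_measurable borel"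
    unfolding P_def by measurable
  have mass: "(\<integral>\<^sup>+y. ennreal (P (x - y)) \<partial>lborel) = ennreal m" "(\<integral>\<^sup>+y. ennreal (P (y - x)) \<partial>lborel) = ennreal m" for x
    unfolding m_def P_def by (rule gauss_kernel_mass[OF e])+
  have gi: "integrable lborel (\<lambda>\<xi>::real^'n. complex_of_real (gauss (e *\<^sub>R \<xi>)))"
    using gauss_scaled_fourier(2)[OF e, of 0] by simp
  have gF: "integrable lborel (\<lambda>\<xi>. fourier f \<xi> * of_real (gauss (e *\<^sub>R \<xi>)))"
    by (rule integrable_bounded_mult[OF gi]) (auto intro: fourier_bound)
  have cF: "cnj (fourier f \<xi>) = (\<integral>x. cis (x \<bullet> \<xi>) * cnj (f x) \<partial>lborel)" for \<xi>
    unfolding fourier_def by (simp only: Bochner_Integration.integral_cnj[symmetric] complex_cnj_mult cis_cnj minus_minus)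
  have eq': "cnj (fourier f \<xi>) * (fourier f \<xi> * of_real (gauss (e *\<^sub>R \<xi>))) =
      complex_of_real ((norm (fourier f \<xi>))\<^sup>2 * gauss (e *\<^sub>R \<xi>))" for \<xi>
    unfolding of_real_mult complex_norm_square by (simp only: mult_ac)
  have eq: "complex_of_real ((norm (fourier f \<xi>))\<^sup>2 * gauss (e *\<^sub>R \<xi>)) =
      fourier f \<xi> * of_real (gauss (e *\<^sub>R \<xi>)) * cnj (fourier f \<xi>)" for \<xi>
    unfolding eq'[symmetric] by (rule mult.commute)
  have "integrable lborel (\<lambda>\<xi>. cnj (fourier f \<xi>) * (fourier f \<xi> * of_real (gauss (e *\<^sub>R \<xi>))))"
  proof (rule integrable_bounded_mult[OF gF])
    show "(\<lambda>\<xi>. cnj (fourier f \<xi>)) \<in> borel_measurable lborel"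
      by (rule borel_measurable_continuous_on[of cnj]) (auto intro!: continuous_intros)
  qed (auto intro: fourier_bound)
  then have int: "integrable lborel (\<lambda>\<xi>. complex_of_real ((norm (fourier f \<xi>))\<^sup>2 * gauss (e *\<^sub>R \<xi>)))"
    unfolding eq' .
  have "(\<integral>\<^sup>+\<xi>. ennreal ((norm (fourier f \<xi>))\<^sup>2 * gauss (e *\<^sub>R \<xi>)) \<partial>lborel)
      = ennreal (\<integral>\<xi>. (norm (fourier f \<xi>))\<^sup>2 * gauss (e *\<^sub>R \<xi>) \<partial>lborel)"
    using int by (intro nn_integral_eq_integral) (simp_all only: complex_of_real_integrable_eq, auto)
  also have "\<dots> = ennreal (norm (\<integral>\<xi>. complex_of_real ((norm (fourier f \<xi>))\<^sup>2 * gauss (e *\<^sub>R \<xi>)) \<partial>lborel))"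
    unfolding integral_complex_of_real norm_of_real by (subst abs_of_nonneg) auto
  also have "(\<integral>\<xi>. complex_of_real ((norm (fourier f \<xi>))\<^sup>2 * gauss (e *\<^sub>R \<xi>)) \<partial>lborel)
      = (\<integral>\<xi>. (fourier f \<xi> * of_real (gauss (e *\<^sub>R \<xi>))) * (\<integral>x. cis (x \<bullet> \<xi>) * cnj (f x) \<partial>lborel) \<partial>lborel)"
    unfolding eq cF ..
  also have "\<dots> = (\<integral>x. cnj (f x) * (\<integral>\<xi>. cis (x \<bullet> \<xi>) * (fourier f \<xi> * of_real (gauss (e *\<^sub>R \<xi>))) \<partial>lborel) \<partial>lborel)"
    using f by (intro Fubini_bounded_kernel[OF gF]) auto
  also have "\<dots> = (\<integral>x. cnj (f x) * (\<integral>y. f y * of_real (P (x - y)) \<partial>lborel) \<partial>lborel)"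
    unfolding P_def using fourier_gauss_mean[OF f e] by (simp add: mult_ac)
  also have "ennreal (norm \<dots>) \<le> (\<integral>\<^sup>+x. ennreal (norm (cnj (f x) * (\<integral>y. f y * of_real (P (x - y)) \<partial>lborel))) \<partial>lborel)"
    by (rule norm_integral_le_nn_integral)
  also have "\<dots> \<le> (\<integral>\<^sup>+x. (\<integral>\<^sup>+y. ennreal (norm (f x) * norm (f y) * P (x - y)) \<partial>lborel) \<partial>lborel)"
  proof (rule nn_integral_mono)
    fix x
    have "ennreal (norm (cnj (f x) * (\<integral>y. f y * of_real (P (x - y)) \<partial>lborel)))
        \<le> ennreal (norm (f x)) * (\<integral>\<^sup>+y. ennreal (norm (f y * of_real (P (x - y)))) \<partial>lborel)"
      by (simp add: norm_mult ennreal_mult') (intro mult_left_mono norm_integral_le_nn_integral[THEN order_trans], auto simp: norm_mult ennreal_mult')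
    also have "\<dots> = (\<integral>\<^sup>+y. ennreal (norm (f x) * norm (f y) * P (x - y)) \<partial>lborel)"
      by (subst nn_integral_cmult[symmetric]) (auto simp: norm_mult ennreal_mult'[symmetric] mult.assoc)
    finally show "ennreal (norm (cnj (f x) * (\<integral>y. f y * of_real (P (x - y)) \<partial>lborel)))
        \<le> (\<integral>\<^sup>+y. ennreal (norm (f x) * norm (f y) * P (x - y)) \<partial>lborel)" .
  qed
  also have "\<dots> \<le> (\<integral>\<^sup>+x. (\<integral>\<^sup>+y. ennreal ((norm (f x))\<^sup>2 / 2) * ennreal (P (x - y)) + ennreal ((norm (f y))\<^sup>2 / 2) * ennreal (P (x - y)) \<partial>lborel) \<partial>lborel)"
  proof (intro nn_integral_mono)
    fix x y
    have "norm (f x) * norm (f y) \<le> (norm (f x))\<^sup>2 / 2 + (norm (f y))\<^sup>2 / 2"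
      using sum_squares_bound[of "norm (f x)" "norm (f y)"] by simp
    then have "norm (f x) * norm (f y) * P (x - y) \<le> ((norm (f x))\<^sup>2 / 2 + (norm (f y))\<^sup>2 / 2) * P (x - y)"
      by (rule mult_right_mono) simp
    then show "ennreal (norm (f x) * norm (f y) * P (x - y))
        \<le> ennreal ((norm (f x))\<^sup>2 / 2) * ennreal (P (x - y)) + ennreal ((norm (f y))\<^sup>2 / 2) * ennreal (P (x - y))"
      by (simp add: ennreal_mult'[symmetric] ennreal_plus[symmetric] distrib_right ennreal_leI del: ennreal_plus)
  qed
  also have "\<dots> = (\<integral>\<^sup>+x. (\<integral>\<^sup>+y. ennreal ((norm (f x))\<^sup>2 / 2) * ennreal (P (x - y)) \<partial>lborel) \<partial>lborel)
      + (\<integral>\<^sup>+x. (\<integral>\<^sup>+y. ennreal ((norm (f y))\<^sup>2 / 2) * ennreal (P (x - y)) \<partial>lborel) \<partial>lborel)"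
    by (subst nn_integral_add[symmetric]) (auto intro!: nn_integral_cong nn_integral_add)
  also have "(\<integral>\<^sup>+x. (\<integral>\<^sup>+y. ennreal ((norm (f y))\<^sup>2 / 2) * ennreal (P (x - y)) \<partial>lborel) \<partial>lborel)
      = (\<integral>\<^sup>+y. (\<integral>\<^sup>+x. ennreal ((norm (f y))\<^sup>2 / 2) * ennreal (P (x - y)) \<partial>lborel) \<partial>lborel)"
    by (rule lborel_pair.Fubini'[symmetric]) measurable
  also have "(\<integral>\<^sup>+x. (\<integral>\<^sup>+y. ennreal ((norm (f x))\<^sup>2 / 2) * ennreal (P (x - y)) \<partial>lborel) \<partial>lborel)
      = (\<integral>\<^sup>+x. ennreal ((norm (f x))\<^sup>2 / 2) * ennreal m \<partial>lborel)"
    by (intro nn_integral_cong, subst nn_integral_cmult) (auto simp: mass)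
  also have "(\<integral>\<^sup>+y. (\<integral>\<^sup>+x. ennreal ((norm (f y))\<^sup>2 / 2) * ennreal (P (x - y)) \<partial>lborel) \<partial>lborel)
      = (\<integral>\<^sup>+x. ennreal ((norm (f x))\<^sup>2 / 2) * ennreal m \<partial>lborel)"
    by (intro nn_integral_cong, subst nn_integral_cmult) (auto simp: mass)
  also have "(\<integral>\<^sup>+x. ennreal ((norm (f x))\<^sup>2 / 2) * ennreal m \<partial>lborel) + (\<integral>\<^sup>+x. ennreal ((norm (f x))\<^sup>2 / 2) * ennreal m \<partial>lborel)
      = (\<integral>\<^sup>+x. ennreal m * (ennreal (norm (f x)))\<^sup>2 \<partial>lborel)"
    using m by (subst nn_integral_add[symmetric])
       (auto simp: ennreal_power ennreal_mult'[symmetric] ennreal_plus[symmetric] mult.commute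
         simp del: ennreal_plus intro!: nn_integral_cong)
  also have "\<dots> = ennreal m * energy f"
    unfolding energy_def by (rule nn_integral_cmult) auto
  finally show ?thesis by (simp add: m_def)
qed

text \<open>The Gaussian damping is removed by Fatou's lemma.\<close>

theorem plancherel_le:
  fixes f :: "real^'n::finite \<Rightarrow> complex"
  assumes f: "integrable lborel f"
  shows "energy (fourier f) \<le> ennreal ((2 * pi) ^ CARD('n)) * energy f"
  unfolding energy_def[of "fourier f"]
proof (rule nn_integral_limit_le)
  have [measurable]: "f \<in> borel_measurable borel"
    using borel_measurable_integrable[OF f] by simp
  show "(\<lambda>\<xi>. ennreal ((norm (fourier f \<xi>))\<^sup>2 * gauss (eps k *\<^sub>R \<xi>))) \<in> borel_measurable lborel" for k
    by measurable
  show "(\<integral>\<^sup>+\<xi>. ennreal ((norm (fourier f \<xi>))\<^sup>2 * gauss (eps k *\<^sub>R \<xi>)) \<partial>lborel) \<le> ennreal ((2 * pi) ^ CARD('n)) * energy f" for k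
    by (rule plancherel_gauss[OF f eps_pos])
  show "AE \<xi> in lborel. (\<lambda>k. ennreal ((norm (fourier f \<xi>))\<^sup>2 * gauss (eps k *\<^sub>R \<xi>))) \<longlonglongrightarrow> (ennreal (norm (fourier f \<xi>)))\<^sup>2"
  proof (rule AE_I2)
    fix \<xi> :: "real^'n"
    have "(\<lambda>k. ennreal ((norm (fourier f \<xi>))\<^sup>2 * gauss (eps k *\<^sub>R \<xi>))) \<longlonglongrightarrow> ennreal ((norm (fourier f \<xi>))\<^sup>2 * 1)"
      by (intro tendsto_ennrealI tendsto_mult_left gauss_eps_lim)
    then show "(\<lambda>k. ennreal ((norm (fourier f \<xi>))\<^sup>2 * gauss (eps k *\<^sub>R \<xi>))) \<longlonglongrightarrow> (ennreal (norm (fourier f \<xi>)))\<^sup>2"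
      by (simp add: ennreal_power)
  qed
qed

lemma null_of_square_bound:
  fixes a :: "nat \<Rightarrow> 'a::real_normed_vector"
  assumes "\<And>k. (ennreal (norm (a k)))\<^sup>2 \<le> b k" and "b \<longlonglongrightarrow> 0"
  shows "a \<longlonglongrightarrow> 0"
proof (rule LIMSEQ_I)
  fix e :: real assume e: "e > 0"
  have "eventually (\<lambda>k. b k < (ennreal e)\<^sup>2) sequentially"
    using e by (intro order_tendstoD(2)[OF assms(2)]) (simp add: ennreal_power)
  then obtain N where N: "\<And>k. k \<ge> N \<Longrightarrow> b k < (ennreal e)\<^sup>2"
    by (auto simp: eventually_sequentially)
  have "norm (a k) < e" if "k \<ge> N" for k
  proof (rule ccontr)
    assume "\<not> norm (a k) < e"
    then have "(ennreal e)\<^sup>2 \<le> (ennreal (norm (a k)))\<^sup>2"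
      by (intro power_mono ennreal_leI) auto
    with assms(1)[of k] N[OF that] show False by auto
  qed
  then show "\<exists>N. \<forall>k\<ge>N. norm (a k - 0) < e" by auto
qed

lemma
  fixes f g :: "real^'n::finite \<Rightarrow> complex"
  assumes [measurable]: "f \<in> borel_measurable borel" "g \<in> borel_measurable borel"
  shows nn_integral_mult_energy: "(\<integral>\<^sup>+x. ennreal (norm (f x * g x)) \<partial>lborel)\<^sup>2 \<le> energy f * energy g"
    and integral_mult_energy: "(ennreal (norm (\<integral>x. f x * g x \<partial>lborel)))\<^sup>2 \<le> energy f * energy g"
    and integrable_mult_energy: "energy f < \<infinity> \<Longrightarrow> energy g < \<infinity> \<Longrightarrow> integrable lborel (\<lambda>x. f x * g x)"
proof -
  show *: "(\<integral>\<^sup>+x. ennreal (norm (f x * g x)) \<partial>lborel)\<^sup>2 \<le> energy f * energy g"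
    using Cauchy_Schwarz_nn_integral[of "\<lambda>x. ennreal (norm (f x))" lborel "\<lambda>x. ennreal (norm (g x))"]
    by (simp add: energy_def norm_mult ennreal_mult')
  show "(ennreal (norm (\<integral>x. f x * g x \<partial>lborel)))\<^sup>2 \<le> energy f * energy g"
    by (rule order_trans[OF power_mono[OF norm_integral_le_nn_integral] *]) simp
  show "integrable lborel (\<lambda>x. f x * g x)" if "energy f < \<infinity>" "energy g < \<infinity>"
  proof (rule integrableI_bounded)
    have "(\<integral>\<^sup>+x. ennreal (norm (f x * g x)) \<partial>lborel)\<^sup>2 < \<infinity>"
      using * that by (simp add: ennreal_mult_less_top order_le_less_trans)
    then show "(\<integral>\<^sup>+x. ennreal (norm (f x * g x)) \<partial>lborel) < \<infinity>"
      by (simp add: power2_eq_square ennreal_mult_less_top) (auto simp: less_top[symmetric] ennreal_mult_eq_top_iff)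
  qed measurable
qed

lemma energy_mono:
  "(\<And>x. norm (f x) \<le> norm (g x)) \<Longrightarrow> energy f \<le> energy g"
  unfolding energy_def by (intro nn_integral_mono power_mono ennreal_leI) auto

lemma energy_schwartz: "schwartz f \<Longrightarrow> energy f < \<infinity>"
proof -
  assume f: "schwartz f"
  obtain C where C: "C \<ge> 0" "\<And>x. norm (f x) \<le> C" using schwartz_bounded[OF f] by blast
  have [measurable]: "f \<in> borel_measurable borel" by (rule schwartz_measurable[OF f])
  have "energy f \<le> (\<integral>\<^sup>+x. ennreal C * ennreal (norm (f x)) \<partial>lborel)"
    unfolding energy_def power2_eq_square using C by (intro nn_integral_mono mult_right_mono ennreal_leI) auto
  also have "\<dots> = ennreal C * (\<integral>\<^sup>+x. ennreal (norm (f x)) \<partial>lborel)"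
    by (rule nn_integral_cmult) measurable
  also have "\<dots> < \<infinity>"
    using schwartz_integrable[OF f] by (simp add: integrable_iff_bounded ennreal_mult_less_top)
  finally show ?thesis .
qed

lemma energy_gauss: "energy (\<lambda>x::real^'n::finite. complex_of_real (gauss x)) < \<infinity>"
proof -
  have "energy (\<lambda>x::real^'n. complex_of_real (gauss x)) \<le> (\<integral>\<^sup>+(x::real^'n). ennreal (gauss x) \<partial>lborel)"
    unfolding energy_def by (intro nn_integral_mono) (auto simp: ennreal_power power_le_one_iff power2_eq_square mult_left_le intro!: ennreal_leI)
  also have "\<dots> < \<infinity>"
    using integrable_gauss by (subst nn_integral_eq_integral) auto
  finally show ?thesis .
qed

text \<open>The transforms of the truncations of \<open>g\<close> form a Cauchy sequence in \<open>L\<^sup>2\<close>. After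
  multiplication with a Gaussian it is Cauchy in \<open>L\<^sup>1\<close>, so a subsequence converges almost
  everywhere; Fatou's lemma turns the pointwise limit into the limit in \<open>L\<^sup>2\<close>.\<close>

theorem fourier_L2:
  fixes g :: "real^'n::finite \<Rightarrow> complex"
  assumes g [measurable]: "g \<in> borel_measurable borel" and fin: "energy g < \<infinity>"
  obtains h where "h \<in> borel_measurable borel" "energy h \<le> ennreal ((2 * pi) ^ CARD('n)) * energy g"
    "\<And>\<psi>. schwartz \<psi> \<Longrightarrow> (\<integral>x. g x * fourier \<psi> x \<partial>lborel) = (\<integral>x. h x * \<psi> x \<partial>lborel)"
proof -
  define m where "m = ennreal ((2 * pi) ^ CARD('n))"
  \<comment> \<open>Truncations are integrable, and \<open>D k\<close> is the energy of the tail.\<close>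
  define G where "G k x = (if norm x \<le> real k then g x else 0)" for k :: nat and x
  define D where "D k = energy (\<lambda>x. g x - G k x)" for k
  define H where "H k = fourier (G k)" for k
  have m: "m < top" by (simp add: m_def)
  have [measurable]: "G k \<in> borel_measurable borel" for k
    unfolding G_def by measurable
  have Gi: "integrable lborel (G k)" for k
  proof (rule integrableI_bounded)
    have "(\<integral>\<^sup>+x. ennreal (norm (G k x)) \<partial>lborel)
        \<le> (\<integral>\<^sup>+x. indicator (cball 0 (real k)) x + (ennreal (norm (g x)))\<^sup>2 \<partial>lborel)"
    proof (rule nn_integral_mono)
      fix x
      have "norm (g x) \<le> 1 + (norm (g x))\<^sup>2"
        using sum_squares_bound[of 1 "norm (g x)"] by simp (smt (verit) norm_ge_zero)
      then have "ennreal (norm (g x)) \<le> 1 + (ennreal (norm (g x)))\<^sup>2"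
        by (simp add: ennreal_power ennreal_1[symmetric] ennreal_plus[symmetric] ennreal_leI del: ennreal_1 ennreal_plus)
      then show "ennreal (norm (G k x)) \<le> indicator (cball 0 (real k)) x + (ennreal (norm (g x)))\<^sup>2"
        by (simp add: G_def indicator_def)
    qed
    also have "\<dots> = emeasure lborel (cball (0::real^'n) (real k)) + energy g"
      unfolding energy_def
      by (subst nn_integral_add) (auto intro!: borel_measurable_indicator borel_closed)
    also have "\<dots> < \<infinity>"
      using fin emeasure_lborel_cball_finite[of "0::real^'n" "real k"] by simp
    finally show "(\<integral>\<^sup>+x. ennreal (norm (G k x)) \<partial>lborel) < \<infinity>" .
  qed measurable
  have [measurable]: "H k \<in> borel_measurable borel" for k
    unfolding H_def by measurable
  have D0: "D \<longlonglongrightarrow> 0"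
  proof -
    have "(\<lambda>k. \<integral>\<^sup>+x. (ennreal (norm (g x - G k x)))\<^sup>2 \<partial>lborel) \<longlonglongrightarrow> (\<integral>\<^sup>+x. 0 \<partial>(lborel :: (real^'n) measure))"
    proof (rule nn_integral_dominated_convergence)
      show "(\<integral>\<^sup>+x. (ennreal (norm (g x)))\<^sup>2 \<partial>lborel) < \<infinity>"
        using fin by (simp add: energy_def)
      show "AE x in lborel. (ennreal (norm (g x - G k x)))\<^sup>2 \<le> (ennreal (norm (g x)))\<^sup>2" for k
        by (auto simp: G_def)
      show "AE x in lborel. (\<lambda>k. (ennreal (norm (g x - G k x)))\<^sup>2) \<longlonglongrightarrow> 0"
      proof (rule AE_I2, rule tendsto_eventually)
        fix x :: "real^'n"
        obtain N :: nat where "norm x \<le> real N" using real_arch_simple by blast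
        then show "eventually (\<lambda>k. (ennreal (norm (g x - G k x)))\<^sup>2 = 0) sequentially"
          by (intro eventually_sequentiallyI[of N]) (auto simp: G_def)
      qed
    qed measurable
    then show ?thesis by (simp add: D_def[abs_def] energy_def)
  qed
  have diff: "energy (\<lambda>x. H i x - H j x) \<le> m * D N" if "N \<le> i" "N \<le> j" for i j N
  proof -
    have "H i \<xi> - H j \<xi> = fourier (\<lambda>x. G i x - G j x) \<xi>" for \<xi>
      unfolding H_def fourier_def right_diff_distrib
      by (rule Bochner_Integration.integral_diff[symmetric]) (intro fourier_integrable Gi)+
    then have "energy (\<lambda>x. H i x - H j x) \<le> m * energy (\<lambda>x. G i x - G j x)"
      using plancherel_le[of "\<lambda>x. G i x - G j x"] Gi by (simp add: m_def)
    also have "energy (\<lambda>x. G i x - G j x) \<le> D N"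
      unfolding D_def using that by (intro energy_mono) (auto simp: G_def)
    finally show ?thesis by (simp add: mult_left_mono)
  qed
  \<comment> \<open>The finite energy of the Gaussian turns convergence in \<open>L\<^sup>2\<close> into weighted convergence in \<open>L\<^sup>1\<close>.\<close>
  define \<Gamma> where "\<Gamma> = energy (\<lambda>x::real^'n. complex_of_real (gauss x))"
  have \<Gamma>: "\<Gamma> < top" using energy_gauss by (simp add: \<Gamma>_def)
  define s where "s k x = H k x * complex_of_real (gauss x)" for k x
  have si: "integrable lborel (s k)" for k
    unfolding s_def H_def
    by (intro integrable_bounded_mult[of _ _ _ "\<integral>x. norm (G k x) \<partial>lborel"] fourier_bound integrable_of_real integrable_gauss) measurable
  have cauchy: "\<exists>N. \<forall>i\<ge>N. \<forall>j\<ge>N. (\<integral>x. norm (s i x - s j x) \<partial>lborel) < e" if e: "e > 0" for e :: real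
  proof -
    have "(\<lambda>N. (m * \<Gamma>) * D N) \<longlonglongrightarrow> (m * \<Gamma>) * 0"
      using m \<Gamma> by (intro ennreal_tendsto_cmult D0) (simp add: ennreal_mult_less_top)
    then have "eventually (\<lambda>N. (m * \<Gamma>) * D N < (ennreal e)\<^sup>2) sequentially"
      using e by (intro order_tendstoD(2)) (auto simp: ennreal_power)
    then obtain N where N: "(m * \<Gamma>) * D N < (ennreal e)\<^sup>2"
      by (auto simp: eventually_sequentially)
    have "(\<integral>x. norm (s i x - s j x) \<partial>lborel) < e" if "N \<le> i" "N \<le> j" for i j
    proof (rule ccontr)
      assume "\<not> (\<integral>x. norm (s i x - s j x) \<partial>lborel) < e"
      then have "(ennreal e)\<^sup>2 \<le> (ennreal (\<integral>x. norm (s i x - s j x) \<partial>lborel))\<^sup>2"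
        by (intro power_mono ennreal_leI) auto
      also have "ennreal (\<integral>x. norm (s i x - s j x) \<partial>lborel) = (\<integral>\<^sup>+x. ennreal (norm ((H i x - H j x) * of_real (gauss x))) \<partial>lborel)"
      proof -
        have "(H i x - H j x) * of_real (gauss x) = s i x - s j x" for x
          by (simp add: s_def left_diff_distrib)
        moreover have "integrable lborel (\<lambda>x. norm (s i x - s j x))"
          by (intro integrable_norm Bochner_Integration.integrable_diff si)
        ultimately show ?thesis
          by (simp add: nn_integral_eq_integral)
      qed
      also have "\<dots>\<^sup>2 \<le> energy (\<lambda>x. H i x - H j x) * \<Gamma>"
        unfolding \<Gamma>_def by (rule nn_integral_mult_energy) measurable
      also have "\<dots> \<le> (m * D N) * \<Gamma>"
        using diff[OF that] by (rule mult_right_mono) simp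
      finally show False using N by (simp add: mult_ac)
    qed
    then show ?thesis by blast
  qed
  obtain r where r: "strict_mono r" and AE: "AE x in lborel. Cauchy (\<lambda>i. s (r i) x)"
    using cauchy_L1_AE_cauchy_subseq[OF si cauchy] by blast
  define h where "h x = lim (\<lambda>i. H (r i) x)" for x
  have h_meas [measurable]: "h \<in> borel_measurable borel"
    unfolding h_def by measurable
  have lim: "AE x in lborel. (\<lambda>i. H (r i) x) \<longlonglongrightarrow> h x"
    using AE
  proof eventually_elim
    fix x assume "Cauchy (\<lambda>i. s (r i) x)"
    then obtain L where "(\<lambda>i. s (r i) x) \<longlonglongrightarrow> L"
      using Cauchy_convergent convergent_def by blast
    then have "(\<lambda>i. s (r i) x / of_real (gauss x)) \<longlonglongrightarrow> L / of_real (gauss x)"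
      using gauss_pos[of x] by (intro tendsto_divide tendsto_const) auto
    then have "convergent (\<lambda>i. H (r i) x)"
      using gauss_pos[of x] by (auto simp: s_def convergent_def)
    then show "(\<lambda>i. H (r i) x) \<longlonglongrightarrow> h x"
      unfolding h_def convergent_LIMSEQ_iff .
  qed
  have h_diff: "energy (\<lambda>x. h x - H k x) \<le> m * D k" for k
    unfolding energy_def[of "\<lambda>x. h x - H k x"]
  proof (rule nn_integral_limit_le)
    show "AE x in lborel. (\<lambda>i. (ennreal (norm (H (r (i + k)) x - H k x)))\<^sup>2) \<longlonglongrightarrow> (ennreal (norm (h x - H k x)))\<^sup>2"
      using lim
    proof eventually_elim
      fix x assume "(\<lambda>i. H (r i) x) \<longlonglongrightarrow> h x"
      then have "(\<lambda>i. H (r (i + k)) x) \<longlonglongrightarrow> h x"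
        by (rule LIMSEQ_ignore_initial_segment)
      then have "(\<lambda>i. ennreal ((norm (H (r (i + k)) x - H k x))\<^sup>2)) \<longlonglongrightarrow> ennreal ((norm (h x - H k x))\<^sup>2)"
        by (intro tendsto_intros)
      then show "(\<lambda>i. (ennreal (norm (H (r (i + k)) x - H k x)))\<^sup>2) \<longlonglongrightarrow> (ennreal (norm (h x - H k x)))\<^sup>2"
        by (simp add: ennreal_power)
    qed
    show "(\<integral>\<^sup>+x. (ennreal (norm (H (r (i + k)) x - H k x)))\<^sup>2 \<partial>lborel) \<le> m * D k" for i
      using diff[of k "r (i + k)" k] seq_suble[OF r, of "i + k"] by (simp add: energy_def)
  qed measurable
  have h_energy: "energy h \<le> m * energy g"
    unfolding energy_def[of h]
  proof (rule nn_integral_limit_le)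
    show "AE x in lborel. (\<lambda>i. (ennreal (norm (H (r i) x)))\<^sup>2) \<longlonglongrightarrow> (ennreal (norm (h x)))\<^sup>2"
      using lim
    proof eventually_elim
      fix x assume "(\<lambda>i. H (r i) x) \<longlonglongrightarrow> h x"
      then have "(\<lambda>i. ennreal ((norm (H (r i) x))\<^sup>2)) \<longlonglongrightarrow> ennreal ((norm (h x))\<^sup>2)"
        by (intro tendsto_intros)
      then show "(\<lambda>i. (ennreal (norm (H (r i) x)))\<^sup>2) \<longlonglongrightarrow> (ennreal (norm (h x)))\<^sup>2"
        by (simp add: ennreal_power)
    qed
    show "(\<integral>\<^sup>+x. (ennreal (norm (H (r i) x)))\<^sup>2 \<partial>lborel) \<le> m * energy g" for i
    proof -
      have "energy (H (r i)) \<le> m * energy (G (r i))"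
        unfolding H_def m_def by (rule plancherel_le[OF Gi])
      also have "\<dots> \<le> m * energy g"
        by (intro mult_left_mono energy_mono) (auto simp: G_def)
      finally show ?thesis by (simp add: energy_def)
    qed
  qed measurable
  have "(\<integral>x. g x * fourier \<psi> x \<partial>lborel) = (\<integral>x. h x * \<psi> x \<partial>lborel)" if \<psi>: "schwartz \<psi>" for \<psi>
  proof -
    note [measurable] = schwartz_measurable[OF \<psi>]
    have E\<psi>: "energy \<psi> < top" "energy (fourier \<psi>) < top"
      using energy_schwartz schwartz_fourier \<psi> by auto
    have Eh: "energy h < top"
      using h_energy m fin by (auto simp: ennreal_mult_less_top intro: order_le_less_trans)
    have hi: "integrable lborel (\<lambda>x. h x * \<psi> x)"
      using Eh E\<psi> by (intro integrable_mult_energy) auto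
    have Hi: "integrable lborel (\<lambda>x. H k x * \<psi> x)" for k
      unfolding H_def using fourier_bound[of "G k"]
      by (intro integrable_bounded_mult[OF schwartz_integrable[OF \<psi>]]) auto
    have "(\<lambda>k. (\<integral>x. h x * \<psi> x \<partial>lborel) - (\<integral>x. H k x * \<psi> x \<partial>lborel)) \<longlonglongrightarrow> 0"
    proof (rule null_of_square_bound)
      have "(\<lambda>k. (m * energy \<psi>) * D k) \<longlonglongrightarrow> (m * energy \<psi>) * 0"
        using m E\<psi> by (intro ennreal_tendsto_cmult D0) (simp add: ennreal_mult_less_top)
      then show "(\<lambda>k. (m * energy \<psi>) * D k) \<longlonglongrightarrow> 0" by simp
      fix k
      have "(\<integral>x. h x * \<psi> x \<partial>lborel) - (\<integral>x. H k x * \<psi> x \<partial>lborel) = (\<integral>x. (h x - H k x) * \<psi> x \<partial>lborel)"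
        unfolding left_diff_distrib using hi Hi by simp
      also have "(ennreal (norm \<dots>))\<^sup>2 \<le> energy (\<lambda>x. h x - H k x) * energy \<psi>"
        by (rule integral_mult_energy) measurable
      also have "\<dots> \<le> (m * D k) * energy \<psi>"
        using h_diff by (rule mult_right_mono) simp
      finally show "(ennreal (norm ((\<integral>x. h x * \<psi> x \<partial>lborel) - (\<integral>x. H k x * \<psi> x \<partial>lborel))))\<^sup>2 \<le> (m * energy \<psi>) * D k"
        by (simp add: mult_ac)
    qed
    then have "(\<lambda>k. (\<integral>x. h x * \<psi> x \<partial>lborel) - ((\<integral>x. h x * \<psi> x \<partial>lborel) - (\<integral>x. H k x * \<psi> x \<partial>lborel))) \<longlonglongrightarrow> (\<integral>x. h x * \<psi> x \<partial>lborel) - 0"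
      by (intro tendsto_diff tendsto_const)
    then have "(\<lambda>k. \<integral>x. H k x * \<psi> x \<partial>lborel) \<longlonglongrightarrow> (\<integral>x. h x * \<psi> x \<partial>lborel)"
      by simp
    moreover have "(\<lambda>k. \<integral>x. G k x * fourier \<psi> x \<partial>lborel) \<longlonglongrightarrow> (\<integral>x. g x * fourier \<psi> x \<partial>lborel)"
    proof (rule integral_dominated_convergence)
      show "integrable lborel (\<lambda>x. norm (g x * fourier \<psi> x))"
        using fin E\<psi> by (intro integrable_norm integrable_mult_energy) auto
      show "AE x in lborel. norm (G k x * fourier \<psi> x) \<le> norm (g x * fourier \<psi> x)" for k
        by (auto simp: G_def)
      show "AE x in lborel. (\<lambda>k. G k x * fourier \<psi> x) \<longlonglongrightarrow> g x * fourier \<psi> x"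
      proof (rule AE_I2, rule tendsto_eventually)
        fix x :: "real^'n"
        obtain N :: nat where "norm x \<le> real N" using real_arch_simple by blast
        then show "eventually (\<lambda>k. G k x * fourier \<psi> x = g x * fourier \<psi> x) sequentially"
          by (intro eventually_sequentiallyI[of N]) (auto simp: G_def)
      qed
    qed measurable
    moreover have "(\<integral>x. G k x * fourier \<psi> x \<partial>lborel) = (\<integral>x. H k x * \<psi> x \<partial>lborel)" for k
      unfolding H_def by (rule fourier_multiplication_formula[OF Gi schwartz_integrable[OF \<psi>]])
    ultimately show ?thesis
      using LIMSEQ_unique by simp
  qed
  with h_meas h_energy show ?thesis
    unfolding m_def by (rule that)
qed

section \<open>Convolutions and multipliers\<close>

lemma split_at_level:
  assumes "t \<ge> 0" "\<delta> > 0" "p \<ge> (1::real)"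
  shows "t \<le> \<delta> + \<delta> powr (1 - p) * t powr p"
proof (cases "t \<le> \<delta>")
  case False
  then have "t = t powr (1 - p) * t powr p"
    using assms by (simp add: powr_add[symmetric])
  also have "\<dots> \<le> \<delta> powr (1 - p) * t powr p"
    using False assms by (intro mult_right_mono powr_mono2') auto
  finally show ?thesis using assms by simp
qed (use assms in \<open>simp add: add_increasing2\<close>)

text \<open>Splitting \<open>g\<close> at every level \<open>\<delta>\<close> and choosing \<open>\<delta>\<close> pointwise bounds \<open>|G|\<^sup>p\<close> by a multiple of
  the convolution \<open>J\<close> of \<open>|g|\<^sup>p\<close> with \<open>|K|\<close>. The function \<open>J\<close> is bounded through the bound of \<open>K\<close> and
  integrable through its mass; since \<open>p \<le> 2\<close>, both together control the integral of \<open>|G|\<^sup>2\<close>.\<close>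

lemma
  fixes g K :: "real^'n::finite \<Rightarrow> complex"
  assumes g [measurable]: "g \<in> borel_measurable borel" and K [measurable]: "K \<in> borel_measurable borel"
    and p: "1 \<le> p" "p \<le> 2"
    and I: "(\<integral>\<^sup>+x. ennreal (norm (g x) powr p) \<partial>lborel) \<le> ennreal I" "I \<ge> 0"
    and A: "\<And>x. norm (K x) \<le> A" "A > 0"
    and B: "(\<integral>\<^sup>+x. ennreal (norm (K x)) \<partial>lborel) \<le> ennreal B" "B > 0"
  defines "G \<equiv> \<lambda>y. \<integral>x. g x * K (x - y) \<partial>lborel"
  shows energy_convolution: "energy G \<le> ennreal (4 * B powr (3 - 2 / p) * A powr (2 / p - 1) * I powr (2 / p))"
    and convolution_measurable: "G \<in> borel_measurable borel"
    and Fubini_convolution: "integrable lborel \<psi> \<Longrightarrow>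
       integrable lborel (\<lambda>y. G y * \<psi> y) \<and>
       (\<integral>y. G y * \<psi> y \<partial>lborel) = (\<integral>x. g x * (\<integral>y. K (x - y) * \<psi> y \<partial>lborel) \<partial>lborel)"
proof -
  define J where "J y = (\<integral>\<^sup>+x. ennreal (norm (g x) powr p) * ennreal (norm (K (x - y))) \<partial>lborel)" for y
  define a where "a y = (\<integral>\<^sup>+x. ennreal (norm (g x * K (x - y))) \<partial>lborel)" for y
  have J_le: "J y \<le> ennreal (A * I)" for y
  proof -
    have "J y \<le> (\<integral>\<^sup>+x. ennreal (norm (g x) powr p) * ennreal A \<partial>lborel)"
      unfolding J_def by (intro nn_integral_mono mult_left_mono ennreal_leI A) auto
    also have "\<dots> = (\<integral>\<^sup>+x. ennreal (norm (g x) powr p) \<partial>lborel) * ennreal A"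
      by (rule nn_integral_multc) measurable
    also have "\<dots> \<le> ennreal I * ennreal A"
      by (intro mult_right_mono I) simp
    finally show ?thesis using A I by (simp add: ennreal_mult'[symmetric] mult.commute)
  qed
  have J_eq: "J y = ennreal (enn2real (J y))" and j_le: "enn2real (J y) \<le> A * I" for y
  proof -
    show "J y = ennreal (enn2real (J y))"
      using J_le[of y] by (metis ennreal_enn2real ennreal_less_top order_le_less_trans)
    show "enn2real (J y) \<le> A * I"
      using J_le[of y] A I by (intro enn2real_leI) auto
  qed
  have K_shift: "(\<integral>\<^sup>+x. ennreal (norm (K (x - y))) \<partial>lborel) = (\<integral>\<^sup>+x. ennreal (norm (K x)) \<partial>lborel)"
    and K_shift': "(\<integral>\<^sup>+y. ennreal (norm (K (x - y))) \<partial>lborel) = (\<integral>\<^sup>+x. ennreal (norm (K x)) \<partial>lborel)" for x y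
    using nn_integral_affine[of "\<lambda>x. ennreal (norm (K x))" 1 "- y"]
      nn_integral_affine[of "\<lambda>x. ennreal (norm (K x))" "-1" x]
    by simp_all
  have a_le: "a y \<le> ennreal (\<delta> * B + \<delta> powr (1 - p) * enn2real (J y))" if \<delta>: "\<delta> > 0" for y \<delta>
  proof -
    have "a y \<le> (\<integral>\<^sup>+x. ennreal \<delta> * ennreal (norm (K (x - y))) + ennreal (\<delta> powr (1 - p)) * (ennreal (norm (g x) powr p) * ennreal (norm (K (x - y)))) \<partial>lborel)"
      unfolding a_def
    proof (rule nn_integral_mono)
      fix x
      have "norm (g x) * norm (K (x - y)) \<le> (\<delta> + \<delta> powr (1 - p) * norm (g x) powr p) * norm (K (x - y))"
        using split_at_level[of "norm (g x)" \<delta> p] \<delta> p by (intro mult_right_mono) auto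
      then show "ennreal (norm (g x * K (x - y))) \<le> ennreal \<delta> * ennreal (norm (K (x - y))) + ennreal (\<delta> powr (1 - p)) * (ennreal (norm (g x) powr p) * ennreal (norm (K (x - y))))"
        using \<delta> by (simp add: norm_mult ennreal_mult'[symmetric] ennreal_plus[symmetric] distrib_right mult.assoc ennreal_leI del: ennreal_plus)
    qed
    also have "\<dots> = ennreal \<delta> * (\<integral>\<^sup>+x. ennreal (norm (K x)) \<partial>lborel) + ennreal (\<delta> powr (1 - p)) * J y"
      unfolding J_def by (simp add: nn_integral_add nn_integral_cmult K_shift)
    also have "\<dots> \<le> ennreal \<delta> * ennreal B + ennreal (\<delta> powr (1 - p)) * J y"
      by (intro add_right_mono mult_left_mono B) simp
    also have "J y = ennreal (enn2real (J y))"
      by (rule J_eq)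
    finally show ?thesis
      using \<delta> B by (simp add: ennreal_mult'[symmetric] ennreal_plus[symmetric] del: ennreal_plus)
  qed
  have a_bounded: "a y \<le> ennreal (B + A * I)" for y
    using order_trans[OF a_le[of 1 y] ennreal_leI] j_le[of y] by simp
  have a_opt: "a y \<le> ennreal (2 * B powr (1 - 1 / p) * enn2real (J y) powr (1 / p))" for y
  proof (cases "enn2real (J y) = 0")
    case True
    have "a y \<le> 0"
    proof (rule ennreal_le_epsilon)
      fix e :: real assume "e > 0"
      then show "a y \<le> 0 + ennreal e"
        using a_le[of "e / B" y] True B by simp
    qed
    then show ?thesis by simp
  next
    case False
    define j where "j = enn2real (J y)"
    have j: "j > 0" using False by (simp add: j_def less_le)
    \<comment> \<open>The level at which the two terms of the split are equal.\<close>
    define \<delta> where "\<delta> = (j / B) powr (1 / p)"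
    have "\<delta> * B = B powr (1 - 1 / p) * j powr (1 / p)"
      using j B by (simp add: \<delta>_def powr_divide powr_diff)
    moreover have "\<delta> powr (1 - p) * j = B powr (1 - 1 / p) * j powr (1 / p)"
    proof -
      have "\<delta> powr (1 - p) = (j / B) powr (1 / p - 1)"
        using p by (simp add: \<delta>_def powr_powr field_simps)
      then show ?thesis
        using j B by (simp add: powr_divide powr_diff)
    qed
    moreover have "\<delta> > 0" using j B by (simp add: \<delta>_def)
    ultimately show ?thesis
      using a_le[of \<delta> y] by (simp add: j_def[symmetric] mult_ac)
  qed
  have G_le: "ennreal (norm (G y)) \<le> a y" for y
    unfolding G_def a_def by (rule norm_integral_le_nn_integral)
  show Gm: "G \<in> borel_measurable borel"
    unfolding G_def by measurable
  define c where "c = 4 * B powr (2 - 2 / p) * (A * I) powr (2 / p - 1)"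
  have pointwise: "(ennreal (norm (G y)))\<^sup>2 \<le> ennreal c * J y" for y
  proof -
    define j where "j = enn2real (J y)"
    have j: "0 \<le> j" "j \<le> A * I" using j_le by (auto simp: j_def)
    have "norm (G y) \<le> 2 * B powr (1 - 1 / p) * j powr (1 / p)"
      using order_trans[OF G_le a_opt, of y] by (simp add: j_def)
    then have "(norm (G y))\<^sup>2 \<le> (2 * B powr (1 - 1 / p) * j powr (1 / p))\<^sup>2"
      by (intro power_mono) auto
    also have "\<dots> = 4 * B powr (2 - 2 / p) * j powr (2 / p)"
    proof -
      have "(x powr u)\<^sup>2 = x powr (2 * u)" for x u :: real
        by (simp add: power2_eq_square powr_add[symmetric])
      then show ?thesis
        unfolding power_mult_distrib by (simp add: right_diff_distrib)
    qed
    \<comment> \<open>Keep one factor \<open>j\<close> for the integration over \<open>y\<close> and bound the others uniformly. The case \<open>j = 0\<close>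
      is separate because \<open>0 powr 0 = 0\<close>.\<close>
    also have "j powr (2 / p) \<le> (A * I) powr (2 / p - 1) * j"
    proof (cases "j = 0")
      case False
      then have "j powr (2 / p) = j powr (2 / p - 1) * j"
        using j by (simp add: powr_diff)
      also have "\<dots> \<le> (A * I) powr (2 / p - 1) * j"
        using j p by (intro mult_right_mono powr_mono2) (auto simp: field_simps)
      finally show ?thesis .
    qed simp
    then have "4 * B powr (2 - 2 / p) * j powr (2 / p) \<le> c * j"
      unfolding c_def mult.assoc using B by (intro mult_left_mono) auto
    finally have "(norm (G y))\<^sup>2 \<le> c * j" .
    then have "ennreal ((norm (G y))\<^sup>2) \<le> ennreal (c * j)"
      by (rule ennreal_leI)
    also have "ennreal (c * j) = ennreal c * ennreal j"
      by (rule ennreal_mult') (simp add: c_def)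
    finally show ?thesis
      using J_eq[of y] by (simp add: ennreal_power j_def)
  qed
  have "energy G \<le> (\<integral>\<^sup>+y. ennreal c * J y \<partial>lborel)"
    unfolding energy_def by (intro nn_integral_mono pointwise)
  also have "\<dots> = ennreal c * (\<integral>\<^sup>+y. J y \<partial>lborel)"
    unfolding J_def by (rule nn_integral_cmult) measurable
  also have "(\<integral>\<^sup>+y. J y \<partial>lborel) = (\<integral>\<^sup>+x. (\<integral>\<^sup>+y. ennreal (norm (g x) powr p) * ennreal (norm (K (x - y))) \<partial>lborel) \<partial>lborel)"
    unfolding J_def by (rule lborel_pair.Fubini') measurable
  also have "\<dots> = (\<integral>\<^sup>+x. ennreal (norm (g x) powr p) \<partial>lborel) * (\<integral>\<^sup>+x. ennreal (norm (K x)) \<partial>lborel)"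
    by (simp add: nn_integral_cmult nn_integral_multc K_shift')
  also have "ennreal c * \<dots> \<le> ennreal c * (ennreal I * ennreal B)"
    by (intro mult_left_mono mult_mono I B) auto
  also have "\<dots> = ennreal (c * (I * B))"
    using I B by (simp add: ennreal_mult'[symmetric] ennreal_mult''[symmetric])
  also have "c * (I * B) = 4 * B powr (3 - 2 / p) * A powr (2 / p - 1) * I powr (2 / p)"
  proof (cases "I = 0")
    case False
    have "B powr (3 - 2 / p) = B powr (2 - 2 / p) * B"
      using B powr_add[of B "2 - 2 / p" 1] by simp
    moreover have "I powr (2 / p) = I powr (2 / p - 1) * I"
      using False I by (simp add: powr_diff)
    moreover have "(A * I) powr (2 / p - 1) = A powr (2 / p - 1) * I powr (2 / p - 1)"
      using A I by (simp add: powr_mult)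
    ultimately show ?thesis by (simp add: c_def)
  qed simp
  finally show "energy G \<le> ennreal (4 * B powr (3 - 2 / p) * A powr (2 / p - 1) * I powr (2 / p))" .
  show "integrable lborel (\<lambda>y. G y * \<psi> y) \<and>
     (\<integral>y. G y * \<psi> y \<partial>lborel) = (\<integral>x. g x * (\<integral>y. K (x - y) * \<psi> y \<partial>lborel) \<partial>lborel)"
    if \<psi>: "integrable lborel \<psi>"
  proof -
    have [measurable]: "\<psi> \<in> borel_measurable borel"
      using borel_measurable_integrable[OF \<psi>] by simp
    have int: "integrable (lborel \<Otimes>\<^sub>M lborel) (\<lambda>(y, x). g x * K (x - y) * \<psi> y)"
    proof (rule integrableI_bounded)
      show "(\<lambda>(y, x). g x * K (x - y) * \<psi> y) \<in> borel_measurable (lborel \<Otimes>\<^sub>M lborel)"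
        by measurable
      have "(\<integral>\<^sup>+z. ennreal (norm (case z of (y, x) \<Rightarrow> g x * K (x - y) * \<psi> y)) \<partial>(lborel \<Otimes>\<^sub>M lborel))
          = (\<integral>\<^sup>+y. (\<integral>\<^sup>+x. ennreal (norm (g x * K (x - y))) * ennreal (norm (\<psi> y)) \<partial>lborel) \<partial>lborel)"
        by (subst lborel.nn_integral_fst[symmetric]) (auto simp: norm_mult ennreal_mult')
      also have "\<dots> = (\<integral>\<^sup>+y. a y * ennreal (norm (\<psi> y)) \<partial>lborel)"
        unfolding a_def by (intro nn_integral_cong nn_integral_multc) measurable
      also have "\<dots> \<le> (\<integral>\<^sup>+y. ennreal (B + A * I) * ennreal (norm (\<psi> y)) \<partial>lborel)"
        by (intro nn_integral_mono mult_right_mono a_bounded) simp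
      also have "\<dots> = ennreal (B + A * I) * (\<integral>\<^sup>+y. ennreal (norm (\<psi> y)) \<partial>lborel)"
        by (rule nn_integral_cmult) measurable
      also have "\<dots> < \<infinity>"
        using \<psi> by (simp add: integrable_iff_bounded ennreal_mult_less_top)
      finally show "(\<integral>\<^sup>+z. ennreal (norm (case z of (y, x) \<Rightarrow> g x * K (x - y) * \<psi> y)) \<partial>(lborel \<Otimes>\<^sub>M lborel)) < \<infinity>" .
    qed
    have "integrable lborel (\<lambda>y. \<integral>x. g x * K (x - y) * \<psi> y \<partial>lborel)"
      by (rule lborel_pair.integrable_fst[OF int])
    moreover have "(\<integral>x. (\<integral>y. g x * K (x - y) * \<psi> y \<partial>lborel) \<partial>lborel) = (\<integral>y. (\<integral>x. g x * K (x - y) * \<psi> y \<partial>lborel) \<partial>lborel)"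
      by (rule lborel_pair.Fubini_integral[OF int])
    moreover have "G y * \<psi> y = (\<integral>x. g x * K (x - y) * \<psi> y \<partial>lborel)" for y
      by (simp add: G_def)
    moreover have "g x * (\<integral>y. K (x - y) * \<psi> y \<partial>lborel) = (\<integral>y. g x * K (x - y) * \<psi> y \<partial>lborel)" for x
      by (simp add: mult.assoc)
    ultimately show ?thesis
      by presburger
  qed
qed

text \<open>Multiplication by a symbol on the frequency side is convolution with its transform, up to the
  factor \<open>(2\<pi>)\<^sup>-\<^sup>n\<close> from the inverse transform.\<close>

lemma fourier_multiplier_convolution:
  fixes \<mu> \<psi> :: "real^'n::finite \<Rightarrow> complex"
  assumes \<mu>: "integrable lborel \<mu>" and \<psi>: "integrable lborel \<psi>"
  shows "fourier (\<lambda>\<xi>. \<mu> \<xi> * inv_fourier \<psi> \<xi>) x =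
    (\<integral>y. of_real (1 / (2 * pi) ^ CARD('n)) * fourier \<mu> (x - y) * \<psi> y \<partial>lborel)"
proof -
  let ?c = "complex_of_real (1 / (2 * pi) ^ CARD('n))"
  have m: "integrable lborel (\<lambda>\<xi>. cis (- (\<xi> \<bullet> x)) * \<mu> \<xi>)"
    by (rule fourier_integrable[OF \<mu>])
  have "fourier (\<lambda>\<xi>. \<mu> \<xi> * inv_fourier \<psi> \<xi>) x
      = ?c * (\<integral>\<xi>. (cis (- (\<xi> \<bullet> x)) * \<mu> \<xi>) * (\<integral>y. cis (\<xi> \<bullet> y) * \<psi> y \<partial>lborel) \<partial>lborel)"
    unfolding fourier_def inv_fourier_def
    by (subst integral_mult_right_zero[symmetric]) (simp add: mult_ac)
  also have "(\<integral>\<xi>. (cis (- (\<xi> \<bullet> x)) * \<mu> \<xi>) * (\<integral>y. cis (\<xi> \<bullet> y) * \<psi> y \<partial>lborel) \<partial>lborel)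
      = (\<integral>y. \<psi> y * (\<integral>\<xi>. cis (\<xi> \<bullet> y) * (cis (- (\<xi> \<bullet> x)) * \<mu> \<xi>) \<partial>lborel) \<partial>lborel)"
    by (rule Fubini_bounded_kernel[OF m \<psi>]) auto
  also have "\<dots> = (\<integral>y. \<psi> y * fourier \<mu> (x - y) \<partial>lborel)"
    unfolding fourier_def by (simp add: mult.assoc[symmetric] cis_mult inner_diff_right)
  finally show ?thesis
    by (subst (asm) integral_mult_right_zero[symmetric]) (simp add: mult_ac)
qed

lemma fourier_scale:
  fixes f :: "real^'n::finite \<Rightarrow> complex"
  assumes f: "integrable lborel f" and a: "a > 0"
  shows "fourier (\<lambda>x. f (a *\<^sub>R x)) \<xi> = of_real (1 / a ^ CARD('n)) * fourier f ((1 / a) *\<^sub>R \<xi>)"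
proof -
  have "fourier f ((1 / a) *\<^sub>R \<xi>) = a ^ CARD('n) *\<^sub>R fourier (\<lambda>x. f (a *\<^sub>R x)) \<xi>"
    using lborel_integral_affine[OF fourier_integrable[OF f, of "(1 / a) *\<^sub>R \<xi>"], of a 0] a
    unfolding fourier_def by simp
  then show ?thesis using a by (simp add: scaleR_conv_of_real)
qed

section \<open>Estimates for dyadic blocks\<close>

text \<open>The sum of three neighbouring pieces of the partition of unity. It is again a smooth cutoff to
  an annulus, and it equals one on the support of \<open>\<phi>\<close>.\<close>

definition thick_cutoff :: "(real^'n::finite \<Rightarrow> real) \<Rightarrow> real^'n \<Rightarrow> real" where
  "thick_cutoff \<phi> \<xi> = \<phi> (2 *\<^sub>R \<xi>) + \<phi> \<xi> + \<phi> ((1 / 2) *\<^sub>R \<xi>)"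

lemma thick_cutoff_range:
  assumes "dyadic_partition \<phi>"
  shows "0 \<le> thick_cutoff \<phi> \<xi>" "thick_cutoff \<phi> \<xi> \<le> 3"
proof -
  have "0 \<le> \<phi> x" "\<phi> x \<le> 1" for x
    using assms unfolding dyadic_partition_def by (metis atLeastAtMost_iff range_subsetD)+
  note this[of "2 *\<^sub>R \<xi>"] this[of \<xi>] this[of "(1 / 2) *\<^sub>R \<xi>"]
  then show "0 \<le> thick_cutoff \<phi> \<xi>" "thick_cutoff \<phi> \<xi> \<le> 3"
    unfolding thick_cutoff_def by linarith+
qed

lemma thick_cutoff_support:
  assumes "dyadic_partition \<phi>" and "thick_cutoff \<phi> \<xi> \<noteq> 0"
  shows "3 / 8 \<le> norm \<xi>" "norm \<xi> \<le> 16 / 3"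
proof -
  have supp: "\<phi> x \<noteq> 0 \<Longrightarrow> 3 / 4 \<le> norm x \<and> norm x \<le> 8 / 3" for x
    using assms(1) unfolding dyadic_partition_def by blast
  have "\<phi> (2 *\<^sub>R \<xi>) \<noteq> 0 \<or> \<phi> \<xi> \<noteq> 0 \<or> \<phi> ((1 / 2) *\<^sub>R \<xi>) \<noteq> 0"
    using assms(2) unfolding thick_cutoff_def by auto
  then show "3 / 8 \<le> norm \<xi>" "norm \<xi> \<le> 16 / 3"
    using supp[of "2 *\<^sub>R \<xi>"] supp[of \<xi>] supp[of "(1 / 2) *\<^sub>R \<xi>"] by auto
qed

text \<open>On the support of \<open>\<phi>\<close> only the three terms \<open>q = -1, 0, 1\<close> of the partition of unity survive.\<close>

lemma thick_cutoff_reproduces: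
  fixes \<phi> :: "real^'n::finite \<Rightarrow> real"
  assumes "dyadic_partition \<phi>"
  shows "\<phi> \<xi> * thick_cutoff \<phi> \<xi> = \<phi> \<xi>"
proof (cases "\<phi> \<xi> = 0")
  case False
  have supp: "\<phi> x \<noteq> 0 \<Longrightarrow> 3 / 4 \<le> norm x \<and> norm x \<le> 8 / 3" for x
    using assms unfolding dyadic_partition_def by blast
  have n: "3 / 4 \<le> norm \<xi>" "norm \<xi> \<le> 8 / 3"
    using supp[OF False] by auto
  have zero: "\<phi> ((2 powi (- q)) *\<^sub>R \<xi>) = 0" if "q \<notin> {-1, 0, 1}" for q :: int
  proof (rule ccontr)
    assume "\<phi> ((2 powi (- q)) *\<^sub>R \<xi>) \<noteq> 0"
    from supp[OF this] have s: "3 / 4 \<le> 2 powi (- q) * norm \<xi>" "2 powi (- q) * norm \<xi> \<le> 8 / 3"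
      by auto
    from that consider "q \<ge> 2" | "q \<le> -2" by force
    then show False
    proof cases
      case 1
      then have "(2::real) powi (- q) \<le> 2 powi (- 2)"
        by (intro power_int_increasing) auto
      then have "2 powi (- q) * norm \<xi> \<le> (1 / 4) * (8 / 3)"
        using n by (intro mult_mono) (auto simp: power_int_minus)
      with s show False by simp
    next
      case 2
      then have "(2::real) powi 2 \<le> 2 powi (- q)"
        by (intro power_int_increasing) auto
      then have "4 * (3 / 4) \<le> 2 powi (- q) * norm \<xi>"
        using n by (intro mult_mono) auto
      with s show False by simp
    qed
  qed
  have "\<xi> \<noteq> 0" using n by auto
  then have "((\<lambda>q::int. \<phi> ((2 powi (- q)) *\<^sub>R \<xi>)) has_sum 1) UNIV"
    using assms unfolding dyadic_partition_def by blast
  then have "((\<lambda>q::int. \<phi> ((2 powi (- q)) *\<^sub>R \<xi>)) has_sum 1) {-1, 0, 1}"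
    using zero by (subst has_sum_cong_neutral[where T = UNIV and g = "\<lambda>q::int. \<phi> ((2 powi (- q)) *\<^sub>R \<xi>)"]) auto
  moreover have "((\<lambda>q::int. \<phi> ((2 powi (- q)) *\<^sub>R \<xi>)) has_sum (\<Sum>q\<in>{-1, 0, 1}. \<phi> ((2 powi (- q)) *\<^sub>R \<xi>))) {-1, 0, 1}"
    by (rule has_sum_finite) simp
  ultimately have "(\<Sum>q::int\<in>{-1, 0, 1}. \<phi> ((2 powi (- q)) *\<^sub>R \<xi>)) = 1"
    by (rule has_sum_unique[symmetric])
  moreover have "(2::real) powi (- 1) = 1 / 2"
    by (simp add: power_int_minus)
  ultimately have "thick_cutoff \<phi> \<xi> = 1"
    unfolding thick_cutoff_def by simp
  then show ?thesis by simp
qed simp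

definition scaled_cutoff :: "(real^'n::finite \<Rightarrow> real) \<Rightarrow> int \<Rightarrow> real^'n \<Rightarrow> complex" where
  "scaled_cutoff \<phi> q \<xi> = of_real (thick_cutoff \<phi> ((2 powi (- q)) *\<^sub>R \<xi>))"

lemma schwartz_thick_cutoff:
  fixes \<phi> :: "real^'n::finite \<Rightarrow> real"
  assumes "dyadic_partition \<phi>"
  shows "schwartz (\<lambda>\<xi>. complex_of_real (thick_cutoff \<phi> \<xi>))"
proof -
  have s: "schwartz (\<lambda>\<xi>. complex_of_real (\<phi> \<xi>))"
  proof (rule schwartz_compact_support[of \<phi> "8 / 3"])
    show "smooth \<phi>"
      using assms unfolding dyadic_partition_def by blast
    show "\<phi> \<xi> = 0" if "norm \<xi> > 8 / 3" for \<xi>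
      using assms that unfolding dyadic_partition_def by (meson not_le)
  qed
  show ?thesis
    unfolding thick_cutoff_def of_real_add
    using schwartz_scale[OF s, of 2] schwartz_scale[OF s, of "1 / 2"] s by (intro schwartz_add) auto
qed

lemma schwartz_scaled_cutoff: "dyadic_partition \<phi> \<Longrightarrow> schwartz (scaled_cutoff \<phi> q)"
  using schwartz_scale[OF schwartz_thick_cutoff, of \<phi> "2 powi (- q)"] by (simp add: scaled_cutoff_def[abs_def])

lemma dyadic_block_eq:
  "dyadic_block \<phi> q u \<psi> = u (fourier (\<lambda>\<xi>. of_real (\<phi> ((2 powi (- q)) *\<^sub>R \<xi>)) * inv_fourier \<psi> \<xi>))"
  by (simp add: dyadic_block_def inv_fourier_dist_def mult_dist_def fourier_dist_def)

lemma dyadic_cutoff_mult: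
  assumes "dyadic_partition \<phi>"
  shows "complex_of_real (\<phi> ((2 powi (- q)) *\<^sub>R \<xi>)) * (scaled_cutoff \<phi> q \<xi> * z) = of_real (\<phi> ((2 powi (- q)) *\<^sub>R \<xi>)) * z"
  unfolding scaled_cutoff_def mult.assoc[symmetric] of_real_mult[symmetric] thick_cutoff_reproduces[OF assms] ..

lemma schwartz_scaled_cutoff_mult:
  assumes "dyadic_partition \<phi>" "schwartz \<psi>" shows "schwartz (\<lambda>\<xi>. scaled_cutoff \<phi> q \<xi> * \<psi> \<xi>)"
  by (intro schwartz_mult_slow schwartz_scaled_cutoff schwartz_imp_slow assms)

text \<open>On both sides \<open>u\<close> is applied to the same function: after Fourier inversion the thickened cutoff
  multiplies the dyadic cutoff, which it leaves fixed.\<close>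

lemma dyadic_block_reproduce:
  assumes \<phi>: "dyadic_partition \<phi>" and \<psi>: "schwartz \<psi>"
  shows "dyadic_block \<phi> q u (fourier (\<lambda>\<xi>. scaled_cutoff \<phi> q \<xi> * inv_fourier \<psi> \<xi>)) = dyadic_block \<phi> q u \<psi>"
    and "dyadic_block \<phi> q u (fourier (\<lambda>\<xi>. scaled_cutoff \<phi> q \<xi> * \<psi> \<xi>)) = dyadic_block \<phi> q u (fourier \<psi>)"
  unfolding dyadic_block_eq
  by (simp_all add: fourier_inversion schwartz_scaled_cutoff_mult schwartz_inv_fourier \<phi> \<psi> dyadic_cutoff_mult)

lemma fourier_scaled_cutoff:
  fixes \<phi> :: "real^'n::finite \<Rightarrow> real"
  assumes "dyadic_partition \<phi>"
  shows "fourier (scaled_cutoff \<phi> q) z =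
    of_real ((2 powi q) ^ CARD('n)) * fourier (\<lambda>\<xi>. of_real (thick_cutoff \<phi> \<xi>)) ((2 powi q) *\<^sub>R z)"
  using fourier_scale[OF schwartz_integrable[OF schwartz_thick_cutoff[OF assms]], of "2 powi (- q)" z]
  by (simp add: scaled_cutoff_def[abs_def] power_int_minus_divide power_divide)

text \<open>Bernstein's inequality. The block is reproduced by convolution with the kernel of the
  thickened cutoff, whose mass does not depend on \<open>q\<close> and whose maximum scales like \<open>2\<^bsup>qn\<^esup>\<close>.\<close>

lemma bernstein:
  fixes \<phi> :: "real^'n::finite \<Rightarrow> real"
  assumes \<phi>: "dyadic_partition \<phi>" and p: "1 \<le> p" "p \<le> 2"
  obtains C where "C > 0"
    "\<And>q u g I. represents g (dyadic_block \<phi> q u) \<Longrightarrow> I \<ge> 0 \<Longrightarrow>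
      (\<integral>\<^sup>+x. ennreal (norm (g x) powr p) \<partial>lborel) \<le> ennreal I \<Longrightarrow>
      \<exists>G. represents G (dyadic_block \<phi> q u) \<and>
        energy G \<le> ennreal (C * ((2 powi q) ^ CARD('n)) powr (2 / p - 1) * I powr (2 / p))"
proof -
  let ?c = "complex_of_real (1 / (2 * pi) ^ CARD('n))"
  define K where "K q z = ?c * fourier (scaled_cutoff \<phi> q) z" for q z
  define k where "k z = ?c * fourier (\<lambda>\<xi>. of_real (thick_cutoff \<phi> \<xi>)) z" for z
  have K_eq: "K q z = of_real ((2 powi q) ^ CARD('n)) * k ((2 powi q) *\<^sub>R z)" for q z
    unfolding K_def k_def fourier_scaled_cutoff[OF \<phi>] by (simp add: mult_ac)
  have k: "schwartz k"
    unfolding k_def[abs_def] by (intro schwartz_cmult schwartz_fourier schwartz_thick_cutoff[OF \<phi>])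
  note [measurable] = schwartz_measurable[OF k]
  obtain A0 where A0: "A0 \<ge> 0" "\<And>z. norm (k z) \<le> A0" using schwartz_bounded[OF k] by blast
  \<comment> \<open>The summand 1 makes the bounds positive, as the rules for powers require.\<close>
  define A where "A = A0 + 1"
  have A: "A > 0" "\<And>z. norm (k z) \<le> A" using A0 by (auto simp: A_def intro: add_increasing2)
  define B where "B = (\<integral>z. norm (k z) \<partial>lborel) + 1"
  have "0 \<le> (\<integral>z. norm (k z) \<partial>lborel)" by simp
  then have B: "B > 0" unfolding B_def by linarith
  have kB: "(\<integral>\<^sup>+z. ennreal (norm (k z)) \<partial>lborel) \<le> ennreal B"
    using schwartz_integrable[OF k] by (subst nn_integral_eq_integral) (auto simp: B_def)
  define C where "C = 4 * B powr (3 - 2 / p) * A powr (2 / p - 1)"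
  show ?thesis
  proof
    show "C > 0" using A B by (simp add: C_def)
    fix q u g I
    assume g: "represents g (dyadic_block \<phi> q u)" and I: "I \<ge> 0"
      "(\<integral>\<^sup>+x. ennreal (norm (g x) powr p) \<partial>lborel) \<le> ennreal I"
    let ?b = "(2::real) powi q"
    have b: "?b > 0" by simp
    have gm: "g \<in> borel_measurable borel" using g by (simp add: represents_def)
    have Km: "K q \<in> borel_measurable borel"
      unfolding K_eq[abs_def] by measurable
    have KA: "norm (K q z) \<le> ?b ^ CARD('n) * A" for z
      unfolding K_eq norm_mult norm_of_real using A b by (simp add: abs_of_pos)
    have KB: "(\<integral>\<^sup>+z. ennreal (norm (K q z)) \<partial>lborel) \<le> ennreal B"
    proof -
      have "(\<integral>\<^sup>+z. ennreal (norm (K q z)) \<partial>lborel) = ennreal (?b ^ CARD('n)) * (\<integral>\<^sup>+z. ennreal (norm (k (0 + ?b *\<^sub>R z))) \<partial>lborel)"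
        unfolding K_eq norm_mult norm_of_real using b
        by (subst nn_integral_cmult[symmetric]) (auto simp: ennreal_mult' abs_of_pos)
      also have "\<dots> = (\<integral>\<^sup>+z. ennreal (norm (k z)) \<partial>lborel)"
        using b by (subst nn_integral_affine[where c="?b" and t=0 and f="\<lambda>z. ennreal (norm (k z))"]) auto
      finally show ?thesis using kB by simp
    qed
    have A': "?b ^ CARD('n) * A > 0" using A b by simp
    define G where "G y = (\<integral>x. g x * K q (x - y) \<partial>lborel)" for y
    note conv = energy_convolution[OF gm Km p I(2,1) KA A' KB B, folded G_def]
      convolution_measurable[OF gm Km p I(2,1) KA A' KB B, folded G_def]
      Fubini_convolution[OF gm Km p I(2,1) KA A' KB B, folded G_def]
    have "represents G (dyadic_block \<phi> q u)"
      unfolding represents_def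
    proof (intro conjI allI impI)
      show "G \<in> borel_measurable lborel" using conv(2) by simp
      fix \<psi> :: "real^'n \<Rightarrow> complex" assume \<psi>: "schwartz \<psi>"
      note c = conv(3)[OF schwartz_integrable[OF \<psi>]]
      show "integrable lborel (\<lambda>x. G x * \<psi> x)" using c by blast
      have "dyadic_block \<phi> q u \<psi> = dyadic_block \<phi> q u (fourier (\<lambda>\<xi>. scaled_cutoff \<phi> q \<xi> * inv_fourier \<psi> \<xi>))"
        by (rule dyadic_block_reproduce(1)[OF \<phi> \<psi>, symmetric])
      also have "\<dots> = (\<integral>x. g x * fourier (\<lambda>\<xi>. scaled_cutoff \<phi> q \<xi> * inv_fourier \<psi> \<xi>) x \<partial>lborel)"
        using g schwartz_fourier[OF schwartz_scaled_cutoff_mult[OF \<phi> schwartz_inv_fourier[OF \<psi>]]]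
        unfolding represents_def by blast
      also have "\<dots> = (\<integral>x. g x * (\<integral>y. K q (x - y) * \<psi> y \<partial>lborel) \<partial>lborel)"
        unfolding K_def
        by (subst fourier_multiplier_convolution[OF schwartz_integrable[OF schwartz_scaled_cutoff[OF \<phi>]] schwartz_integrable[OF \<psi>]]) (rule refl)
      finally show "dyadic_block \<phi> q u \<psi> = (\<integral>x. G x * \<psi> x \<partial>lborel)"
        using c by simp
    qed
    moreover have "energy G \<le> ennreal (C * (?b ^ CARD('n)) powr (2 / p - 1) * I powr (2 / p))"
      using conv(1) A b by (simp add: C_def powr_mult mult_ac)
    ultimately show "\<exists>G. represents G (dyadic_block \<phi> q u) \<and>
        energy G \<le> ennreal (C * (?b ^ CARD('n)) powr (2 / p - 1) * I powr (2 / p))"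
      by blast
  qed
qed

text \<open>At low frequencies \<open>\<eta>(\<xi>) \<approx> |\<xi>|\<^sup>2\<close>, at high frequencies \<open>\<eta>(\<xi>) \<approx> |\<xi>|\<^bsup>-2\<^esup>\<close>. The
  constant is \<open>(3/8)\<^sup>2 / 30\<^sup>2 = 1/6400\<close>, because \<open>1 + |\<xi>|\<^sup>2 \<le> 30\<close> when \<open>q < 0\<close>; the case \<open>q \<ge> 0\<close>
  would allow a larger one.\<close>

lemma eta_annulus:
  fixes \<xi> :: "real^'n::finite"
  assumes "3 / 8 \<le> 2 powi (- q) * norm \<xi>" "2 powi (- q) * norm \<xi> \<le> 16 / 3"
  shows "(2 powi (- \<bar>q\<bar>))\<^sup>2 / 6400 \<le> eta \<xi>"
proof -
  define b where "b = (2::real) powi q"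
  define N where "N = norm \<xi>"
  have b: "b > 0" by (simp add: b_def)
  have r: "(2::real) powi (- q) = 1 / b" by (simp add: b_def power_int_minus_divide)
  then have N: "3 / 8 * b \<le> N" "N \<le> 16 / 3 * b"
    using assms b unfolding r N_def[symmetric] by (simp_all add: field_simps)
  have N0: "N > 0" using N(1) b by linarith
  have e: "eta \<xi> = N\<^sup>2 / (1 + N\<^sup>2)\<^sup>2" by (simp add: eta_def N_def)
  have pos: "(1 + N\<^sup>2)\<^sup>2 > 0" by (intro zero_less_power add_pos_nonneg) auto
  show ?thesis
  proof (cases "q < 0")
    case True
    have "b \<le> 2 powi (-1)"
      unfolding b_def using True by (intro power_int_increasing) auto
    then have "N \<le> 8 / 3" using N by (simp add: power_int_minus)
    then have "N\<^sup>2 \<le> (8 / 3)\<^sup>2" using N0 by (intro power_mono) auto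
    then have "1 + N\<^sup>2 \<le> 30" by (simp add: power2_eq_square)
    then have "(1 + N\<^sup>2)\<^sup>2 \<le> 30\<^sup>2" by (intro power_mono) auto
    moreover have "(3 / 8 * b)\<^sup>2 \<le> N\<^sup>2" using N b by (intro power_mono) auto
    then have "b\<^sup>2 * 900 \<le> N\<^sup>2 * 6400" by (simp add: power_mult_distrib power_divide)
    ultimately have "b\<^sup>2 * (1 + N\<^sup>2)\<^sup>2 \<le> N\<^sup>2 * 6400"
      using mult_left_mono[of "(1 + N\<^sup>2)\<^sup>2" "900" "b\<^sup>2"] by simp
    then have "b\<^sup>2 / 6400 \<le> eta \<xi>"
      using pos unfolding e by (simp add: pos_le_divide_eq)
    then show ?thesis using True by (simp add: b_def)
  next
    case False
    have "2 powi 0 \<le> b"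
      unfolding b_def using False by (intro power_int_increasing) auto
    then have "1 \<le> b" by simp
    then have "3 / 8 \<le> N" using N by linarith
    then have "(3 / 8)\<^sup>2 \<le> N\<^sup>2" by (intro power_mono) auto
    then have "1 + N\<^sup>2 \<le> 9 * N\<^sup>2" by (simp add: power2_eq_square)
    then have "(1 + N\<^sup>2)\<^sup>2 \<le> (9 * N\<^sup>2)\<^sup>2" by (intro power_mono) auto
    also have "\<dots> = 81 * N\<^sup>2 * N\<^sup>2" by (simp add: power2_eq_square)
    also have "\<dots> \<le> 81 * N\<^sup>2 * (16 / 3 * b)\<^sup>2"
      using N N0 by (intro mult_left_mono power_mono) auto
    also have "\<dots> \<le> 6400 * N\<^sup>2 * b\<^sup>2"
      by (simp add: power_mult_distrib power_divide)
    finally have "1 / b\<^sup>2 / 6400 \<le> eta \<xi>"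
      using pos b unfolding e by (simp add: pos_le_divide_eq pos_divide_le_eq)
    then show ?thesis using False by (simp add: b_def power_int_minus_divide power_divide)
  qed
qed

lemma lp_norm_2_le:
  assumes "energy h \<le> ennreal E" "E \<ge> 0"
  shows "lp_norm lborel 2 (\<lambda>x. ennreal (norm (h x))) \<le> ennreal (sqrt E)"
proof -
  have "enn_powr (ennreal (norm (h x))) (enn2real 2) = (ennreal (norm (h x)))\<^sup>2" for x
    by (simp add: enn_powr_def ennreal_power)
  then have eq: "lp_norm lborel 2 (\<lambda>x. ennreal (norm (h x))) = enn_powr (energy h) (1 / 2)"
    by (simp add: lp_norm_def energy_def)
  have fin: "energy h < top" using assms(1) by (rule order_le_less_trans) simp
  have "enn2real (energy h) \<le> E"
    using assms by (intro enn2real_leI) auto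
  then have "enn2real (energy h) powr (1 / 2) \<le> sqrt E"
    by (simp add: powr_half_sqrt)
  then show ?thesis
    unfolding eq enn_powr_def using fin by (auto intro: ennreal_leI)
qed

lemma lp_norm_finite_exponent:
  assumes p: "p \<ge> 1" and fin: "lp_norm lborel (ennreal p) (\<lambda>x. ennreal (norm (g x))) < top"
  obtains I where "I \<ge> 0" "(\<integral>\<^sup>+x. ennreal (norm (g x) powr p) \<partial>lborel) = ennreal I"
    "lp_norm lborel (ennreal p) (\<lambda>x. ennreal (norm (g x))) = ennreal (I powr (1 / p))"
proof -
  define N where "N = (\<integral>\<^sup>+x. ennreal (norm (g x) powr p) \<partial>lborel)"
  have eq: "lp_norm lborel (ennreal p) (\<lambda>x. ennreal (norm (g x))) = enn_powr N (1 / p)"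
    using p by (simp add: lp_norm_def enn_powr_def N_def)
  then have "N < top"
    using fin by (cases "N = top") (auto simp: enn_powr_def less_top)
  then have "N = ennreal (enn2real N)" by simp
  moreover have "enn_powr N (1 / p) = ennreal (enn2real N powr (1 / p))"
    using \<open>N < top\<close> by (auto simp: enn_powr_def)
  ultimately show ?thesis
    using eq that[of "enn2real N"] unfolding N_def[symmetric] by (metis enn2real_nonneg)
qed

text \<open>The damped transform is represented by \<open>h\<close>, the transform of \<open>G\<close> in \<open>L\<^sup>2\<close>, times the damping factor
  and the thickened cutoff. Inserting the cutoff localises the representing function to the annulus, where
  the damping factor is uniformly small.\<close>

lemma damped_block_norm_le:
  fixes \<phi> :: "real^'n::finite \<Rightarrow> real"
  assumes \<phi>: "dyadic_partition \<phi>" and G: "represents G (dyadic_block \<phi> q u)"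
    and E: "energy G \<le> ennreal E" "E \<ge> 0" and t: "t \<ge> 0"
  shows "damped_block_norm \<phi> t q u
    \<le> ennreal (3 * exp (- ((2 powi (- \<bar>q\<bar>))\<^sup>2 / 6400 * t)) * sqrt ((2 * pi) ^ CARD('n) * E))"
proof -
  define d where "d = exp (- ((2 powi (- \<bar>q\<bar>))\<^sup>2 / 6400 * t))"
  let ?e = "\<lambda>\<xi>::real^'n. complex_of_real (exp (- eta \<xi> * t))"
  have Gm: "G \<in> borel_measurable borel" using G by (simp add: represents_def)
  have "energy G < \<infinity>" using E(1) by (rule order_le_less_trans) simp
  from fourier_L2[OF Gm this] obtain h where hm [measurable]: "h \<in> borel_measurable borel"
    and h: "energy h \<le> ennreal ((2 * pi) ^ CARD('n)) * energy G"
    and hG: "\<And>\<psi>. schwartz \<psi> \<Longrightarrow> (\<integral>x. G x * fourier \<psi> x \<partial>lborel) = (\<integral>x. h x * \<psi> x \<partial>lborel)"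
    by blast
  note h
  also have "ennreal ((2 * pi) ^ CARD('n)) * energy G \<le> ennreal ((2 * pi) ^ CARD('n)) * ennreal E"
    by (intro mult_left_mono E) simp
  also have "\<dots> = ennreal ((2 * pi) ^ CARD('n) * E)"
    by (rule ennreal_mult'[symmetric]) simp
  finally have hE: "energy h \<le> ennreal ((2 * pi) ^ CARD('n) * E)" .
  define w where "w \<xi> = h \<xi> * scaled_cutoff \<phi> q \<xi> * ?e \<xi>" for \<xi>
  have e_slow: "slow ?e" using t by (rule slow_damping)
  have [measurable]: "?e \<in> borel_measurable borel"
    unfolding eta_def by measurable
  have fm [measurable]: "scaled_cutoff \<phi> q \<in> borel_measurable borel"
    by (rule schwartz_measurable[OF schwartz_scaled_cutoff[OF \<phi>]])
  have wm [measurable]: "w \<in> borel_measurable borel"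
    unfolding w_def by measurable
  have w_le: "norm (w \<xi>) \<le> 3 * d * norm (h \<xi>)" for \<xi>
  proof (cases "scaled_cutoff \<phi> q \<xi> = 0")
    case False
    then have ne: "thick_cutoff \<phi> ((2 powi (- q)) *\<^sub>R \<xi>) \<noteq> 0" by (simp add: scaled_cutoff_def)
    have "(2 powi (- \<bar>q\<bar>))\<^sup>2 / 6400 \<le> eta \<xi>"
      using thick_cutoff_support[OF \<phi> ne] by (intro eta_annulus) auto
    then have "(2 powi (- \<bar>q\<bar>))\<^sup>2 / 6400 * t \<le> eta \<xi> * t"
      using t by (rule mult_right_mono)
    then have "exp (- eta \<xi> * t) \<le> d"
      unfolding d_def by simp
    moreover have "norm (scaled_cutoff \<phi> q \<xi>) \<le> 3"
      unfolding scaled_cutoff_def norm_of_real using thick_cutoff_range[OF \<phi>] by simp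
    ultimately have "norm (scaled_cutoff \<phi> q \<xi>) * exp (- eta \<xi> * t) \<le> 3 * d"
      by (intro mult_mono) auto
    then have "norm (h \<xi>) * (norm (scaled_cutoff \<phi> q \<xi>) * exp (- eta \<xi> * t)) \<le> norm (h \<xi>) * (3 * d)"
      by (rule mult_left_mono) simp
    then show ?thesis by (simp add: w_def norm_mult mult_ac)
  qed (simp add: w_def d_def)
  have wE: "energy w \<le> ennreal ((3 * d)\<^sup>2 * ((2 * pi) ^ CARD('n) * E))"
  proof -
    have "energy w \<le> (\<integral>\<^sup>+x. ennreal ((3 * d)\<^sup>2) * (ennreal (norm (h x)))\<^sup>2 \<partial>lborel)"
      unfolding energy_def
    proof (rule nn_integral_mono)
      fix x
      have "(norm (w x))\<^sup>2 \<le> (3 * d)\<^sup>2 * (norm (h x))\<^sup>2"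
        unfolding power_mult_distrib[symmetric] using w_le by (intro power_mono) auto
      then show "(ennreal (norm (w x)))\<^sup>2 \<le> ennreal ((3 * d)\<^sup>2) * (ennreal (norm (h x)))\<^sup>2"
        by (simp add: ennreal_power ennreal_mult'[symmetric] ennreal_leI)
    qed
    also have "\<dots> = ennreal ((3 * d)\<^sup>2) * energy h"
      unfolding energy_def by (rule nn_integral_cmult) measurable
    also have "\<dots> \<le> ennreal ((3 * d)\<^sup>2) * ennreal ((2 * pi) ^ CARD('n) * E)"
      by (intro mult_left_mono hE) simp
    also have "\<dots> = ennreal ((3 * d)\<^sup>2 * ((2 * pi) ^ CARD('n) * E))"
      by (rule ennreal_mult'[symmetric]) simp
    finally show ?thesis .
  qed
  have "represents w (mult_dist ?e (fourier_dist (dyadic_block \<phi> q u)))"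
    unfolding represents_def
  proof (intro conjI allI impI)
    show "w \<in> borel_measurable lborel" by simp
    fix \<psi> :: "real^'n \<Rightarrow> complex" assume \<psi>: "schwartz \<psi>"
    have e\<psi>: "schwartz (\<lambda>\<xi>. ?e \<xi> * \<psi> \<xi>)"
      using schwartz_mult_slow[OF \<psi> e_slow] by (simp add: mult.commute)
    have "energy w < \<infinity>" using wE by (rule order_le_less_trans) simp
    then show "integrable lborel (\<lambda>x. w x * \<psi> x)"
      by (rule integrable_mult_energy[OF wm schwartz_measurable[OF \<psi>] _ energy_schwartz[OF \<psi>]])
    have "mult_dist ?e (fourier_dist (dyadic_block \<phi> q u)) \<psi> = dyadic_block \<phi> q u (fourier (\<lambda>\<xi>. ?e \<xi> * \<psi> \<xi>))"
      by (simp add: mult_dist_def fourier_dist_def)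
    also have "\<dots> = dyadic_block \<phi> q u (fourier (\<lambda>\<xi>. scaled_cutoff \<phi> q \<xi> * (?e \<xi> * \<psi> \<xi>)))"
      by (rule dyadic_block_reproduce(2)[OF \<phi> e\<psi>, symmetric])
    also have "\<dots> = (\<integral>x. G x * fourier (\<lambda>\<xi>. scaled_cutoff \<phi> q \<xi> * (?e \<xi> * \<psi> \<xi>)) x \<partial>lborel)"
      using G schwartz_fourier[OF schwartz_scaled_cutoff_mult[OF \<phi> e\<psi>]] unfolding represents_def by blast
    also have "\<dots> = (\<integral>x. h x * (scaled_cutoff \<phi> q x * (?e x * \<psi> x)) \<partial>lborel)"
      by (rule hG[OF schwartz_scaled_cutoff_mult[OF \<phi> e\<psi>]])
    finally show "mult_dist ?e (fourier_dist (dyadic_block \<phi> q u)) \<psi> = (\<integral>x. w x * \<psi> x \<partial>lborel)"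
      by (simp add: w_def mult.assoc)
  qed
  then have "damped_block_norm \<phi> t q u \<le> lp_norm lborel 2 (\<lambda>x. ennreal (norm (w x)))"
    unfolding damped_block_norm_def dist_norm_def by (intro INF_lower) simp
  also have "\<dots> \<le> ennreal (sqrt ((3 * d)\<^sup>2 * ((2 * pi) ^ CARD('n) * E)))"
    using E by (intro lp_norm_2_le[OF wE]) auto
  also have "sqrt ((3 * d)\<^sup>2 * ((2 * pi) ^ CARD('n) * E)) = 3 * d * sqrt ((2 * pi) ^ CARD('n) * E)"
  proof -
    have "3 * d \<ge> 0" by (simp add: d_def)
    then show ?thesis
      unfolding real_sqrt_mult[of "(3 * d)\<^sup>2"] real_sqrt_abs by (simp only: abs_of_nonneg)
  qed
  finally show ?thesis by (simp add: d_def)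
qed

text \<open>The infimum is handled by dividing by \<open>c\<close>; if \<open>v\<close> is represented by no function, both infimum and
  bound are infinite.\<close>

lemma le_mult_dist_norm:
  assumes "\<And>g. represents g v \<Longrightarrow> X \<le> ennreal c * lp_norm lborel p (\<lambda>x. ennreal (norm (g x)))" and c: "c > 0"
  shows "X \<le> ennreal c * dist_norm p v"
proof -
  have inv: "ennreal (1 / c) * ennreal c = 1" "ennreal c * ennreal (1 / c) = 1"
    using c by (simp_all add: ennreal_mult'[symmetric])
  have "ennreal (1 / c) * X \<le> dist_norm p v"
    unfolding dist_norm_def
  proof (rule INF_greatest)
    fix g assume "g \<in> {g. represents g v}"
    then have "ennreal (1 / c) * X \<le> ennreal (1 / c) * (ennreal c * lp_norm lborel p (\<lambda>x. ennreal (norm (g x))))"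
      using assms(1) by (intro mult_left_mono) auto
    then show "ennreal (1 / c) * X \<le> lp_norm lborel p (\<lambda>x. ennreal (norm (g x)))"
      by (simp add: mult.assoc[symmetric] inv)
  qed
  then have "ennreal c * (ennreal (1 / c) * X) \<le> ennreal c * dist_norm p v"
    by (rule mult_left_mono) simp
  then show ?thesis by (simp add: mult.assoc[symmetric] inv)
qed

text \<open>Bernstein's inequality passes from \<open>L\<^sup>p\<close> to \<open>L\<^sup>2\<close> at the cost of \<open>2\<^bsup>qn(1/p-1/2)\<^esup>\<close>, and the damping of
  the annulus supplies the exponential factor.\<close>

theorem damped_block_norm_estimate:
  fixes \<phi> :: "real^'n::finite \<Rightarrow> real"
  assumes \<phi>: "dyadic_partition \<phi>" and p: "1 \<le> p" "p \<le> 2"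
  obtains C where "C > 0"
    "\<And>q t u. t \<ge> 0 \<Longrightarrow> damped_block_norm \<phi> t q u \<le>
      ennreal (C * exp (- ((2 powi (- \<bar>q\<bar>))\<^sup>2 / 6400 * t)) * 2 powr (of_int q * (real CARD('n) * (1 / p - 1 / 2))))
        * dist_norm (ennreal p) (dyadic_block \<phi> q u)"
proof -
  obtain C where C: "C > 0" and bern: "\<And>q u g I. represents g (dyadic_block \<phi> q u) \<Longrightarrow> I \<ge> 0 \<Longrightarrow>
      (\<integral>\<^sup>+x. ennreal (norm (g x) powr p) \<partial>lborel) \<le> ennreal I \<Longrightarrow>
      \<exists>G. represents G (dyadic_block \<phi> q u) \<and>
        energy G \<le> ennreal (C * ((2 powi q) ^ CARD('n)) powr (2 / p - 1) * I powr (2 / p))"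
    using bernstein[OF \<phi> p] by blast
  define D where "D = 3 * sqrt ((2 * pi) ^ CARD('n) * C)"
  have D: "D > 0" using C by (simp add: D_def)
  have "damped_block_norm \<phi> t q u \<le>
      ennreal (D * exp (- ((2 powi (- \<bar>q\<bar>))\<^sup>2 / 6400 * t)) * 2 powr (of_int q * (real CARD('n) * (1 / p - 1 / 2))))
        * dist_norm (ennreal p) (dyadic_block \<phi> q u)" if t: "t \<ge> 0" for q t u
  proof (rule le_mult_dist_norm)
    define \<kappa> where "\<kappa> = exp (- ((2 powi (- \<bar>q\<bar>))\<^sup>2 / 6400 * t))"
    \<comment> \<open>The energy contributes \<open>2\<^bsup>qn(2/p-1)\<^esup>\<close>, whose square root is \<open>2\<^bsup>q\<beta>\<^esup>\<close>.\<close>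
    define \<beta> where "\<beta> = real CARD('n) * (1 / p - 1 / 2)"
    show pos: "0 < D * exp (- ((2 powi (- \<bar>q\<bar>))\<^sup>2 / 6400 * t)) * 2 powr (of_int q * (real CARD('n) * (1 / p - 1 / 2)))"
      using D by simp
    fix g assume g: "represents g (dyadic_block \<phi> q u)"
    let ?N = "lp_norm lborel (ennreal p) (\<lambda>x. ennreal (norm (g x)))"
    show "damped_block_norm \<phi> t q u \<le>
      ennreal (D * exp (- ((2 powi (- \<bar>q\<bar>))\<^sup>2 / 6400 * t)) * 2 powr (of_int q * (real CARD('n) * (1 / p - 1 / 2)))) * ?N"
    proof (cases "?N = top")
      case True
      with pos D show ?thesis by (simp add: ennreal_mult_top)
    next
      case False
      then obtain I where I: "I \<ge> 0" "(\<integral>\<^sup>+x. ennreal (norm (g x) powr p) \<partial>lborel) = ennreal I"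
        "?N = ennreal (I powr (1 / p))"
        using lp_norm_finite_exponent[OF p(1)] by (metis less_top)
      define E where "E = C * ((2 powi q) ^ CARD('n)) powr (2 / p - 1) * I powr (2 / p)"
      have E: "E \<ge> 0" using C by (simp add: E_def)
      obtain G where G: "represents G (dyadic_block \<phi> q u)" "energy G \<le> ennreal E"
        using bern[OF g I(1)] I(2) unfolding E_def by auto
      have sqrt_E: "sqrt ((2 * pi) ^ CARD('n) * E) = sqrt ((2 * pi) ^ CARD('n) * C) * (2 powr (of_int q * \<beta>) * I powr (1 / p))"
      proof -
        have sq: "x powr (2 * a) = (x powr a)\<^sup>2" for x a :: real
          by (simp add: power2_eq_square powr_add[symmetric])
        have "(2::real) powi q = 2 powr of_int q"
          by (simp add: powr_real_of_int')
        then have "((2 powi q) ^ CARD('n)) powr (2 / p - 1) = 2 powr (2 * (of_int q * \<beta>))"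
          by (simp add: powr_power powr_powr \<beta>_def algebra_simps)
        also have "\<dots> = (2 powr (of_int q * \<beta>))\<^sup>2" by (rule sq)
        finally have "E = C * (2 powr (of_int q * \<beta>) * I powr (1 / p))\<^sup>2"
          using sq[of I "1 / p"] by (simp add: E_def power_mult_distrib)
        then show ?thesis
          by (simp add: real_sqrt_mult mult.assoc[symmetric])
      qed
      have "damped_block_norm \<phi> t q u \<le> ennreal (3 * \<kappa> * sqrt ((2 * pi) ^ CARD('n) * E))"
        unfolding \<kappa>_def by (rule damped_block_norm_le[OF \<phi> G E t])
      also have "3 * \<kappa> * sqrt ((2 * pi) ^ CARD('n) * E) = (D * \<kappa> * 2 powr (of_int q * \<beta>)) * I powr (1 / p)"
        unfolding sqrt_E D_def by (simp only: mult_ac)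
      also have "ennreal \<dots> = ennreal (D * \<kappa> * 2 powr (of_int q * \<beta>)) * ?N"
        unfolding I(3) using D by (intro ennreal_mult') (simp add: \<kappa>_def)
      finally show ?thesis by (simp only: \<kappa>_def \<beta>_def)
    qed
  qed
  with D show ?thesis by (rule that)
qed

section \<open>Sequence norms and time weights\<close>

lemma enn_powr_mono: "x \<le> y \<Longrightarrow> a > 0 \<Longrightarrow> enn_powr x a \<le> enn_powr y a"
  unfolding enn_powr_def
  by (auto simp: top_unique less_top[symmetric] intro!: ennreal_leI powr_mono2 enn2real_mono)

lemma enn_powr_cmult:
  assumes "c \<ge> 0" "a > 0"
  shows "enn_powr (ennreal c * x) a = ennreal (c powr a) * enn_powr x a"
proof (cases "x = top")
  case True
  then show ?thesis
    using assms by (cases "c = 0") (auto simp: enn_powr_def ennreal_mult_top)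
next
  case False
  then obtain y where y: "x = ennreal y" "y \<ge> 0" by (cases x) auto
  then show ?thesis
    using assms by (simp add: enn_powr_def ennreal_mult'[symmetric] powr_mult)
qed

lemma lp_norm_count_space_mono:
  fixes a b :: "int \<Rightarrow> ennreal"
  assumes r: "1 \<le> r" and c: "c \<ge> 0" and ab: "\<And>q. q \<in> I \<Longrightarrow> a q \<le> ennreal c * b q"
  shows "lp_norm (count_space I) r a \<le> ennreal c * lp_norm (count_space UNIV) r b"
proof (cases "r = \<infinity>")
  case True
  have b: "b q \<le> esssup (count_space UNIV) b" for q
    using esssup_AE[where M = "count_space UNIV" and f = b] by (simp add: AE_count_space)
  have "a q \<le> ennreal c * esssup (count_space UNIV) b" if "q \<in> I" for q
    by (rule order_trans[OF ab[OF that] mult_left_mono[OF b]]) simp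
  then have "esssup (count_space I) a \<le> ennreal c * esssup (count_space UNIV) b"
    by (intro esssup_I) (auto simp: AE_count_space)
  with True show ?thesis by (simp add: lp_norm_def)
next
  case False
  define \<rho> where "\<rho> = enn2real r"
  have \<rho>: "\<rho> \<ge> 1"
    unfolding \<rho>_def using r False enn2real_mono[of 1 r] by (simp add: less_top)
  have "(\<integral>\<^sup>+q. enn_powr (a q) \<rho> \<partial>count_space I) \<le> (\<integral>\<^sup>+q. ennreal (c powr \<rho>) * enn_powr (b q) \<rho> \<partial>count_space I)"
  proof (rule nn_integral_mono)
    fix q assume "q \<in> space (count_space I)"
    then have "enn_powr (a q) \<rho> \<le> enn_powr (ennreal c * b q) \<rho>"
      using ab \<rho> by (intro enn_powr_mono) auto
    then show "enn_powr (a q) \<rho> \<le> ennreal (c powr \<rho>) * enn_powr (b q) \<rho>"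
      using c \<rho> by (simp add: enn_powr_cmult)
  qed
  also have "\<dots> \<le> (\<integral>\<^sup>+q. ennreal (c powr \<rho>) * enn_powr (b q) \<rho> \<partial>count_space UNIV)"
    by (subst nn_integral_count_space_indicator) (auto intro!: nn_integral_mono simp: indicator_def)
  also have "\<dots> = ennreal (c powr \<rho>) * (\<integral>\<^sup>+q. enn_powr (b q) \<rho> \<partial>count_space UNIV)"
    by (rule nn_integral_cmult) simp
  finally have "enn_powr (\<integral>\<^sup>+q. enn_powr (a q) \<rho> \<partial>count_space I) (1 / \<rho>)
      \<le> enn_powr (ennreal (c powr \<rho>) * (\<integral>\<^sup>+q. enn_powr (b q) \<rho> \<partial>count_space UNIV)) (1 / \<rho>)"
    using \<rho> by (intro enn_powr_mono) auto
  also have "\<dots> = ennreal c * enn_powr (\<integral>\<^sup>+q. enn_powr (b q) \<rho> \<partial>count_space UNIV) (1 / \<rho>)"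
    using \<rho> c by (subst enn_powr_cmult) (auto simp: powr_powr)
  finally show ?thesis
    using False by (simp add: lp_norm_def \<rho>_def)
qed

text \<open>One of the two parts carries at least half of the sum.\<close>

lemma lp_norm_split:
  fixes a :: "int \<Rightarrow> ennreal"
  assumes r: "1 \<le> r"
  shows "lp_norm (count_space UNIV) r a \<le> 2 * (lp_norm (count_space I) r a + lp_norm (count_space (- I)) r a)"
proof (cases "r = \<infinity>")
  case True
  have "a q \<le> esssup (count_space I) a + esssup (count_space (- I)) a" for q
    using esssup_AE[where M = "count_space I" and f = a] esssup_AE[where M = "count_space (- I)" and f = a]
    by (cases "q \<in> I") (auto simp: AE_count_space intro: add_increasing add_increasing2)
  then have "esssup (count_space UNIV) a \<le> esssup (count_space I) a + esssup (count_space (- I)) a"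
    by (intro esssup_I) (auto simp: AE_count_space)
  also have "\<dots> \<le> 2 * (esssup (count_space I) a + esssup (count_space (- I)) a)"
    by (simp add: mult_2 add_increasing2)
  finally show ?thesis using True by (simp add: lp_norm_def)
next
  case False
  define \<rho> where "\<rho> = enn2real r"
  have \<rho>: "\<rho> \<ge> 1"
    unfolding \<rho>_def using r False enn2real_mono[of 1 r] by (simp add: less_top)
  define S where "S J = (\<integral>\<^sup>+q. enn_powr (a q) \<rho> \<partial>count_space J)" for J
  define m where "m = max (S I) (S (- I))"
  have S_eq: "S J = (\<integral>\<^sup>+q. enn_powr (a q) \<rho> * indicator J q \<partial>count_space UNIV)" for J
    by (simp add: S_def nn_integral_count_space_indicator)
  have "S UNIV = S I + S (- I)"
    unfolding S_eq
    by (subst nn_integral_add[symmetric]) (auto intro!: nn_integral_cong simp: indicator_def)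
  also have "\<dots> \<le> ennreal 2 * m"
    by (simp add: m_def mult_2 add_mono)
  finally have "enn_powr (S UNIV) (1 / \<rho>) \<le> enn_powr (ennreal 2 * m) (1 / \<rho>)"
    using \<rho> by (intro enn_powr_mono) auto
  also have "\<dots> = ennreal (2 powr (1 / \<rho>)) * enn_powr m (1 / \<rho>)"
    using \<rho> by (intro enn_powr_cmult) auto
  also have "\<dots> \<le> 2 * (enn_powr (S I) (1 / \<rho>) + enn_powr (S (- I)) (1 / \<rho>))"
  proof (rule mult_mono)
    have "2 powr (1 / \<rho>) \<le> 2 powr (1::real)"
      using \<rho> by (intro powr_mono) auto
    then show "ennreal (2 powr (1 / \<rho>)) \<le> 2"
      using ennreal_leI by fastforce
    show "enn_powr m (1 / \<rho>) \<le> enn_powr (S I) (1 / \<rho>) + enn_powr (S (- I)) (1 / \<rho>)"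
      unfolding m_def by (simp add: max_def add_increasing add_increasing2)
  qed auto
  finally show ?thesis
    using False by (simp add: lp_norm_def \<rho>_def S_def)
qed

text \<open>By translation invariance of counting measure the bound is uniform in the shift, which will depend
  on time.\<close>

lemma lp_norm_geometric:
  assumes r: "1 \<le> r" and \<alpha>: "\<alpha> > 0"
  obtains S where "S > 0"
    "\<And>k::int. lp_norm (count_space UNIV) r (\<lambda>q::int. ennreal (2 powr (- \<alpha> * \<bar>of_int (q + k)\<bar>))) \<le> ennreal S"
proof (cases "r = \<infinity>")
  case True
  have "lp_norm (count_space UNIV) r (\<lambda>q::int. ennreal (2 powr (- \<alpha> * \<bar>of_int (q + k)\<bar>))) \<le> ennreal 1" for k
  proof -
    have "2 powr (- \<alpha> * \<bar>of_int (q + k)\<bar>) \<le> 2 powr (0::real)" for q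
      using \<alpha> by (intro powr_mono) auto
    then show ?thesis
      using True unfolding lp_norm_def by (auto intro!: esssup_I ennreal_leI simp: AE_count_space simp del: ennreal_1)
  qed
  then show ?thesis using that[of 1] by simp
next
  case False
  define \<rho> where "\<rho> = enn2real r"
  have \<rho>: "\<rho> \<ge> 1"
    unfolding \<rho>_def using r False enn2real_mono[of 1 r] by (simp add: less_top)
  define g where "g q = 2 powr (- \<alpha> * \<rho> * \<bar>real_of_int q\<bar>)" for q :: int
  define T where "T = (\<integral>\<^sup>+q. ennreal (g q) \<partial>count_space UNIV)"
  define x where "x = 2 powr (- \<alpha> * \<rho>)"
  have x: "0 \<le> x" "x < 1"
    using \<alpha> \<rho> powr_less_mono[of "- \<alpha> * \<rho>" 0 2] by (auto simp: x_def)
  have gn: "g (int n) = x ^ n" "g (- int n) = x ^ n" for n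
    by (simp_all add: g_def x_def powr_power mult_ac)
  have geo: "(\<integral>\<^sup>+n. ennreal (x ^ n) \<partial>count_space UNIV) < top"
    using x by (simp add: nn_integral_count_space_nat suminf_ennreal_eq[OF _ geometric_sums])
  have "T \<le> (\<integral>\<^sup>+q. ennreal (g q) * indicator (range int) q + ennreal (g q) * indicator (range (\<lambda>n. - int n)) q \<partial>count_space UNIV)"
    unfolding T_def
  proof (rule nn_integral_mono)
    fix q :: int
    have "q \<in> range int \<or> q \<in> range (\<lambda>n. - int n)"
      by (cases q rule: int_cases2) auto
    then show "ennreal (g q) \<le> ennreal (g q) * indicator (range int) q + ennreal (g q) * indicator (range (\<lambda>n. - int n)) q"
      by (auto simp: indicator_def)
  qed
  also have "\<dots> = (\<integral>\<^sup>+q. ennreal (g q) \<partial>count_space (range int)) + (\<integral>\<^sup>+q. ennreal (g q) \<partial>count_space (range (\<lambda>n. - int n)))"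
    by (subst nn_integral_add) (simp_all add: nn_integral_count_space_indicator)
  also have "(\<integral>\<^sup>+q. ennreal (g q) \<partial>count_space (range int)) = (\<integral>\<^sup>+n. ennreal (g (int n)) \<partial>count_space UNIV)"
    by (rule nn_integral_bij_count_space[symmetric]) (auto simp: bij_betw_def inj_on_def)
  also have "(\<integral>\<^sup>+q. ennreal (g q) \<partial>count_space (range (\<lambda>n. - int n))) = (\<integral>\<^sup>+n. ennreal (g (- int n)) \<partial>count_space UNIV)"
    by (rule nn_integral_bij_count_space[symmetric]) (auto simp: bij_betw_def inj_on_def)
  also have "\<dots> = (\<integral>\<^sup>+n. ennreal (x ^ n) \<partial>count_space UNIV)"
    by (simp add: gn)
  also have "(\<integral>\<^sup>+n. ennreal (g (int n)) \<partial>count_space UNIV) = (\<integral>\<^sup>+n. ennreal (x ^ n) \<partial>count_space UNIV)"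
    by (simp add: gn)
  also have "(\<integral>\<^sup>+n. ennreal (x ^ n) \<partial>count_space UNIV) + (\<integral>\<^sup>+n. ennreal (x ^ n) \<partial>count_space UNIV) < top"
    using geo by simp
  finally have T: "T < top" .
  have norm_eq: "lp_norm (count_space UNIV) r (\<lambda>q::int. ennreal (2 powr (- \<alpha> * \<bar>of_int (q + k)\<bar>))) = enn_powr T (1 / \<rho>)" for k
  proof -
    have "enn_powr (ennreal (2 powr (- \<alpha> * \<bar>of_int (q + k)\<bar>))) \<rho> = ennreal (g (q + k))" for q
      by (simp add: enn_powr_def g_def powr_powr mult_ac)
    moreover have "(\<integral>\<^sup>+q. ennreal (g (q + k)) \<partial>count_space UNIV) = T"
      unfolding T_def
      by (rule nn_integral_bij_count_space) (rule bij_betw_byWitness[of _ "\<lambda>q. q - k"], auto)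
    ultimately show ?thesis
      using False by (simp add: lp_norm_def \<rho>_def)
  qed
  have "enn_powr T (1 / \<rho>) \<le> ennreal (enn2real T powr (1 / \<rho>) + 1)"
    using T by (auto simp: enn_powr_def intro: ennreal_leI)
  moreover have "enn2real T powr (1 / \<rho>) + 1 > 0"
    by (simp add: add_nonneg_pos)
  ultimately show ?thesis
    using that norm_eq by metis
qed

text \<open>Since \<open>u \<le> e\<^sup>u\<close> for \<open>u = cz/\<alpha>\<close>. The summand 1 covers \<open>\<alpha> = 0\<close>, where \<open>0 powr 0 = 0\<close>.\<close>

lemma powr_exp_bound:
  fixes z c \<alpha> :: real
  assumes "z \<ge> 0" "c > 0" "\<alpha> \<ge> 0"
  shows "z powr \<alpha> * exp (- (c * z)) \<le> (\<alpha> / c) powr \<alpha> + 1"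
proof (cases "\<alpha> = 0")
  case True
  have "z powr \<alpha> * exp (- (c * z)) \<le> 1 * 1"
    using assms True by (intro mult_mono) auto
  then show ?thesis by (simp add: add_increasing)
next
  case False
  then have \<alpha>: "\<alpha> > 0" using assms by simp
  have "c * z / \<alpha> \<le> exp (c * z / \<alpha>)"
    using exp_ge_add_one_self[of "c * z / \<alpha>"] by linarith
  then have "(c * z / \<alpha>) powr \<alpha> \<le> exp (c * z / \<alpha>) powr \<alpha>"
    using assms \<alpha> by (intro powr_mono2) auto
  also have "\<dots> = exp (c * z)"
    using \<alpha> by (simp add: powr_def)
  finally have "(\<alpha> / c) powr \<alpha> * (c * z / \<alpha>) powr \<alpha> \<le> (\<alpha> / c) powr \<alpha> * exp (c * z)"
    by (rule mult_left_mono) simp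
  also have "(\<alpha> / c) powr \<alpha> * (c * z / \<alpha>) powr \<alpha> = z powr \<alpha>"
    using assms \<alpha> by (simp add: powr_mult[symmetric])
  finally have "z powr \<alpha> * exp (- (c * z)) \<le> (\<alpha> / c) powr \<alpha> * exp (c * z) * exp (- (c * z))"
    by (rule mult_right_mono) simp
  also have "\<dots> = (\<alpha> / c) powr \<alpha>"
    by (simp add: mult.assoc exp_add[symmetric])
  finally show ?thesis by simp
qed

text \<open>As \<open>y \<le> 1\<close>, the time \<open>t\<close> may be replaced by \<open>1 + t\<close> at the price of a constant.\<close>

lemma exp_shift_time:
  fixes c t y :: real
  assumes "c \<ge> 0" "0 \<le> y" "y \<le> 1"
  shows "exp (- (y\<^sup>2 * c * t)) \<le> exp c * exp (- (c * ((1 + t) * y\<^sup>2)))"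
proof -
  have "y\<^sup>2 \<le> 1" using assms by (simp add: power_le_one)
  then have "c * y\<^sup>2 \<le> c" using assms by (simp add: mult_left_le)
  then show ?thesis
    by (simp add: exp_add[symmetric] algebra_simps)
qed

text \<open>With \<open>y = 2\<^bsup>-q\<^esup>\<close> the variable \<open>z = (1 + t) y\<^sup>2\<close> is scale invariant: the power of
  \<open>1 + t\<close> comes out, and what remains is a bounded function of \<open>z\<close>.\<close>

lemma high_frequency_weight:
  fixes c t y \<alpha> :: real
  assumes "c > 0" "\<alpha> \<ge> 0" "t \<ge> 0" "0 < y" "y \<le> 1"
  shows "y powr \<alpha> * exp (- (y\<^sup>2 * c * t))
    \<le> exp c * ((\<alpha> / 2 / c) powr (\<alpha> / 2) + 1) * (1 + t) powr (- (\<alpha> / 2))"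
proof -
  define z where "z = (1 + t) * y\<^sup>2"
  have z: "z \<ge> 0" using assms by (simp add: z_def)
  have "z powr (\<alpha> / 2) = (1 + t) powr (\<alpha> / 2) * y powr \<alpha>"
    using assms by (simp add: z_def powr_mult powr_powr powr_numeral[symmetric] del: powr_numeral)
  then have y: "y powr \<alpha> = (1 + t) powr (- (\<alpha> / 2)) * z powr (\<alpha> / 2)"
    using assms by (simp add: powr_minus field_simps)
  have "y powr \<alpha> * exp (- (y\<^sup>2 * c * t)) \<le> y powr \<alpha> * (exp c * exp (- (c * z)))"
    unfolding z_def using assms by (intro mult_left_mono exp_shift_time) auto
  also have "\<dots> = exp c * (1 + t) powr (- (\<alpha> / 2)) * (z powr (\<alpha> / 2) * exp (- (c * z)))"
    unfolding y by (simp only: mult_ac)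
  also have "\<dots> \<le> exp c * (1 + t) powr (- (\<alpha> / 2)) * ((\<alpha> / 2 / c) powr (\<alpha> / 2) + 1)"
    using assms z by (intro mult_left_mono powr_exp_bound) auto
  finally show ?thesis by (simp only: mult_ac)
qed

text \<open>The integer \<open>k\<close> locates \<open>(1 + t)\<^bsup>1/2\<^esup>\<close> on the dyadic scale. Away from the critical frequency
  \<open>2\<^bsup>-k\<^esup>\<close> the weight decays geometrically: towards zero because of the power, in
  the other direction because of the exponential.\<close>

lemma low_frequency_weight:
  fixes c t \<alpha> :: real
  assumes c: "c > 0" and \<alpha>: "\<alpha> > 0" and t: "t \<ge> 0"
  obtains k :: int where "\<And>q::int. q \<le> 0 \<Longrightarrow>
    (2 powr of_int q) powr \<alpha> * exp (- ((2 powr of_int q)\<^sup>2 * c * t))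
    \<le> exp c * ((\<alpha> / c) powr \<alpha> + 1 + 2 powr \<alpha>) * (1 + t) powr (- (\<alpha> / 2)) * 2 powr (- \<alpha> * \<bar>of_int (q + k)\<bar>)"
proof
  define \<tau> where "\<tau> = sqrt (1 + t)"
  have \<tau>: "\<tau> > 0" using t by (simp add: \<tau>_def)
  define k where "k = \<lfloor>log 2 \<tau>\<rfloor>"
  have k: "2 powr of_int k \<le> \<tau>" "\<tau> \<le> 2 powr (of_int k + 1)"
  proof -
    have "of_int k \<le> log 2 \<tau>" by (simp add: k_def)
    then show "2 powr of_int k \<le> \<tau>" using \<tau> by (simp add: le_log_iff)
    have "log 2 \<tau> \<le> of_int k + 1" unfolding k_def by linarith
    then show "\<tau> \<le> 2 powr (of_int k + 1)" using \<tau> by (simp add: log_le_iff)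
  qed
  fix q :: int assume q: "q \<le> 0"
  define b where "b = (2::real) powr of_int q"
  have b: "b > 0" by (simp add: b_def)
  have b1: "b \<le> 1"
    unfolding b_def using q powr_mono[of "of_int q" 0 "2::real"] by simp
  define x where "x = b * \<tau>"
  have x: "x > 0" using b \<tau> by (simp add: x_def)
  define m where "m = q + k"
  have xm: "2 powr of_int m \<le> x" "x \<le> 2 * 2 powr of_int m"
  proof -
    have "b * 2 powr of_int k \<le> x" "x \<le> b * 2 powr (of_int k + 1)"
      unfolding x_def using b k by (auto intro!: mult_left_mono)
    then show "2 powr of_int m \<le> x" "x \<le> 2 * 2 powr of_int m"
      by (simp_all add: b_def m_def powr_add mult_ac)
  qed
  define M where "M = (\<alpha> / c) powr \<alpha> + 1"
  have M: "M > 0" by (simp add: M_def add_nonneg_pos)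
  have "x powr \<alpha> * exp (- (c * x\<^sup>2)) \<le> (M + 2 powr \<alpha>) * 2 powr (- \<alpha> * \<bar>of_int m\<bar>)"
  proof (cases "m \<ge> 0")
    case True
    have "x powr \<alpha> = x powr (- \<alpha>) * (x\<^sup>2) powr \<alpha>"
      using x by (simp add: powr_powr powr_add[symmetric] powr_numeral[symmetric] del: powr_numeral)
    then have "x powr \<alpha> * exp (- (c * x\<^sup>2)) = x powr (- \<alpha>) * ((x\<^sup>2) powr \<alpha> * exp (- (c * x\<^sup>2)))"
      by simp
    also have "\<dots> \<le> x powr (- \<alpha>) * M"
      unfolding M_def using c \<alpha> by (intro mult_left_mono powr_exp_bound) auto
    also have "\<dots> \<le> (2 powr of_int m) powr (- \<alpha>) * M"
      using xm \<alpha> x M by (intro mult_right_mono powr_mono2') auto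
    also have "\<dots> = M * 2 powr (- \<alpha> * \<bar>of_int m\<bar>)"
      using True by (simp add: powr_powr mult_ac)
    also have "\<dots> \<le> (M + 2 powr \<alpha>) * 2 powr (- \<alpha> * \<bar>of_int m\<bar>)"
      by (intro mult_right_mono) auto
    finally show ?thesis .
  next
    case False
    have "x powr \<alpha> * exp (- (c * x\<^sup>2)) \<le> x powr \<alpha> * 1"
      using c by (intro mult_left_mono) auto
    also have "\<dots> \<le> (2 * 2 powr of_int m) powr \<alpha>"
      using xm x \<alpha> by (simp add: powr_mono2)
    also have "\<dots> = 2 powr \<alpha> * 2 powr (- \<alpha> * \<bar>of_int m\<bar>)"
      using False by (simp add: powr_mult powr_powr mult_ac)
    also have "\<dots> \<le> (M + 2 powr \<alpha>) * 2 powr (- \<alpha> * \<bar>of_int m\<bar>)"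
      using M by (intro mult_right_mono) auto
    finally show ?thesis .
  qed
  note main = this
  have bx: "b powr \<alpha> = (1 + t) powr (- (\<alpha> / 2)) * x powr \<alpha>"
  proof -
    have "\<tau> powr \<alpha> = (1 + t) powr (\<alpha> / 2)"
      using t by (simp add: \<tau>_def powr_half_sqrt[symmetric] powr_powr)
    then show ?thesis
      using b \<tau> t by (simp add: x_def powr_mult powr_minus field_simps)
  qed
  have x2: "(1 + t) * b\<^sup>2 = x\<^sup>2"
    using t by (simp add: x_def \<tau>_def power_mult_distrib mult.commute)
  have "b powr \<alpha> * exp (- (b\<^sup>2 * c * t)) \<le> b powr \<alpha> * (exp c * exp (- (c * ((1 + t) * b\<^sup>2))))"
    using b b1 c by (intro mult_left_mono exp_shift_time) auto
  also have "\<dots> = exp c * (1 + t) powr (- (\<alpha> / 2)) * (x powr \<alpha> * exp (- (c * x\<^sup>2)))"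
    unfolding x2 bx by (simp only: mult_ac)
  also have "\<dots> \<le> exp c * (1 + t) powr (- (\<alpha> / 2)) * ((M + 2 powr \<alpha>) * 2 powr (- \<alpha> * \<bar>of_int m\<bar>))"
    using main by (rule mult_left_mono) simp
  also have "\<dots> = exp c * (M + 2 powr \<alpha>) * (1 + t) powr (- (\<alpha> / 2)) * 2 powr (- \<alpha> * \<bar>of_int m\<bar>)"
    by (simp only: mult_ac)
  finally show "(2 powr of_int q) powr \<alpha> * exp (- ((2 powr of_int q)\<^sup>2 * c * t))
    \<le> exp c * ((\<alpha> / c) powr \<alpha> + 1 + 2 powr \<alpha>) * (1 + t) powr (- (\<alpha> / 2)) * 2 powr (- \<alpha> * \<bar>of_int (q + k)\<bar>)"
    unfolding b_def M_def m_def .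
qed

lemma ennreal_regroup:
  "u * v = x * y \<Longrightarrow> 0 \<le> v \<Longrightarrow> 0 \<le> y \<Longrightarrow> ennreal u * (ennreal v * d) = ennreal x * (ennreal y * d)"
  by (simp add: mult.assoc[symmetric] ennreal_mult''[symmetric])

section \<open>The decay estimate\<close>

text \<open>For \<open>q < 0\<close> the supremum over \<open>q\<close> of the data is taken out, and the weights are summable in
  \<open>\<ell>\<^sup>r\<close> uniformly in time because \<open>\<sigma> + s > 0\<close>.\<close>

lemma low_frequency_estimate:
  fixes \<phi> :: "real^'n::finite \<Rightarrow> real"
  assumes \<phi>: "dyadic_partition \<phi>" and r: "1 \<le> r" and pos: "\<sigma> + s > 0"
  obtains C where "C > 0" "\<And>f t. t \<ge> 0 \<Longrightarrow>
    lp_norm (count_space {q. q < 0}) r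
      (\<lambda>q::int. ennreal (2 powr (of_int q * \<sigma>)) * damped_block_norm \<phi> t q f)
    \<le> ennreal C * (ennreal ((1 + t) powr (- ((\<sigma> + s) / 2))) * besov_norm \<phi> (- s) 2 \<infinity> f)"
proof -
  define \<alpha> where "\<alpha> = \<sigma> + s"
  have \<alpha>: "\<alpha> > 0" using pos by (simp add: \<alpha>_def)
  obtain C1 where C1: "C1 > 0" and est: "\<And>q t u. t \<ge> 0 \<Longrightarrow> damped_block_norm \<phi> t q u \<le>
      ennreal (C1 * exp (- ((2 powi (- \<bar>q\<bar>))\<^sup>2 / 6400 * t)) * 2 powr (of_int q * (real CARD('n) * (1 / 2 - 1 / 2))))
        * dist_norm (ennreal 2) (dyadic_block \<phi> q u)"
    by (rule damped_block_norm_estimate[OF \<phi>, of 2]) auto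
  obtain S where S: "S > 0" and geo: "\<And>k::int. lp_norm (count_space UNIV) r (\<lambda>q::int. ennreal (2 powr (- \<alpha> * \<bar>of_int (q + k)\<bar>))) \<le> ennreal S"
    using lp_norm_geometric[OF r \<alpha>] by blast
  define c where "c = 1 / (6400::real)"
  have c: "c > 0" by (simp add: c_def)
  define M where "M = exp c * ((\<alpha> / c) powr \<alpha> + 1 + 2 powr \<alpha>)"
  have M: "M > 0" unfolding M_def by (intro mult_pos_pos add_nonneg_pos) auto
  define C where "C = C1 * M * S"
  have C: "C > 0" using C1 M S by (simp add: C_def)
  show ?thesis
  proof (rule that[OF C])
    fix f and t :: real assume t: "t \<ge> 0"
    define B where "B = besov_norm \<phi> (- s) 2 \<infinity> f"
    define w where "w = (1 + t) powr (- (\<alpha> / 2))"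
    have w: "w > 0" using t by (simp add: w_def)
    let ?a = "\<lambda>q::int. ennreal (2 powr (of_int q * \<sigma>)) * damped_block_norm \<phi> t q f"
    have B: "ennreal (2 powr (of_int q * - s)) * dist_norm 2 (dyadic_block \<phi> q f) \<le> B" for q
      unfolding B_def besov_norm_def lp_norm_def
      using esssup_AE[where M = "count_space UNIV" and f = "\<lambda>q. ennreal (2 powr (of_int q * - s)) * dist_norm 2 (dyadic_block \<phi> q f)"]
      by (simp add: AE_count_space)
    show "lp_norm (count_space {q. q < 0}) r ?a
      \<le> ennreal C * (ennreal ((1 + t) powr (- ((\<sigma> + s) / 2))) * besov_norm \<phi> (- s) 2 \<infinity> f)"
      unfolding B_def[symmetric] \<alpha>_def[symmetric] w_def[symmetric]
    proof (cases "B = top")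
      case True
      then show "lp_norm (count_space {q. q < 0}) r ?a \<le> ennreal C * (ennreal w * B)"
        using C w by (simp add: ennreal_mult_top)
    next
      case False
      then obtain \<beta> where \<beta>: "B = ennreal \<beta>" "\<beta> \<ge> 0" by (cases B) auto
      obtain k :: int where k: "\<And>q::int. q \<le> 0 \<Longrightarrow>
          (2 powr of_int q) powr \<alpha> * exp (- ((2 powr of_int q)\<^sup>2 * c * t)) \<le> M * w * 2 powr (- \<alpha> * \<bar>of_int (q + k)\<bar>)"
        unfolding M_def w_def using low_frequency_weight[OF c \<alpha> t] by blast
      have "lp_norm (count_space {q. q < 0}) r ?a
        \<le> ennreal (C1 * M * w * \<beta>) * lp_norm (count_space UNIV) r (\<lambda>q::int. ennreal (2 powr (- \<alpha> * \<bar>of_int (q + k)\<bar>)))"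
      proof (rule lp_norm_count_space_mono[OF r])
        show "0 \<le> C1 * M * w * \<beta>" using C1 M w \<beta> by simp
        fix q :: int assume "q \<in> {q. q < 0}"
        then have q: "q \<le> 0" "\<bar>q\<bar> = - q" by auto
        define b where "b = (2::real) powr of_int q"
        have pb: "(2::real) powi (- \<bar>q\<bar>) = b"
          unfolding q by (simp add: b_def powr_real_of_int')
        have "?a q \<le> ennreal (2 powr (of_int q * \<sigma>)) * (ennreal (C1 * exp (- (b\<^sup>2 * c * t))) * dist_norm 2 (dyadic_block \<phi> q f))"
          using est[OF t, of q f] by (intro mult_left_mono) (auto simp: pb c_def)
        also have "\<dots> = ennreal (C1 * (b powr \<alpha> * exp (- (b\<^sup>2 * c * t)))) * (ennreal (2 powr (of_int q * - s)) * dist_norm 2 (dyadic_block \<phi> q f))"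
        proof -
          have "2 powr (of_int q * \<sigma>) = b powr \<alpha> * 2 powr (of_int q * - s)"
            by (simp add: b_def powr_powr powr_add[symmetric] \<alpha>_def algebra_simps)
          then have "2 powr (of_int q * \<sigma>) * (C1 * exp (- (b\<^sup>2 * c * t)))
              = C1 * (b powr \<alpha> * exp (- (b\<^sup>2 * c * t))) * 2 powr (of_int q * - s)"
            by (simp only: mult_ac)
          then show ?thesis
            using C1 by (intro ennreal_regroup) auto
        qed
        also have "\<dots> \<le> ennreal (C1 * (M * w * 2 powr (- \<alpha> * \<bar>of_int (q + k)\<bar>))) * ennreal \<beta>"
          using C1 B[of q] unfolding b_def \<beta>(1)
          by (intro mult_mono[OF ennreal_leI[OF mult_left_mono[OF k[OF q(1)]]]]) auto
        also have "\<dots> = ennreal (C1 * M * w * \<beta>) * ennreal (2 powr (- \<alpha> * \<bar>of_int (q + k)\<bar>))"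
        proof -
          have "ennreal (C1 * (M * w * 2 powr (- \<alpha> * \<bar>of_int (q + k)\<bar>))) * ennreal \<beta>
              = ennreal (C1 * (M * w * 2 powr (- \<alpha> * \<bar>of_int (q + k)\<bar>)) * \<beta>)"
            using \<beta> by (simp add: ennreal_mult'')
          also have "C1 * (M * w * 2 powr (- \<alpha> * \<bar>of_int (q + k)\<bar>)) * \<beta> = (C1 * M * w * \<beta>) * 2 powr (- \<alpha> * \<bar>of_int (q + k)\<bar>)"
            by (simp only: mult_ac)
          also have "ennreal \<dots> = ennreal (C1 * M * w * \<beta>) * ennreal (2 powr (- \<alpha> * \<bar>of_int (q + k)\<bar>))"
            by (rule ennreal_mult'') simp
          finally show ?thesis .
        qed
        finally show "?a q \<le> ennreal (C1 * M * w * \<beta>) * ennreal (2 powr (- \<alpha> * \<bar>of_int (q + k)\<bar>))" .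
      qed
      also have "\<dots> \<le> ennreal (C1 * M * w * \<beta>) * ennreal S"
        by (intro mult_left_mono geo) simp
      also have "\<dots> = ennreal C * (ennreal w * B)"
        using C1 M w \<beta> S by (simp add: C_def ennreal_mult'[symmetric] mult_ac)
      finally show "lp_norm (count_space {q. q < 0}) r ?a \<le> ennreal C * (ennreal w * B)" .
    qed
  qed
qed

text \<open>For \<open>q \<ge> 0\<close> the weights only need to be bounded, because the \<open>\<ell>\<^sup>r\<close> sum is already in the norm of
  the data. The exponent \<open>l - n (1/p - 1/2)\<close> is what Bernstein's inequality leaves of the extra regularity \<open>l\<close>.\<close>

lemma high_frequency_estimate:
  fixes \<phi> :: "real^'n::finite \<Rightarrow> real"
  assumes \<phi>: "dyadic_partition \<phi>" and r: "1 \<le> r" and p: "1 \<le> p" "p \<le> 2"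
    and l: "l \<ge> real CARD('n) * (1 / p - 1 / 2)"
  obtains C where "C > 0" "\<And>f t. t \<ge> 0 \<Longrightarrow>
    lp_norm (count_space {q. q \<ge> 0}) r
      (\<lambda>q::int. ennreal (2 powr (of_int q * \<sigma>)) * damped_block_norm \<phi> t q f)
    \<le> ennreal C * (ennreal ((1 + t) powr (- (l / 2) + real CARD('n) / 2 * (1 / p - 1 / 2)))
        * besov_norm \<phi> (\<sigma> + l) (ennreal p) r f)"
proof -
  define \<gamma> where "\<gamma> = real CARD('n) * (1 / p - 1 / 2)"
  define \<alpha> where "\<alpha> = l - \<gamma>"
  have \<alpha>: "\<alpha> \<ge> 0" using l by (simp add: \<alpha>_def \<gamma>_def)
  have exponent: "- (l / 2) + real CARD('n) / 2 * (1 / p - 1 / 2) = - (\<alpha> / 2)"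
  proof -
    have "- (l / 2) + N / 2 * u = - ((l - N * u) / 2)" for N u :: real
      by (simp add: field_simps)
    then show ?thesis unfolding \<alpha>_def \<gamma>_def .
  qed
  obtain C1 where C1: "C1 > 0" and est: "\<And>q t u. t \<ge> 0 \<Longrightarrow> damped_block_norm \<phi> t q u \<le>
      ennreal (C1 * exp (- ((2 powi (- \<bar>q\<bar>))\<^sup>2 / 6400 * t)) * 2 powr (of_int q * \<gamma>))
        * dist_norm (ennreal p) (dyadic_block \<phi> q u)"
    unfolding \<gamma>_def by (rule damped_block_norm_estimate[OF \<phi> p]) auto
  define c where "c = 1 / (6400::real)"
  have c: "c > 0" by (simp add: c_def)
  define M where "M = exp c * ((\<alpha> / 2 / c) powr (\<alpha> / 2) + 1)"
  have M: "M > 0" unfolding M_def by (intro mult_pos_pos add_nonneg_pos) auto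
  have C: "C1 * M > 0" using C1 M by simp
  show ?thesis
  proof (rule that[OF C])
    fix f and t :: real assume t: "t \<ge> 0"
    define w where "w = (1 + t) powr (- (\<alpha> / 2))"
    have w: "w > 0" using t by (simp add: w_def)
    let ?a = "\<lambda>q::int. ennreal (2 powr (of_int q * \<sigma>)) * damped_block_norm \<phi> t q f"
    let ?b = "\<lambda>q::int. ennreal (2 powr (of_int q * (\<sigma> + l))) * dist_norm (ennreal p) (dyadic_block \<phi> q f)"
    have "lp_norm (count_space {q. q \<ge> 0}) r ?a \<le> ennreal (C1 * M * w) * lp_norm (count_space UNIV) r ?b"
    proof (rule lp_norm_count_space_mono[OF r])
      show "0 \<le> C1 * M * w" using C w by simp
      fix q :: int assume "q \<in> {q. q \<ge> 0}"
      then have q: "q \<ge> 0" "\<bar>q\<bar> = q" by auto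
      define y where "y = (2::real) powr (- of_int q)"
      have y: "0 < y" "y \<le> 1"
        unfolding y_def using q powr_mono[of "- of_int q" 0 "2::real"] by auto
      have py: "(2::real) powi (- \<bar>q\<bar>) = y"
        unfolding q y_def by (subst powr_real_of_int'[symmetric]) auto
      have "?a q \<le> ennreal (2 powr (of_int q * \<sigma>)) * (ennreal (C1 * exp (- (y\<^sup>2 * c * t)) * 2 powr (of_int q * \<gamma>)) * dist_norm (ennreal p) (dyadic_block \<phi> q f))"
        using est[OF t, of q f] by (intro mult_left_mono) (auto simp: py c_def)
      also have "\<dots> = ennreal (C1 * (y powr \<alpha> * exp (- (y\<^sup>2 * c * t)))) * ?b q"
      proof -
        have "2 powr (of_int q * \<sigma>) * 2 powr (of_int q * \<gamma>) = y powr \<alpha> * 2 powr (of_int q * (\<sigma> + l))"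
          by (simp add: y_def powr_powr powr_add[symmetric] \<alpha>_def algebra_simps)
        then have "2 powr (of_int q * \<sigma>) * (C1 * exp (- (y\<^sup>2 * c * t)) * 2 powr (of_int q * \<gamma>))
            = C1 * (y powr \<alpha> * exp (- (y\<^sup>2 * c * t))) * 2 powr (of_int q * (\<sigma> + l))"
          by (simp add: mult_ac)
        then show ?thesis
          using C1 by (intro ennreal_regroup) auto
      qed
      also have "\<dots> \<le> ennreal (C1 * (M * w)) * ?b q"
        unfolding M_def w_def using C1 high_frequency_weight[OF c \<alpha> t y]
        by (intro mult_right_mono ennreal_leI mult_left_mono) auto
      finally show "?a q \<le> ennreal (C1 * M * w) * ?b q"
        by (simp add: mult.assoc)
    qed
    also have "ennreal (C1 * M * w) = ennreal (C1 * M) * ennreal w"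
      using w by (intro ennreal_mult'') simp
    finally show "lp_norm (count_space {q. q \<ge> 0}) r ?a
      \<le> ennreal (C1 * M) * (ennreal ((1 + t) powr (- (l / 2) + real CARD('n) / 2 * (1 / p - 1 / 2)))
        * besov_norm \<phi> (\<sigma> + l) (ennreal p) r f)"
      unfolding exponent by (simp add: besov_norm_def w_def mult.assoc)
  qed
qed

theorem proposition3p1:
  fixes \<phi> :: "real^'n::finite \<Rightarrow> real"
    and \<sigma> s l p :: real
    and r :: ennreal
  assumes "dyadic_partition \<phi>"
    and "\<sigma> + s > 0"
    and "1 \<le> r"
    and "1 \<le> p" and "p \<le> 2"
    and "l > real CARD('n) * (1 / p - 1 / 2) \<or> (p = 2 \<and> l \<ge> 0)"
  shows "\<exists>C>0. \<forall>F \<in> besov_space \<phi> (\<sigma> + l) (ennreal p) r \<inter> besov_space \<phi> (- s) 2 \<infinity>.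
    \<forall>f\<in>F. \<forall>t\<ge>0.
      let lhs = (\<lambda>I. lp_norm (count_space I) r
            (\<lambda>q::int. ennreal (2 powr (of_int q * \<sigma>)) * damped_block_norm \<phi> t q f));
          low = ennreal ((1 + t) powr (- ((\<sigma> + s) / 2))) * besov_norm \<phi> (- s) 2 \<infinity> f;
          high = ennreal ((1 + t) powr (- (l / 2) + real CARD('n) / 2 * (1 / p - 1 / 2)))
            * besov_norm \<phi> (\<sigma> + l) (ennreal p) r f
      in lhs UNIV \<le> ennreal C * (low + high) \<and>
         lhs {q. q < 0} \<le> ennreal C * low \<and>
         lhs {q. q \<ge> 0} \<le> ennreal C * high"
proof -
  have l: "l \<ge> real CARD('n) * (1 / p - 1 / 2)"
    using assms(6) by auto
  obtain A where A: "A > 0" and low: "\<And>f t. t \<ge> 0 \<Longrightarrow>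
    lp_norm (count_space {q. q < 0}) r
      (\<lambda>q::int. ennreal (2 powr (of_int q * \<sigma>)) * damped_block_norm \<phi> t q f)
    \<le> ennreal A * (ennreal ((1 + t) powr (- ((\<sigma> + s) / 2))) * besov_norm \<phi> (- s) 2 \<infinity> f)"
    using low_frequency_estimate[OF assms(1,3,2)] by blast
  obtain B where B: "B > 0" and high: "\<And>f t. t \<ge> 0 \<Longrightarrow>
    lp_norm (count_space {q. q \<ge> 0}) r
      (\<lambda>q::int. ennreal (2 powr (of_int q * \<sigma>)) * damped_block_norm \<phi> t q f)
    \<le> ennreal B * (ennreal ((1 + t) powr (- (l / 2) + real CARD('n) / 2 * (1 / p - 1 / 2)))
        * besov_norm \<phi> (\<sigma> + l) (ennreal p) r f)"
    using high_frequency_estimate[OF assms(1,3,4,5) l] by blast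
  have combine: "u \<le> ennreal (2 * (A + B)) * (x + y) \<and> v \<le> ennreal (2 * (A + B)) * x \<and> w \<le> ennreal (2 * (A + B)) * y"
    if "u \<le> 2 * (v + w)" "v \<le> ennreal A * x" "w \<le> ennreal B * y" for u v w x y
  proof (intro conjI)
    have le: "A \<le> 2 * (A + B)" "B \<le> 2 * (A + B)" "A \<le> A + B" "B \<le> A + B"
      using A B by auto
    note AB = le[THEN ennreal_leI]
    show "v \<le> ennreal (2 * (A + B)) * x"
      using that(2) by (rule order_trans) (intro mult_right_mono AB, simp)
    show "w \<le> ennreal (2 * (A + B)) * y"
      using that(3) by (rule order_trans) (intro mult_right_mono AB, simp)
    have "v + w \<le> ennreal (A + B) * x + ennreal (A + B) * y"
      using that(2,3) AB by (intro add_mono) (auto elim!: order_trans intro!: mult_right_mono)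
    then have "2 * (v + w) \<le> 2 * (ennreal (A + B) * (x + y))"
      by (intro mult_left_mono) (auto simp: distrib_left)
    also have "\<dots> = ennreal (2 * (A + B)) * (x + y)"
    proof -
      have "ennreal (2 * (A + B)) = ennreal 2 * ennreal (A + B)"
        by (rule ennreal_mult') simp
      then show ?thesis by (simp only: ennreal_numeral mult.assoc)
    qed
    finally show "u \<le> ennreal (2 * (A + B)) * (x + y)"
      using that(1) by (rule order_trans[rotated])
  qed
  have compl: "- {q::int. q < 0} = {q. q \<ge> 0}" by auto
  show ?thesis
    unfolding Let_def
  proof (intro exI[of _ "2 * (A + B)"] conjI[of "2 * (A + B) > 0"] ballI allI impI, goal_cases)
    case 1
    then show ?case using A B by simp
  next
    case (2 F f t)
    show ?case
      using lp_norm_split[OF assms(3), of "\<lambda>q::int. ennreal (2 powr (of_int q * \<sigma>)) * damped_block_norm \<phi> t q f" "{q. q < 0}"]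
        low[OF 2(3), of f] high[OF 2(3), of f]
      unfolding compl by (rule combine)
  qed
qed

end
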